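(* Let $G$ be a locally compact second countable group and let $(X,\nu)$, $(Y,\eta)$, $(Z,\zeta)$ and $(W,\rho)$ be $G$-spaces with $G$-maps $\psi:(W,\rho)\to(X,\nu)$, $\tau:(W,\rho)\to(Y,\eta)$, $\pi:(X,\nu)\to(Z,\zeta)$ and $\varphi:(Y,\eta)\to(Z,\zeta)$ such that $\pi\circ\psi=\varphi\circ\tau$ almost everywhere. If $\tau$ and $\pi$ are relatively measure-preserving and $\psi$ and $\varphi$ are relatively contractive, then $(W,\rho)$ is $G$-isomorphic to the independent relative joining of $(X,\nu)$ and $(Y,\eta)$ over $(Z,\zeta)$.
   Context: A $G$-space is a (standard) probability space $(X,\nu)$ with a measurable action of $G$ preserving the class of $\nu$-null sets. A $G$-map $\pi:(X,\nu)\to(Y,\eta)$ is a measurable map with $\pi_*\nu=\eta$ and $\pi(gx)=g\pi(x)$ for all $g$ and almost every $x$. Its disintegration $D_\pi:Y\to P(X)$ is the a.e. unique map with $D_\pi(y)$ supported on $\pi^{-1}(y)$ and $\int_Y D_\pi(y)\,d\eta(y)=\nu$. For a measure $m$, $gm(E)=m(g^{-1}E)$. $\pi$ is relatively measure-preserving when $D_\pi(gy)=gD_\pi(y)$ for all $g\in G$ and almost every $y$. $\pi$ is relatively contractive when for every measurable $E\subseteq X$ and almost every $y\in Y$ with $D_\pi(y)(E)>0$ there is a sequence $\{g_n\}$ in $G$ with $(g_n^{-1}D_\pi(g_ny))(E)\to 1$. The independent relative joining of $(X,\nu)$ and $(Y,\eta)$ over the common quotient $(Z,\zeta)$, with quotient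 maps $\pi:X\to Z$ and $\varphi:Y\to Z$, is $X\times Y$ with the diagonal action and the measure $\int_Z D_\pi(z)\times D_\varphi(z)\,d\zeta(z)$. *)

theory Defs
  imports "HOL-Analysis.Analysis" "HOL-Probability.Probability"
begin

text \<open>
  The acting group is a type of class \<^class>\<open>topological_group_add\<close>. That class is not commutative;
  the product \<open>gh\<close> is written \<open>g + h\<close>, the unit \<open>0\<close> and the inverse \<open>- g\<close>.
  A standard Borel space is the Borel space of a Polish space, hence a type of class
  \<^class>\<open>polish_space\<close> with the sigma-algebra of \<^term>\<open>borel\<close>.
\<close>

instance prod :: (polish_space, polish_space) polish_space ..

definition G_space :: "('g::topological_group_add \<Rightarrow> 'x::polish_space \<Rightarrow> 'x) \<Rightarrow> 'x measure \<Rightarrow> bool" where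
  "G_space act \<nu> \<longleftrightarrow>
     prob_space \<nu> \<and> sets \<nu> = sets borel \<and>
     (\<forall>x. act 0 x = x) \<and> (\<forall>g h x. act (g + h) x = act g (act h x)) \<and>
     (\<lambda>(g, x). act g x) \<in> borel \<Otimes>\<^sub>M borel \<rightarrow>\<^sub>M borel \<and>
     (\<forall>g. \<forall>N \<in> sets \<nu>. act g -` N \<in> null_sets \<nu> \<longleftrightarrow> N \<in> null_sets \<nu>)"

text \<open>Equivariance holds for each \<open>g\<close> outside a null set that may depend on \<open>g\<close>.\<close>

definition G_map ::
  "('g \<Rightarrow> 'x::polish_space \<Rightarrow> 'x) \<Rightarrow> 'x measure \<Rightarrow> ('g \<Rightarrow> 'y::polish_space \<Rightarrow> 'y) \<Rightarrow> 'y measure \<Rightarrow>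
   ('x \<Rightarrow> 'y) \<Rightarrow> bool" where
  "G_map actX \<nu> actY \<eta> \<pi> \<longleftrightarrow>
     \<pi> \<in> borel \<rightarrow>\<^sub>M borel \<and> distr \<nu> borel \<pi> = \<eta> \<and>
     (\<forall>g. AE x in \<nu>. \<pi> (actX g x) = actY g (\<pi> x))"

definition G_isomorphic ::
  "('g::topological_group_add \<Rightarrow> 'x::polish_space \<Rightarrow> 'x) \<Rightarrow> 'x measure \<Rightarrow>
   ('g \<Rightarrow> 'y::polish_space \<Rightarrow> 'y) \<Rightarrow> 'y measure \<Rightarrow> bool" where
  "G_isomorphic actX \<nu> actY \<eta> \<longleftrightarrow>
     G_space actX \<nu> \<and> G_space actY \<eta> \<and>
     (\<exists>f h. G_map actX \<nu> actY \<eta> f \<and> G_map actY \<eta> actX \<nu> h \<and>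
            (AE x in \<nu>. h (f x) = x) \<and> (AE y in \<eta>. f (h y) = y))"

definition translate :: "('g \<Rightarrow> 'x::topological_space \<Rightarrow> 'x) \<Rightarrow> 'g \<Rightarrow> 'x measure \<Rightarrow> 'x measure" where
  "translate act g m = distr m borel (act g)"

text \<open>
  A disintegration is determined only up to a null set of \<open>y\<close>; the following predicate describes
  its versions. Here \<open>\<eta> \<bind> D\<close> is the integral of \<open>D y\<close> with respect to \<open>\<eta>\<close>.
\<close>

definition disintegration ::
  "'x::polish_space measure \<Rightarrow> 'y::polish_space measure \<Rightarrow> ('x \<Rightarrow> 'y) \<Rightarrow> ('y \<Rightarrow> 'x measure) \<Rightarrow> bool" where
  "disintegration \<nu> \<eta> \<pi> D \<longleftrightarrow>
     D \<in> \<eta> \<rightarrow>\<^sub>M prob_algebra borel \<and>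
     (AE y in \<eta>. emeasure (D y) (\<pi> -` {y}) = 1) \<and>
     \<eta> \<bind> D = \<nu>"

definition rel_measure_preserving ::
  "('g \<Rightarrow> 'x::polish_space \<Rightarrow> 'x) \<Rightarrow> 'x measure \<Rightarrow> ('g \<Rightarrow> 'y::polish_space \<Rightarrow> 'y) \<Rightarrow> 'y measure \<Rightarrow>
   ('x \<Rightarrow> 'y) \<Rightarrow> bool" where
  "rel_measure_preserving actX \<nu> actY \<eta> \<pi> \<longleftrightarrow>
     (\<forall>D. disintegration \<nu> \<eta> \<pi> D \<longrightarrow>
        (\<forall>g. AE y in \<eta>. D (actY g y) = translate actX g (D y)))"

text \<open>
  The sequence in the next definition depends on \<open>y\<close>. As the group may be uncountable, changing
  \<open>D\<close> on a null set \<open>N\<close> can affect the condition at every \<open>y\<close> whose orbit meets \<open>N\<close>, so a single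
  badly chosen version could satisfy it spuriously (for instance for the projection of a product
  with trivial action on one factor). The condition is therefore required of every version.
\<close>

definition rel_contractive ::
  "('g::uminus \<Rightarrow> 'x::polish_space \<Rightarrow> 'x) \<Rightarrow> 'x measure \<Rightarrow> ('g \<Rightarrow> 'y::polish_space \<Rightarrow> 'y) \<Rightarrow> 'y measure \<Rightarrow>
   ('x \<Rightarrow> 'y) \<Rightarrow> bool" where
  "rel_contractive actX \<nu> actY \<eta> \<pi> \<longleftrightarrow>
     (\<forall>D. disintegration \<nu> \<eta> \<pi> D \<longrightarrow>
        (\<forall>E \<in> sets borel. AE y in \<eta>. measure (D y) E > 0 \<longrightarrow>
           (\<exists>g :: nat \<Rightarrow> 'g.
              (\<lambda>n. measure (translate actX (- g n) (D (actY (g n) y))) E) \<longlonglongrightarrow> 1)))"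

definition diagonal_action :: "('g \<Rightarrow> 'x \<Rightarrow> 'x) \<Rightarrow> ('g \<Rightarrow> 'y \<Rightarrow> 'y) \<Rightarrow> 'g \<Rightarrow> 'x \<times> 'y \<Rightarrow> 'x \<times> 'y" where
  "diagonal_action actX actY g = map_prod (actX g) (actY g)"

text \<open>The measure below does not depend on which versions of the disintegrations are chosen.\<close>

definition rel_joining ::
  "'x::polish_space measure \<Rightarrow> 'y::polish_space measure \<Rightarrow> 'z::polish_space measure \<Rightarrow>
   ('x \<Rightarrow> 'z) \<Rightarrow> ('y \<Rightarrow> 'z) \<Rightarrow> ('x \<times> 'y) measure" where
  "rel_joining \<nu> \<eta> \<zeta> \<pi> \<phi> =
     \<zeta> \<bind> (\<lambda>z. (SOME D. disintegration \<nu> \<zeta> \<pi> D) z \<Otimes>\<^sub>M (SOME D. disintegration \<eta> \<zeta> \<phi> D) z)"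

end

theory Submission
  imports Defs
begin

text \<open>
  Let \<open>p w = (\<psi> w, \<tau> w)\<close>. The isomorphism is \<open>p\<close>, and there are two things to see: the law of \<open>p\<close>
  is the independent relative joining, and \<open>p\<close> loses no information about \<open>w\<close> up to null sets.
  Both come from playing contraction against preservation, through two principles that speak only
  of measures of sets.

  \<^item> Contraction (lemma \<open>contractive_null\<close>): let \<open>\<pi> : X \<rightarrow> Y\<close> be relatively contractive and
    \<open>c < 1\<close>. If for every \<open>g\<close> the translate \<open>g E\<close> has conditional probability at most \<open>c\<close> over almost
    every point of \<open>Y\<close>, then \<open>E\<close> is null: otherwise some translates of \<open>E\<close> would have conditional
    probabilities tending to 1.
  \<^item> Preservation (lemma \<open>rel_measure_preserving_transfer\<close>): if \<open>\<pi>\<close> is relatively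
    measure-preserving, an inequality between the conditional probabilities of \<open>S\<close> and \<open>T\<close> over \<open>Y\<close>
    passes to \<open>g S\<close> and \<open>g T\<close> for every \<open>g\<close>, because translating only moves the fibre measures around.

  For the law of \<open>p\<close>, compare for a set \<open>A\<close> in \<open>X\<close> its conditional probability \<open>f\<close> given \<open>Y\<close> with its
  conditional probability \<open>q\<close> given \<open>Z\<close>. If \<open>f \<ge> s > t \<ge> q\<close> on a set \<open>B\<close> in \<open>Y\<close>, preservation for
  \<open>\<tau>\<close> and \<open>\<pi>\<close> transports both bounds to all translates; averaging over the fibres of \<open>\<phi>\<close> then shows
  that every translate of \<open>B\<close> has conditional probability at most \<open>t / s\<close> over \<open>Z\<close>, so \<open>B\<close> is null as
  \<open>\<phi>\<close> is contractive. Hence \<open>f \<le> q\<close>, and the integrals agree, so given \<open>Z\<close> the coordinates \<open>\<psi>\<close> and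
  \<open>\<tau>\<close> are independent. For the second point, let \<open>f\<close> be the conditional probability of a set \<open>E\<close> in \<open>W\<close>
  given \<open>p\<close>. The part of \<open>E\<close> where \<open>f \<le> c\<close> keeps conditional probability at most \<open>c\<close> over \<open>X\<close> under all
  translations, by preservation for \<open>\<tau>\<close>, so it is null as \<open>\<psi>\<close> is contractive. Thus \<open>f\<close> only takes
  the values 0 and 1, and every Borel set of \<open>W\<close> comes from \<open>X \<times> Y\<close>; this yields a Borel inverse.

  The delicate point is in the first principle. The bounds hold for each \<open>g\<close> and almost every \<open>y\<close>,
  whereas the contracting sequence depends on \<open>y\<close> and ranges over an uncountable group. Here local
  compactness enters: with a finite measure on \<open>G\<close> whose null sets are left-invariant (equivalent to
  Haar measure), Fubini's theorem turns the bounds into bounds for almost every \<open>g\<close> at a fixed \<open>y\<close>, and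
  replacing \<open>E\<close> by the set of points that lie in \<open>h E\<close> for most \<open>h\<close> in a piece \<open>C\<close> of the group turns
  them into bounds for every \<open>g\<close> and \<open>y\<close> (lemma \<open>smoothed_set_small\<close>). Haar measure comes from
  Weil's covering indices (lemma \<open>left_invariant_content\<close>), and disintegrations exist because a Polish
  space can be coded by real numbers (theorem \<open>disintegration_exists\<close>).
\<close>

section \<open>Measures from contents on compact sets\<close>

text \<open>Disjoint compact sets have disjoint open neighbourhoods; cutting these away from \<open>K\<close> splits it.
  This is what makes the inner content of open sets subadditive.\<close>
lemma compact_cover_split:
  fixes K :: "'a::t2_space set"
  assumes K: "compact K" and U: "open U" "open V" and sub: "K \<subseteq> U \<union> V"
  obtains A B where "compact A" "compact B" "A \<subseteq> U" "B \<subseteq> V" "K = A \<union> B"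
proof -
  have comp: "compactin euclidean (K - U)" "compactin euclidean (K - V)"
    using K U by (simp_all add: compact_diff)
  have haus: "Hausdorff_space (euclidean :: 'a topology)"
    unfolding Hausdorff_space_def using hausdorff by (auto simp: disjnt_def)
  have disj: "disjnt (K - U) (K - V)" using sub by (auto simp: disjnt_def)
  obtain P Q where "openin euclidean P" "openin euclidean Q" and PQ: "K - U \<subseteq> P" "K - V \<subseteq> Q" "disjnt P Q"
    by (rule Hausdorff_space_compact_separation[OF haus comp disj])
  then have "open P" "open Q" by simp_all
  show ?thesis
  proof
    show "compact (K - P)" "compact (K - Q)" using K \<open>open P\<close> \<open>open Q\<close> by (simp_all add: compact_diff)
  qed (use PQ in \<open>auto simp: disjnt_def\<close>)
qed

text \<open>A content on compact sets extends to a Borel measure: first to open sets from inside, then to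
  all sets from outside; the outer measure so obtained makes open sets measurable in the sense of
  Caratheodory.\<close>
locale compact_content =
  fixes c :: "'a::t2_space set \<Rightarrow> ennreal"
  assumes mono: "\<lbrakk>compact K; compact L; K \<subseteq> L\<rbrakk> \<Longrightarrow> c K \<le> c L"
    and subadditive: "\<lbrakk>compact K; compact L\<rbrakk> \<Longrightarrow> c (K \<union> L) \<le> c K + c L"
    and additive: "\<lbrakk>compact K; compact L; K \<inter> L = {}\<rbrakk> \<Longrightarrow> c (K \<union> L) = c K + c L"
    and finite: "compact K \<Longrightarrow> c K < \<infinity>"
begin

definition inner_content :: "'a set \<Rightarrow> ennreal" where
  "inner_content U = (SUP K\<in>{K. compact K \<and> K \<subseteq> U}. c K)"

definition outer_content :: "'a set \<Rightarrow> ennreal" where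
  "outer_content A = (INF U\<in>{U. open U \<and> A \<subseteq> U}. inner_content U)"

lemma content_empty: "c {} = 0"
proof -
  have "c {} = c {} + c {}" using additive[of "{}" "{}"] by simp
  then show ?thesis using finite[of "{}"]
    by (metis compact_empty ennreal_add_left_cancel infinity_ennreal_def add.right_neutral less_irrefl)
qed

lemma inner_upper: "compact K \<Longrightarrow> K \<subseteq> U \<Longrightarrow> c K \<le> inner_content U"
  unfolding inner_content_def by (rule SUP_upper) auto

lemma inner_mono: "U \<subseteq> V \<Longrightarrow> inner_content U \<le> inner_content V"
  unfolding inner_content_def by (rule SUP_subset_mono) auto

lemma inner_empty: "inner_content {} = 0"
  unfolding inner_content_def by (auto simp: content_empty intro!: antisym SUP_least)

lemma outer_mono: "A \<subseteq> B \<Longrightarrow> outer_content A \<le> outer_content B"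
  unfolding outer_content_def by (rule INF_superset_mono) auto

lemma outer_open: "open U \<Longrightarrow> outer_content U = inner_content U"
  unfolding outer_content_def by (intro antisym INF_lower INF_greatest inner_mono) auto

lemma outer_empty: "outer_content {} = 0"
  by (simp add: outer_open inner_empty)

lemma inner_Un_le:
  assumes "open U" "open V"
  shows "inner_content (U \<union> V) \<le> inner_content U + inner_content V"
  unfolding inner_content_def[of "U \<union> V"]
proof (rule SUP_least, clarsimp)
  fix K assume "compact K" "K \<subseteq> U \<union> V"
  then obtain A B where *: "compact A" "compact B" "A \<subseteq> U" "B \<subseteq> V" "K = A \<union> B"
    using compact_cover_split assms by metis
  then have "c K \<le> c A + c B" by (auto intro: subadditive)
  also have "\<dots> \<le> inner_content U + inner_content V" using * by (intro add_mono inner_upper)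
  finally show "c K \<le> inner_content U + inner_content V" .
qed

text \<open>A compact subset of a countable union of open sets lies in a finite union, so finite
  subadditivity is enough.\<close>
lemma inner_UN_le:
  fixes U :: "nat \<Rightarrow> 'a set"
  assumes U: "\<And>n. open (U n)"
  shows "inner_content (\<Union>n. U n) \<le> (\<Sum>n. inner_content (U n))"
  unfolding inner_content_def[of "\<Union>n. U n"]
proof (rule SUP_least, clarsimp)
  fix K assume K: "compact K" "K \<subseteq> (\<Union>n. U n)"
  have fin: "inner_content (\<Union>i\<in>I. U i) \<le> (\<Sum>i\<in>I. inner_content (U i))" if "finite I" for I
    using that
  proof induction
    case (insert i I)
    have "inner_content (\<Union>i\<in>insert i I. U i) \<le> inner_content (U i) + inner_content (\<Union>i\<in>I. U i)"
      using inner_Un_le[of "U i" "\<Union>i\<in>I. U i"] U by auto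
    then show ?case using insert by (auto intro: order_trans add_left_mono)
  qed (simp add: inner_empty)
  obtain I where I: "finite I" "K \<subseteq> (\<Union>i\<in>I. U i)"
    by (rule compactE_image[OF K(1), of UNIV U]) (use U K(2) in auto)
  have "c K \<le> (\<Sum>i\<in>I. inner_content (U i))"
    using inner_upper[OF K(1) I(2)] fin[OF I(1)] by (rule order_trans)
  also have "\<dots> \<le> (\<Sum>n. inner_content (U n))"
    by (rule sum_le_suminf) (use I in auto)
  finally show "c K \<le> (\<Sum>n. inner_content (U n))" .
qed

lemma outer_UN_le:
  fixes A :: "nat \<Rightarrow> 'a set"
  shows "outer_content (\<Union>n. A n) \<le> (\<Sum>n. outer_content (A n))"
proof (rule ennreal_le_epsilon)
  fix e :: real assume "0 < e" and fin: "(\<Sum>n. outer_content (A n)) < top"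
  then have "outer_content (A n) < outer_content (A n) + e * (1/2)^Suc n" for n
    by (auto simp add: less_top dest!: ennreal_suminf_lessD)
  then have "\<exists>U\<in>{U. open U \<and> A n \<subseteq> U}. inner_content U < outer_content (A n) + e * (1/2)^Suc n" for n
    by (simp only: INF_less_iff[symmetric] outer_content_def[symmetric])
  then have "\<forall>n. \<exists>U. U \<in> {U. open U \<and> A n \<subseteq> U} \<and> inner_content U < outer_content (A n) + ennreal (e * (1/2)^Suc n)"
    unfolding Bex_def by (rule allI)
  from choice[OF this] obtain U where "\<forall>n. U n \<in> {U. open U \<and> A n \<subseteq> U} \<and>
      inner_content (U n) < outer_content (A n) + ennreal (e * (1/2)^Suc n)" ..
  then have U: "open (U n)" "A n \<subseteq> U n" "inner_content (U n) < outer_content (A n) + ennreal (e * (1/2)^Suc n)" for n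
    by auto
  have "outer_content (\<Union>n. A n) \<le> inner_content (\<Union>n. U n)"
    unfolding outer_content_def by (rule INF_lower) (use U in auto)
  also have "\<dots> \<le> (\<Sum>n. inner_content (U n))" by (rule inner_UN_le) fact
  also have "\<dots> \<le> (\<Sum>n. outer_content (A n) + ennreal (e * (1/2)^Suc n))"
    by (rule suminf_le) (use U in \<open>auto intro: less_imp_le\<close>)
  also have "\<dots> = (\<Sum>n. outer_content (A n)) + (\<Sum>n. ennreal e * ennreal ((1/2) ^ Suc n))"
    using \<open>0 < e\<close> by (subst suminf_add[symmetric])
       (auto simp del: ennreal_suminf_cmult simp add: ennreal_mult[symmetric])
  also have "\<dots> = (\<Sum>n. outer_content (A n)) + e"
    unfolding ennreal_suminf_cmult
    by (subst suminf_ennreal_eq[OF zero_le_power power_half_series]) auto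
  finally show "outer_content (\<Union>n. A n) \<le> (\<Sum>n. outer_content (A n)) + e" .
qed

lemma outer_measure_space_outer: "outer_measure_space UNIV outer_content"
  unfolding outer_measure_space_def positive_def increasing_def countably_subadditive_def
  using outer_empty outer_mono outer_UN_le by auto

text \<open>If \<open>C\<close> is a compact subset of \<open>V \<inter> U\<close> and \<open>D\<close> is a compact subset of \<open>V - C\<close>, then \<open>C\<close> and \<open>D\<close> are
  disjoint and the content of \<open>C \<union> D\<close> is the sum. The supremum over \<open>D\<close> and then over \<open>C\<close> gives the
  half of Caratheodory's condition that is not subadditivity.\<close>
lemma inner_split:
  assumes "open U" "open V"
  shows "outer_content (V \<inter> U) + outer_content (V - U) \<le> inner_content V"
proof -
  have "c C + outer_content (V - U) \<le> inner_content V" if C: "compact C" "C \<subseteq> V \<inter> U" for C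
  proof -
    have op: "open (V - C)" using assms C by (auto intro: open_Diff compact_imp_closed)
    have "outer_content (V - U) \<le> inner_content (V - C)"
      unfolding outer_content_def by (rule INF_lower) (use op C in auto)
    moreover have "c C + inner_content (V - C) \<le> inner_content V"
    proof -
      have "c C + c D \<le> inner_content V" if "compact D" "D \<subseteq> V - C" for D
      proof -
        have "c C + c D = c (C \<union> D)" using that C by (intro additive[symmetric]) auto
        also have "\<dots> \<le> inner_content V" by (rule inner_upper) (use that C in auto)
        finally show ?thesis .
      qed
      then show ?thesis
        unfolding inner_content_def[of "V - C"]
        by (subst ennreal_SUP_add_right) (auto intro!: SUP_least)
    qed
    ultimately show ?thesis by (meson add_left_mono order_trans)
  qed
  moreover have "outer_content (V \<inter> U) = (SUP C\<in>{C. compact C \<and> C \<subseteq> V \<inter> U}. c C)"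
    using assms by (subst outer_open) (auto simp: inner_content_def)
  ultimately show ?thesis
    by (simp, subst ennreal_SUP_add_left[symmetric]) (auto intro!: SUP_least)
qed

lemma open_lambda_system:
  assumes U: "open U"
  shows "U \<in> lambda_system UNIV UNIV outer_content"
proof -
  have le: "outer_content (A \<inter> U) + outer_content (A - U) \<le> outer_content A" for A
    unfolding outer_content_def[of A]
  proof (rule INF_greatest, clarsimp)
    fix V assume V: "open V" "A \<subseteq> V"
    have "outer_content (A \<inter> U) + outer_content (A - U) \<le> outer_content (V \<inter> U) + outer_content (V - U)"
      using V by (intro add_mono outer_mono) auto
    also have "\<dots> \<le> inner_content V" by (rule inner_split) fact+
    finally show "outer_content (A \<inter> U) + outer_content (A - U) \<le> inner_content V" .
  qed
  have ge: "outer_content A \<le> outer_content (A \<inter> U) + outer_content (A - U)" for A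
  proof -
    have "outer_content A = outer_content (\<Union>n. if n = 0 then A \<inter> U else if n = Suc 0 then A - U else {})"
      by (rule arg_cong[of _ _ outer_content]) (auto split: if_splits)
    also have "\<dots> \<le> (\<Sum>n. outer_content (if n = 0 then A \<inter> U else if n = Suc 0 then A - U else {}))"
      by (rule outer_UN_le)
    also have "\<dots> = (\<Sum>n\<in>{0, Suc 0}. outer_content (if n = 0 then A \<inter> U else if n = Suc 0 then A - U else {}))"
      by (rule suminf_finite) (auto simp: outer_empty)
    finally show ?thesis by simp
  qed
  have "algebra UNIV (UNIV :: 'a set set)" using algebra_Pow[of "UNIV :: 'a set"] by simp
  from algebra.lambda_system_eq[OF this] show ?thesis
    using le ge by (auto intro: antisym)
qed

definition content_measure :: "'a measure" where
  "content_measure = measure_of UNIV (sets borel) outer_content"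

lemma sets_content_measure [measurable_cong, simp]: "sets content_measure = sets borel"
  and space_content_measure [simp]: "space content_measure = UNIV"
  unfolding content_measure_def using sets.sigma_sets_eq[of "borel::'a measure"] by (auto simp: sets_measure_of_conv space_measure_of_conv)

lemma emeasure_content_measure:
  assumes "A \<in> sets borel"
  shows "emeasure content_measure A = outer_content A"
proof -
  let ?L = "lambda_system UNIV UNIV outer_content"
  have sa: "sigma_algebra UNIV (UNIV :: 'a set set)" using sigma_algebra_Pow[of "UNIV :: 'a set"] by simp
  have ms: "measure_space UNIV ?L outer_content"
    by (rule sigma_algebra.caratheodory_lemma[OF sa outer_measure_space_outer])
  then have saL: "sigma_algebra UNIV ?L" and ca: "countably_additive ?L outer_content"
    by (auto simp: measure_space_def)
  have "sets borel \<subseteq> ?L"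
    unfolding borel_def by (simp, intro sigma_algebra.sigma_sets_subset[OF saL])
      (auto simp: open_lambda_system)
  then have "countably_additive (sets borel) outer_content"
    using ca unfolding countably_additive_def by blast
  moreover have "positive (sets borel) outer_content" by (simp add: positive_def outer_empty)
  ultimately show ?thesis
    using assms sets.sigma_algebra_axioms[of "borel::'a measure"] unfolding content_measure_def
    by (intro emeasure_measure_of_sigma) (auto simp: )
qed

end

section \<open>A left quasi-invariant measure on a locally compact group\<close>

lemma left_translate_eq_vimage: "(+) a ` A = (+) (- a) -` (A :: 'g::group_add set)"
proof (rule set_eqI)
  fix x
  have "x \<in> (+) a ` A" if "- a + x \<in> A"
    using imageI[OF that, of "(+) a"] by (simp add: add.assoc[symmetric])
  then show "x \<in> (+) a ` A \<longleftrightarrow> x \<in> (+) (- a) -` A" by (auto simp: add.assoc[symmetric])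
qed

lemma left_translate_cancel: "(+) (- a) ` (+) a ` A = (A :: 'g::group_add set)"
  by (simp add: image_image add.assoc[symmetric])

lemma open_left_translate:
  fixes U :: "'g::topological_group_add set"
  assumes "open U" shows "open ((+) a ` U)"
  unfolding left_translate_eq_vimage by (rule open_vimage[OF assms]) (intro continuous_intros)

lemma compact_left_translate:
  fixes K :: "'g::topological_group_add set"
  assumes "compact K" shows "compact ((+) a ` K)"
  by (rule compact_continuous_image[OF _ assms]) (intro continuous_intros)

lemma compact_content_translate:
  fixes c :: "'g::{topological_group_add, t2_space} set \<Rightarrow> ennreal"
  assumes c: "compact_content c"
    and inv: "\<And>a K. compact K \<Longrightarrow> c ((+) a ` K) = c K"
  shows "compact_content.outer_content c ((+) a ` A) = compact_content.outer_content c A"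
proof -
  interpret compact_content c by fact
  have inner_le: "inner_content U \<le> inner_content ((+) b ` U)" for b U
    unfolding inner_content_def[of U]
  proof (rule SUP_least, clarsimp)
    fix K assume K: "compact K" "K \<subseteq> U"
    then have "c K = c ((+) b ` K)" by (simp add: inv)
    also have "\<dots> \<le> inner_content ((+) b ` U)" using K compact_left_translate by (intro inner_upper) auto
    finally show "c K \<le> inner_content ((+) b ` U)" .
  qed
  have inner_eq: "inner_content ((+) b ` U) = inner_content U" for b U
    using inner_le[of U b] inner_le[of "(+) b ` U" "- b"] by (simp add: left_translate_cancel)
  have outer_le: "outer_content ((+) b ` A) \<le> outer_content A" for b A
    unfolding outer_content_def[of A]
  proof (rule INF_greatest, clarsimp)
    fix U assume "open U" "A \<subseteq> U"
    then have "outer_content ((+) b ` A) \<le> inner_content ((+) b ` U)"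
      unfolding outer_content_def by (intro INF_lower) (auto simp: open_left_translate)
    then show "outer_content ((+) b ` A) \<le> inner_content U" by (simp add: inner_eq)
  qed
  show ?thesis
    using outer_le[of a A] outer_le[of "- a" "(+) a ` A"] by (simp add: left_translate_cancel)
qed

text \<open>The index \<open>(K : U)\<close> from Weil's construction of Haar measure.\<close>
definition cover_number :: "'g::plus set \<Rightarrow> 'g set \<Rightarrow> nat" where
  "cover_number U K = (LEAST n. \<exists>T. finite T \<and> K \<subseteq> (\<Union>t\<in>T. (+) t ` U) \<and> card T = n)"

lemma cover_number_le:
  assumes "finite T" "K \<subseteq> (\<Union>t\<in>T. (+) t ` U)"
  shows "cover_number U K \<le> card T"
  unfolding cover_number_def by (rule Least_le) (use assms in auto)

lemma compact_translates_cover: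
  fixes U :: "'g::topological_group_add set"
  assumes K: "compact K" and U: "open U" "0 \<in> U"
  obtains T where "finite T" "K \<subseteq> (\<Union>t\<in>T. (+) t ` U)"
proof -
  have "K \<subseteq> (\<Union>t\<in>K. (+) t ` U)"
    using U(2) by (force simp: image_iff intro: bexI[where x=0])
  then obtain T where "T \<subseteq> K" "finite T" "K \<subseteq> (\<Union>t\<in>T. (+) t ` U)"
    by (rule compactE_image[OF K, of K "\<lambda>t. (+) t ` U", rotated]) (auto simp: open_left_translate U)
  then show ?thesis using that by blast
qed

lemma cover_number_ex:
  fixes U :: "'g::topological_group_add set"
  assumes "compact K" "open U" "0 \<in> U"
  obtains T where "finite T" "K \<subseteq> (\<Union>t\<in>T. (+) t ` U)" "card T = cover_number U K"
proof -
  have "\<exists>n T. finite T \<and> K \<subseteq> (\<Union>t\<in>T. (+) t ` U) \<and> card T = n"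
    using compact_translates_cover[OF assms] by metis
  from LeastI_ex[OF this] show ?thesis
    unfolding cover_number_def[symmetric] using that by blast
qed

lemma cover_number_mono:
  fixes U :: "'g::topological_group_add set"
  assumes "compact L" "open U" "0 \<in> U" "K \<subseteq> L"
  shows "cover_number U K \<le> cover_number U L"
proof -
  obtain T where "finite T" "L \<subseteq> (\<Union>t\<in>T. (+) t ` U)" "card T = cover_number U L"
    using cover_number_ex[OF assms(1-3)] .
  then show ?thesis using cover_number_le[of T K U] assms(4) by auto
qed

lemma cover_number_Un:
  fixes U :: "'g::topological_group_add set"
  assumes "compact K" "compact L" "open U" "0 \<in> U"
  shows "cover_number U (K \<union> L) \<le> cover_number U K + cover_number U L"
proof -
  obtain S where S: "finite S" "K \<subseteq> (\<Union>t\<in>S. (+) t ` U)" "card S = cover_number U K"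
    using cover_number_ex[OF assms(1,3,4)] .
  obtain T where T: "finite T" "L \<subseteq> (\<Union>t\<in>T. (+) t ` U)" "card T = cover_number U L"
    using cover_number_ex[OF assms(2,3,4)] .
  have "cover_number U (K \<union> L) \<le> card (S \<union> T)"
    by (rule cover_number_le) (use S T in auto)
  also have "\<dots> \<le> card S + card T" by (rule card_Un_le)
  finally show ?thesis by (simp add: S T)
qed

lemma cover_number_translate_le:
  fixes U :: "'g::topological_group_add set"
  assumes "compact K" "open U" "0 \<in> U"
  shows "cover_number U ((+) a ` K) \<le> cover_number U K"
proof -
  obtain T where T: "finite T" "K \<subseteq> (\<Union>t\<in>T. (+) t ` U)" "card T = cover_number U K"
    using cover_number_ex[OF assms] .
  have "(+) a ` K \<subseteq> (\<Union>t\<in>(+) a ` T. (+) t ` U)"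
  proof
    fix x assume "x \<in> (+) a ` K"
    then obtain k where k: "k \<in> K" "x = a + k" by auto
    then obtain t u where "t \<in> T" "u \<in> U" "k = t + u" using T(2) by auto
    then show "x \<in> (\<Union>t\<in>(+) a ` T. (+) t ` U)"
      using k by (auto simp: add.assoc image_iff)
  qed
  then have "cover_number U ((+) a ` K) \<le> card ((+) a ` T)"
    using T by (intro cover_number_le) auto
  also have "\<dots> \<le> card T" by (rule card_image_le) fact
  finally show ?thesis by (simp add: T)
qed

lemma cover_number_translate:
  fixes U :: "'g::topological_group_add set"
  assumes "compact K" "open U" "0 \<in> U"
  shows "cover_number U ((+) a ` K) = cover_number U K"
proof -
  show ?thesis
    using cover_number_translate_le[OF assms, of a]
      cover_number_translate_le[OF compact_left_translate[OF assms(1), of a] assms(2,3), of "- a"]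
    by (simp add: left_translate_cancel)
qed

lemma cover_number_pos:
  fixes U :: "'g::topological_group_add set"
  assumes "compact K" "open U" "0 \<in> U" "K \<noteq> {}"
  shows "0 < cover_number U K"
proof -
  obtain T where "finite T" "K \<subseteq> (\<Union>t\<in>T. (+) t ` U)" "card T = cover_number U K"
    using cover_number_ex[OF assms(1-3)] .
  then show ?thesis using assms(4) by (cases "T = {}") (auto simp: card_gt_0_iff)
qed

text \<open>If no translate of \<open>U\<close> meets both \<open>K\<close> and \<open>L\<close>, a cover of the union falls into a cover of \<open>K\<close> and a
  disjoint cover of \<open>L\<close>. In the limit of small \<open>U\<close> this makes the content additive.\<close>
lemma cover_number_separated:
  fixes U :: "'g::topological_group_add set"
  assumes "compact K" "compact L" "open U" "0 \<in> U"
    and sep: "\<And>k l. k \<in> K \<Longrightarrow> l \<in> L \<Longrightarrow> \<nexists>t. k \<in> (+) t ` U \<and> l \<in> (+) t ` U"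
  shows "cover_number U K + cover_number U L \<le> cover_number U (K \<union> L)"
proof -
  obtain T where T: "finite T" "K \<union> L \<subseteq> (\<Union>t\<in>T. (+) t ` U)" "card T = cover_number U (K \<union> L)"
    using cover_number_ex[OF compact_Un[OF assms(1,2)] assms(3,4)] .
  define meeting where "meeting A = {t\<in>T. (+) t ` U \<inter> A \<noteq> {}}" for A
  have le: "cover_number U A \<le> card (meeting A)" if "A \<subseteq> K \<union> L" for A
  proof (rule cover_number_le)
    show "A \<subseteq> (\<Union>t\<in>meeting A. (+) t ` U)"
    proof
      fix x assume "x \<in> A"
      then have "x \<in> (\<Union>t\<in>T. (+) t ` U)" using T(2) that by (metis subsetD)
      then obtain t where "t \<in> T" "x \<in> (+) t ` U" by (rule UN_E)
      moreover from this have "t \<in> meeting A" using \<open>x \<in> A\<close> unfolding meeting_def by blast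
      ultimately show "x \<in> (\<Union>t\<in>meeting A. (+) t ` U)" by (intro UN_I)
    qed
  qed (simp add: meeting_def T)
  define P where "P = meeting K"
  define Q where "Q = meeting L"
  have fin: "finite P" "finite Q" using T(1) by (auto simp: P_def Q_def meeting_def)
  have "cover_number U K \<le> card P" "cover_number U L \<le> card Q"
    unfolding P_def Q_def by (intro le Un_upper1 Un_upper2)+
  moreover have "P \<inter> Q = {}"
  proof (rule equals0I)
    fix t assume t: "t \<in> P \<inter> Q"
    then obtain k where "k \<in> K" "k \<in> (+) t ` U" unfolding P_def meeting_def by blast
    moreover obtain l where "l \<in> L" "l \<in> (+) t ` U" using t unfolding Q_def meeting_def by blast
    ultimately show False using sep by metis
  qed
  then have "card P + card Q = card (P \<union> Q)"
    using fin by (simp add: card_Un_disjoint)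
  moreover have "card (P \<union> Q) \<le> card T"
    using T(1) by (intro card_mono) (auto simp: P_def Q_def meeting_def)
  ultimately show ?thesis using T(3) by linarith
qed

text \<open>The inequality \<open>(K : U) \<le> (K : V) (L : U)\<close> for \<open>V \<subseteq> L\<close>. It keeps the normalised indices
  \<open>(K : U) / (L : U)\<close> in an interval that does not depend on \<open>U\<close>.\<close>
lemma cover_number_bound:
  fixes K :: "'g::topological_group_add set"
  assumes K: "compact K" and L: "compact L" "open V" "0 \<in> V" "V \<subseteq> L"
  shows "\<exists>m. \<forall>U. open U \<longrightarrow> 0 \<in> U \<longrightarrow> cover_number U K \<le> m * cover_number U L"
proof -
  obtain T where T: "finite T" "K \<subseteq> (\<Union>t\<in>T. (+) t ` V)"
    using compact_translates_cover[OF K L(2,3)] .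
  have "cover_number U K \<le> card T * cover_number U L" if U: "open U" "0 \<in> U" for U
  proof -
    obtain S where S: "finite S" "L \<subseteq> (\<Union>t\<in>S. (+) t ` U)" "card S = cover_number U L"
      using cover_number_ex[OF L(1) U] .
    have "K \<subseteq> (\<Union>t\<in>(\<lambda>(t, s). t + s) ` (T \<times> S). (+) t ` U)"
    proof
      fix x assume "x \<in> K"
      then obtain t v where tv: "t \<in> T" "v \<in> V" "x = t + v" using T(2) by auto
      then obtain s u where "s \<in> S" "u \<in> U" "v = s + u" using S(2) L(4) by auto
      then have "t + s \<in> (\<lambda>(t, s). t + s) ` (T \<times> S)" "x = (t + s) + u" "u \<in> U"
        using tv by (auto simp: add.assoc)
      then show "x \<in> (\<Union>t\<in>(\<lambda>(t, s). t + s) ` (T \<times> S). (+) t ` U)" by blast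
    qed
    then have "cover_number U K \<le> card ((\<lambda>(t, s). t + s) ` (T \<times> S))"
      using T S by (intro cover_number_le) auto
    also have "\<dots> \<le> card (T \<times> S)" by (rule card_image_le) (use T S in auto)
    finally show ?thesis by (simp add: card_cartesian_product S)
  qed
  then show ?thesis by blast
qed

text \<open>If \<open>k = t + x\<close> and \<open>l = t + y\<close> with \<open>x\<close> and \<open>y\<close> in a small neighbourhood of 0, then
  \<open>- k + l = - x + y\<close> is close to 0. But the set of all differences \<open>- k + l\<close> is compact and
  avoids 0.\<close>
lemma eventually_separated:
  fixes U :: "nat \<Rightarrow> 'g::{topological_group_add, t2_space} set"
  assumes K: "compact K" "compact L" "K \<inter> L = {}"
    and U: "\<And>S. open S \<Longrightarrow> 0 \<in> S \<Longrightarrow> eventually (\<lambda>n. U n \<subseteq> S) sequentially"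
  shows "eventually (\<lambda>n. \<forall>k\<in>K. \<forall>l\<in>L. \<nexists>t. k \<in> (+) t ` U n \<and> l \<in> (+) t ` U n) sequentially"
proof -
  define D where "D = (\<lambda>(k, l). - k + l) ` (K \<times> L)"
  have "compact D" unfolding D_def
    by (rule compact_continuous_image[OF _ compact_Times[OF K(1,2)]])
       (auto simp: split_beta intro!: continuous_intros)
  then have "open (- D)" by (simp add: compact_imp_closed open_Compl)
  moreover have "0 \<notin> D"
  proof
    assume "0 \<in> D"
    then obtain k l where kl: "k \<in> K" "l \<in> L" "0 = - k + l" by (auto simp: D_def)
    have "l = k + (- k + l)" by (simp add: add.assoc[symmetric])
    with kl K(3) show False by auto
  qed
  moreover define d :: "'g \<times> 'g \<Rightarrow> 'g" where "d = (\<lambda>(x, y). - x + y)"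
  have "continuous_on UNIV d" unfolding d_def by (auto simp: split_beta intro!: continuous_intros)
  ultimately have "open (d -` (- D))" "(0, 0) \<in> d -` (- D)"
    by (auto intro: open_vimage simp: d_def)
  then obtain A B where AB: "open A" "open B" "0 \<in> A" "0 \<in> B" "A \<times> B \<subseteq> d -` (- D)"
    unfolding open_prod_def by (auto elim!: ballE[where x="(0, 0)"])
  have "eventually (\<lambda>n. U n \<subseteq> A \<inter> B) sequentially"
    using AB by (intro U) auto
  then show ?thesis
  proof eventually_elim
    case (elim n)
    have False if "k \<in> K" "l \<in> L" "k = t + x" "l = t + y" "x \<in> U n" "y \<in> U n" for k l t x y
    proof -
      have "d (x, y) = - (t + x) + (t + y)"
        by (simp add: d_def minus_add add.assoc) (simp add: add.assoc[symmetric])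
      then have "d (x, y) \<in> D" using that by (auto simp: D_def image_iff)
      moreover have "(x, y) \<in> A \<times> B" using elim that by auto
      ultimately show ?thesis using AB(5) by blast
    qed
    then show ?case by blast
  qed
qed

text \<open>The content is a cluster point of the normalised indices \<open>(K : U n) / (L : U n)\<close>, all compact
  sets \<open>K\<close> being treated at once as coordinates of a point in a product of compact intervals. Any
  closed condition that holds for all large \<open>n\<close> passes to the cluster point.\<close>
lemma left_invariant_content:
  fixes L V :: "'g::{topological_group_add, t2_space, first_countable_topology} set"
  assumes L: "compact L" "open V" "0 \<in> V" "V \<subseteq> L"
  obtains c where "compact_content c" "\<And>a K. compact K \<Longrightarrow> c ((+) a ` K) = c K" "c L = 1"
proof -
  obtain U :: "nat \<Rightarrow> 'g set" where U: "\<And>n. open (U n)" "\<And>n. 0 \<in> U n"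
      "\<And>S. open S \<Longrightarrow> 0 \<in> S \<Longrightarrow> eventually (\<lambda>n. U n \<subseteq> S) sequentially"
    by (rule countable_basis_at_decseq[of 0]) blast
  define r :: "nat \<Rightarrow> 'g set \<Rightarrow> real" where
    "r n K = (if compact K then cover_number (U n) K / cover_number (U n) L else 0)" for n K
  have r_nonneg: "0 \<le> r n K" for n K by (simp add: r_def)
  have pos: "0 < cover_number (U n) L" for n
    by (rule cover_number_pos) (use L U in auto)
  have "\<exists>m::nat. \<forall>n. r n K \<le> m" for K
  proof (cases "compact K")
    case True
    obtain m where "\<And>n. cover_number (U n) K \<le> m * cover_number (U n) L"
      using cover_number_bound[OF True L] U(1,2) by blast
    then have "real (cover_number (U n) K) \<le> real m * real (cover_number (U n) L)" for n
      by (metis of_nat_le_iff of_nat_mult)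
    then have "r n K \<le> m" for n using pos[of n] True by (simp add: r_def divide_simps)
    then show ?thesis by blast
  qed (auto simp: r_def)
  then obtain m :: "'g set \<Rightarrow> nat" where m: "\<And>K n. r n K \<le> m K" by metis
  let ?B = "PiE UNIV (\<lambda>K. {0 .. real (m K)})"
  have "compact ?B"
    using compactin_PiE[of "\<lambda>_. euclidean :: real topology" UNIV "\<lambda>K. {0 .. real (m K)}"]
    by (simp add: euclidean_product_topology)
  moreover have "\<forall>\<^sub>F f in filtermap r sequentially. f \<in> ?B"
    by (simp add: eventually_filtermap PiE_def Pi_def m r_nonneg)
  moreover have "filtermap r sequentially \<noteq> bot" by (simp add: filtermap_bot_iff)
  ultimately obtain h where "h \<in> ?B" and nb: "nhds h \<sqinter> filtermap r sequentially \<noteq> bot"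
    unfolding compact_filter by blast
  \<comment> \<open>Along this filter every coordinate converges to the corresponding coordinate of \<open>h\<close>.\<close>
  define F where "F = nhds h \<sqinter> filtermap r sequentially"
  have F: "F \<noteq> bot" using nb by (simp add: F_def)
  have ev: "eventually P F" if "eventually (\<lambda>n. P (r n)) sequentially" for P
    using that filter_leD[of F "filtermap r sequentially" P] by (auto simp: F_def eventually_filtermap)
  have lim: "((\<lambda>f. f K) \<longlongrightarrow> h K) F" for K
  proof (rule topological_tendstoI)
    fix S :: "real set" assume "open S" "h K \<in> S"
    moreover have "open ((\<lambda>f :: 'g set \<Rightarrow> real. f K) -` S)"
      by (rule open_vimage[OF \<open>open S\<close> continuous_on_product_coordinates])
    ultimately have "\<forall>\<^sub>F f in nhds h. f K \<in> S"
      unfolding eventually_nhds by (intro exI[of _ "(\<lambda>f. f K) -` S"]) auto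
    then show "\<forall>\<^sub>F f in F. f K \<in> S"
      by (rule filter_leD[rotated]) (simp add: F_def)
  qed
  have h_nonneg: "0 \<le> h K" for K using \<open>h \<in> ?B\<close> by (auto simp: PiE_def Pi_def)
  have h_mono: "h K \<le> h K'" if "compact K" "compact K'" "K \<subseteq> K'" for K K'
  proof (rule tendsto_le[OF F lim lim], rule ev, rule always_eventually, rule allI)
    fix n show "r n K \<le> r n K'"
      using that pos[of n] cover_number_mono[OF that(2) U(1,2) that(3), of n]
      by (simp add: r_def divide_simps)
  qed
  have h_sub: "h (K \<union> K') \<le> h K + h K'" if "compact K" "compact K'" for K K'
  proof (rule tendsto_le[OF F tendsto_add[OF lim lim] lim], rule ev, rule always_eventually, rule allI)
    fix n
    have "real (cover_number (U n) (K \<union> K')) \<le> cover_number (U n) K + cover_number (U n) K'"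
      using cover_number_Un[OF that U(1,2)] by (simp only: of_nat_add[symmetric] of_nat_le_iff)
    then show "r n (K \<union> K') \<le> r n K + r n K'"
      using that pos[of n] by (simp add: r_def divide_simps compact_Un)
  qed
  have h_super: "h K + h K' \<le> h (K \<union> K')" if "compact K" "compact K'" "K \<inter> K' = {}" for K K'
  proof (rule tendsto_le[OF F lim tendsto_add[OF lim lim]], rule ev)
    have sep: "\<forall>\<^sub>F n in sequentially. \<forall>k\<in>K. \<forall>l\<in>K'. \<nexists>t. k \<in> (+) t ` U n \<and> l \<in> (+) t ` U n"
      by (rule eventually_separated[OF that]) (rule U(3))
    show "\<forall>\<^sub>F n in sequentially. r n K + r n K' \<le> r n (K \<union> K')"
      using sep
    proof eventually_elim
      case (elim n)
      have "cover_number (U n) K + cover_number (U n) K' \<le> cover_number (U n) (K \<union> K')"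
        by (rule cover_number_separated) (use that U elim in auto)
      then have "real (cover_number (U n) K) + cover_number (U n) K' \<le> cover_number (U n) (K \<union> K')"
        by (simp only: of_nat_add[symmetric] of_nat_le_iff)
      then show ?case using that pos[of n] by (simp add: r_def divide_simps compact_Un)
    qed
  qed
  have h_inv: "h ((+) a ` K) = h K" if K: "compact K" for a K
  proof -
    have "r n ((+) a ` K) = r n K" for n
      using K U by (simp add: r_def compact_left_translate cover_number_translate)
    then have "\<forall>\<^sub>F f in F. f ((+) a ` K) = f K" by (intro ev) simp
    from tendsto_cong[OF this] show ?thesis
      using lim tendsto_unique[OF F] by blast
  qed
  have "\<forall>\<^sub>F f in F. f L = 1" by (intro ev) (use pos L in \<open>simp add: r_def less_imp_neq\<close>)
  from tendsto_cong[OF this] have h_L: "h L = 1"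
    using lim[of L] tendsto_unique[OF F] tendsto_const[of 1 F] by blast
  show ?thesis
  proof (rule that[of "\<lambda>K. ennreal (h K)"])
    show "compact_content (\<lambda>K. ennreal (h K))"
    proof
      show "ennreal (h (K \<union> K')) \<le> ennreal (h K) + ennreal (h K')" if "compact K" "compact K'" for K K'
        using h_sub[OF that] h_nonneg by (simp flip: ennreal_plus add: ennreal_leI)
      show "ennreal (h (K \<union> K')) = ennreal (h K) + ennreal (h K')"
        if "compact K" "compact K'" "K \<inter> K' = {}" for K K'
        using h_sub[OF that(1,2)] h_super[OF that] h_nonneg by (simp flip: ennreal_plus)
    qed (auto intro: ennreal_leI h_mono)
  qed (simp_all add: h_inv h_L)
qed

lemma haar_measure:
  assumes lc: "locally_compact_space (euclidean :: 'g::{topological_group_add, t2_space, second_countable_topology} topology)"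
  obtains M :: "'g::{topological_group_add, t2_space, second_countable_topology} measure" where "sets M = sets borel" "sigma_finite_measure M" "emeasure M UNIV \<noteq> 0"
    "\<And>a A. A \<in> sets borel \<Longrightarrow> emeasure M ((+) a -` A) = emeasure M A"
proof -
  have nbhd: "\<exists>V L. open V \<and> compact L \<and> x \<in> V \<and> V \<subseteq> L" for x :: 'g
    using lc unfolding locally_compact_space_def by auto
  then obtain V L :: "'g set" where VL: "open V" "compact L" "0 \<in> V" "V \<subseteq> L" by blast
  obtain c :: "'g set \<Rightarrow> ennreal" where c: "compact_content c"
      "\<And>a K. compact K \<Longrightarrow> c ((+) a ` K) = c K" "c L = 1"
    using left_invariant_content[OF VL(2,1,3,4)] by blast
  interpret compact_content c by fact
  show ?thesis
  proof (rule that[of content_measure])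
    show "emeasure content_measure UNIV \<noteq> 0"
      using inner_upper[OF VL(2), of UNIV] c(3) by (auto simp: emeasure_content_measure outer_open)
    fix a :: 'g and A :: "'g set" assume A: "A \<in> sets borel"
    have eq: "(+) a -` A = (+) (- a) ` A" by (simp add: left_translate_eq_vimage)
    have "(+) a \<in> borel_measurable borel" by (intro borel_measurable_continuous_onI continuous_intros)
    from measurable_sets[OF this A] have "(+) a -` A \<in> sets borel" by simp
    then show "emeasure content_measure ((+) a -` A) = emeasure content_measure A"
      using A by (simp add: emeasure_content_measure) (simp add: eq compact_content_translate[OF c(1,2)])
  next
    obtain B :: "'g set set" where B: "countable B" "topological_basis B"
      using ex_countable_basis by blast
    let ?B = "{b\<in>B. \<exists>K. compact K \<and> b \<subseteq> K}"
    show "sigma_finite_measure content_measure"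
    proof (intro sigma_finite_measure.intro exI[of _ ?B] conjI ballI)
      show "countable ?B" using B(1) by (rule countable_subset[rotated]) auto
      show "?B \<subseteq> sets content_measure"
        using topological_basis_open[OF B(2)] by auto
      have "x \<in> \<Union>?B" for x
      proof -
        obtain V L where "open V" "compact L" "x \<in> V" "V \<subseteq> L" using nbhd by blast
        moreover obtain b where "b \<in> B" "x \<in> b" "b \<subseteq> V"
          using topological_basisE[OF B(2) \<open>open V\<close> \<open>x \<in> V\<close>] .
        ultimately show ?thesis by blast
      qed
      then show "\<Union>?B = space content_measure" by auto
      fix b assume "b \<in> ?B"
      then obtain K where K: "compact K" "b \<subseteq> K" and "open b"
        using topological_basis_open[OF B(2)] by blast
      then have "emeasure content_measure b = inner_content b"
        by (simp add: emeasure_content_measure outer_open)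
      also have "\<dots> \<le> c K"
        unfolding inner_content_def using K by (intro SUP_least mono) auto
      also have "\<dots> < \<infinity>" by (rule finite) fact
      finally show "emeasure content_measure b \<noteq> \<infinity>" by simp
    qed
  qed simp
qed

text \<open>A strictly positive integrable density makes the Haar measure finite and keeps its null sets, which
  are all that matters for the use of Fubini's theorem.\<close>
lemma finite_left_quasi_invariant_measure:
  assumes lc: "locally_compact_space (euclidean :: 'g::{topological_group_add, t2_space, second_countable_topology} topology)"
  obtains M :: "'g::{topological_group_add, t2_space, second_countable_topology} measure" where "sets M = sets borel" "finite_measure M" "emeasure M UNIV \<noteq> 0"
    "\<And>a A. A \<in> null_sets M \<Longrightarrow> (+) a -` A \<in> null_sets M"
proof -
  obtain M :: "'g measure" where M [measurable_cong]: "sets M = sets borel"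
      and sf: "sigma_finite_measure M" and nz: "emeasure M UNIV \<noteq> 0"
      and inv: "\<And>a A. A \<in> sets borel \<Longrightarrow> emeasure M ((+) a -` A) = emeasure M A"
    using haar_measure[OF lc] by blast
  have sp: "space M = UNIV" using sets_eq_imp_space_eq[OF M] by simp
  obtain f where f [measurable]: "f \<in> borel_measurable M" and fin: "integral\<^sup>N M f \<noteq> \<infinity>"
      and pos: "\<And>x. 0 < f x" "\<And>x. f x < \<infinity>"
    using sigma_finite_measure.Ex_finite_integrable_function[OF sf] sp by auto
  have null: "A \<in> null_sets (density M f) \<longleftrightarrow> A \<in> null_sets M" for A
  proof -
    have "(AE x in M. x \<in> A \<longrightarrow> f x = 0) \<longleftrightarrow> (AE x in M. x \<notin> A)"
      using pos(1) by (intro AE_cong) (auto simp: less_le)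
    moreover have "A \<in> null_sets M \<longleftrightarrow> A \<in> sets M \<and> (AE x in M. x \<notin> A)"
      using AE_iff_null_sets null_setsD2 by blast
    ultimately show ?thesis
      by (simp add: null_sets_density_iff[OF f])
  qed
  show ?thesis
  proof (rule that[of "density M f"])
    show "finite_measure (density M f)"
      by (rule finite_measureI) (use fin in \<open>simp add: emeasure_density sp\<close>)
    show "emeasure (density M f) UNIV \<noteq> 0"
      using null[of UNIV] nz by (auto simp: null_sets_def M)
    fix a :: 'g and A assume "A \<in> null_sets (density M f)"
    then have A: "A \<in> sets borel" "emeasure M A = 0" unfolding null by (auto simp: null_sets_def M)
    have "(+) a \<in> borel_measurable borel" by (intro borel_measurable_continuous_onI continuous_intros)
    from measurable_sets[OF this A(1)] have "(+) a -` A \<in> sets borel" by simp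
    then show "(+) a -` A \<in> null_sets (density M f)"
      unfolding null using inv[OF A(1)] A by (auto simp: null_sets_def M)
  qed (simp add: M)
qed

section \<open>Coding Polish spaces by binary sequences\<close>

definition dense_seq :: "nat \<Rightarrow> 'w::polish_space" where
  "dense_seq = (SOME d. \<forall>w. \<forall>e>0. \<exists>n. dist (d n) w < e)"

lemma dense_seq: "e > 0 \<Longrightarrow> \<exists>n. dist (dense_seq n) (w::'w::polish_space) < e"
proof -
  obtain D :: "'w set" where D: "countable D" "\<And>X. open X \<Longrightarrow> X \<noteq> {} \<Longrightarrow> \<exists>d\<in>D. d \<in> X"
    using countable_dense_setE by blast
  have "D \<noteq> {}" using D(2)[of UNIV] by auto
  have "\<exists>n. dist (from_nat_into D n) w < e" if "e > 0" for w e
  proof -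
    obtain d where "d \<in> D" "d \<in> ball w e" using D(2)[of "ball w e"] \<open>e > 0\<close> by auto
    then show ?thesis
      using from_nat_into_surj[OF D(1), of d] by (metis dist_commute mem_ball)
  qed
  then have "\<exists>d :: nat \<Rightarrow> 'w. \<forall>w. \<forall>e>0. \<exists>n. dist (d n) w < e" by blast
  from someI_ex[OF this] show "e > 0 \<Longrightarrow> ?thesis" unfolding dense_seq_def by blast
qed

text \<open>The bit with index \<open>prod_encode (m, n)\<close> of the code of a point tells whether the point is within
  \<open>(1/2) ^ m\<close> of the \<open>n\<close>-th element of the dense sequence. A point is recovered from its code as the
  limit of the first elements that are close enough. Points and codes correspond without any
  exceptional null set, and decoding is Borel.\<close>
definition code_set :: "nat \<Rightarrow> 'w::polish_space set" where
  "code_set k = (case prod_decode k of (m, n) \<Rightarrow> ball (dense_seq n) ((1/2) ^ m))"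

definition decode_term :: "(nat \<Rightarrow> bool) \<Rightarrow> nat \<Rightarrow> 'w::polish_space" where
  "decode_term b m = dense_seq (LEAST n. b (prod_encode (m, n)))"

text \<open>The value \<open>dense_seq 0\<close> is given to the binary sequences that are not the code of a point and do
  not even produce a Cauchy sequence; it makes decoding total and Borel.\<close>
definition decode :: "(nat \<Rightarrow> bool) \<Rightarrow> 'w::polish_space" where
  "decode b = (if Cauchy (decode_term b :: nat \<Rightarrow> 'w) then lim (decode_term b) else dense_seq 0)"

lemma code_set_borel [measurable]: "code_set k \<in> sets borel"
  by (simp add: code_set_def split: prod.split)

lemma decode_code: "decode (\<lambda>k. w \<in> code_set k) = (w :: 'w::polish_space)"
proof -
  let ?b = "\<lambda>k. w \<in> code_set k"
  have *: "dist (decode_term ?b m) w < (1/2) ^ m" for m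
  proof -
    have "\<exists>n. ?b (prod_encode (m, n))"
      using dense_seq[of "(1/2)^m" w] by (auto simp: code_set_def)
    from LeastI_ex[OF this] show ?thesis by (simp add: decode_term_def code_set_def)
  qed
  have "(\<lambda>m. dist (decode_term ?b m) w) \<longlonglongrightarrow> 0"
    by (rule tendsto_sandwich[of "\<lambda>_. 0" _ _ "\<lambda>m. (1/2) ^ m"])
       (use * in \<open>auto intro!: always_eventually LIMSEQ_power_zero intro: less_imp_le\<close>)
  then have lim: "decode_term ?b \<longlonglongrightarrow> w" by (rule tendsto_dist_iff[THEN iffD2])
  then show ?thesis
    by (simp add: decode_def LIMSEQ_imp_Cauchy limI)
qed

lemma measurable_decode:
  assumes [measurable]: "\<And>k. B k \<in> sets M"
  shows "(\<lambda>x. decode (\<lambda>k. x \<in> B k) :: 'w::polish_space) \<in> borel_measurable M"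
proof -
  have t [measurable]: "(\<lambda>x. decode_term (\<lambda>k. x \<in> B k) m :: 'w) \<in> borel_measurable M" for m
  proof -
    have [measurable]: "(\<lambda>x. LEAST n. x \<in> B (prod_encode (m, n))) \<in> measurable M (count_space UNIV)"
      by measurable
    show ?thesis unfolding decode_term_def by measurable
  qed
  let ?C = "\<lambda>x. Cauchy (\<lambda>m. decode_term (\<lambda>k. x \<in> B k) m :: 'w)"
  show ?thesis
  proof (rule borel_measurable_LIMSEQ_metric)
    show "(\<lambda>x. if ?C x then decode_term (\<lambda>k. x \<in> B k) m :: 'w else dense_seq 0) \<in> borel_measurable M" for m
      by (intro measurable_If sets_Collect_Cauchy) measurable
    show "(\<lambda>m. if ?C x then decode_term (\<lambda>k. x \<in> B k) m else dense_seq 0) \<longlonglongrightarrow> (decode (\<lambda>k. x \<in> B k) :: 'w)" for x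
      using Cauchy_convergent_iff[of "decode_term (\<lambda>k. x \<in> B k) :: nat \<Rightarrow> 'w"]
      by (auto simp: decode_def convergent_LIMSEQ_iff)
  qed
qed

text \<open>The expansion in base 3 with digits 0 and 1 only. Its tails are at most \<open>1/2 < 1\<close>, so the digits
  can be read off with the floor function; base 2 would have ambiguous expansions.\<close>
definition ternary :: "(nat \<Rightarrow> bool) \<Rightarrow> real" where
  "ternary b = (\<Sum>k. of_bool (b k) * (1/3) ^ Suc k)"

definition ternary_digit :: "nat \<Rightarrow> real \<Rightarrow> bool" where
  "ternary_digit k x \<longleftrightarrow> \<lfloor>3 ^ Suc k * x\<rfloor> mod 3 = 1"

lemma summable_ternary: "summable (\<lambda>k. of_bool (b k) * (1/3::real) ^ Suc k)"
  by (rule summable_comparison_test'[where g="\<lambda>k. (1/3) ^ Suc k" and N=0])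
     (auto intro: summable_Suc_iff[THEN iffD2] simp: summable_geometric simp del: power_Suc)

lemma ternary_bounds: "0 \<le> ternary b" "ternary b \<le> 1/2"
proof -
  show "0 \<le> ternary b" unfolding ternary_def by (rule suminf_nonneg[OF summable_ternary]) auto
  have "ternary b \<le> (\<Sum>k. (1/3::real) ^ Suc k)"
    unfolding ternary_def
    by (rule suminf_le[OF _ summable_ternary])
       (auto simp: summable_geometric simp del: power_Suc intro: summable_Suc_iff[THEN iffD2])
  also have "\<dots> = 1/2" using suminf_mult[of "\<lambda>k. (1/3::real) ^ k" "1/3"]
    by (simp add: suminf_geometric summable_geometric)
  finally show "ternary b \<le> 1/2" .
qed

lemma ternary_shift: "3 * ternary b = of_bool (b 0) + ternary (\<lambda>k. b (Suc k))"
proof -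
  have "ternary b = of_bool (b 0) * (1/3) + (\<Sum>k. of_bool (b (Suc k)) * (1/3) ^ Suc (Suc k))"
    unfolding ternary_def using suminf_split_head[OF summable_ternary[of b]] by simp
  also have "(\<Sum>k. of_bool (b (Suc k)) * (1/3::real) ^ Suc (Suc k)) = (1/3) * ternary (\<lambda>k. b (Suc k))"
    unfolding ternary_def
    by (subst suminf_mult[OF summable_ternary, symmetric]) (simp add: algebra_simps)
  finally show ?thesis by simp
qed

lemma ternary_digit_ternary: "ternary_digit k (ternary b) = b k"
proof -
  have "\<exists>m::int. 3 ^ k * ternary b = of_int m + ternary (\<lambda>i. b (i + k))"
  proof (induction k)
    case (Suc k)
    then obtain m :: int where "3 ^ k * ternary b = of_int m + ternary (\<lambda>i. b (i + k))" ..
    then have "3 ^ Suc k * ternary b = of_int (3 * m + of_bool (b k)) + ternary (\<lambda>i. b (i + Suc k))"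
      using ternary_shift[of "\<lambda>i. b (i + k)"] by simp
    then show ?case ..
  qed simp
  then obtain m :: int where "3 ^ k * ternary b = of_int m + ternary (\<lambda>i. b (i + k))" ..
  then have "3 ^ Suc k * ternary b = of_int (3 * m + of_bool (b k)) + ternary (\<lambda>i. b (i + Suc k))"
    using ternary_shift[of "\<lambda>i. b (i + k)"] by simp
  then have "\<lfloor>3 ^ Suc k * ternary b\<rfloor> = 3 * m + of_bool (b k)"
    using ternary_bounds[of "\<lambda>i. b (i + Suc k)"] by (intro floor_unique) auto
  then show ?thesis by (auto simp: ternary_digit_def)
qed

text \<open>Conditional distributions on a Polish space thereby reduce to distributions on the
  real line, where distribution functions are available.\<close>
lemma polish_real_retract:
  obtains i :: "'w::polish_space \<Rightarrow> real" and j :: "real \<Rightarrow> 'w"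
  where "i \<in> borel_measurable borel" "j \<in> borel_measurable borel" "\<And>w. j (i w) = w"
    "\<And>w. 0 \<le> i w" "\<And>w. i w \<le> 1/2"
proof
  show "(\<lambda>w::'w. ternary (\<lambda>k. w \<in> code_set k)) \<in> borel_measurable borel"
    unfolding ternary_def of_bool_def by measurable
  have "{x. ternary_digit k x} \<in> sets borel" for k
    unfolding ternary_digit_def by measurable
  from measurable_decode[of "\<lambda>k. {x. ternary_digit k x}", OF this]
  show "(\<lambda>x. decode (\<lambda>k. ternary_digit k x) :: 'w) \<in> borel_measurable borel" by simp
qed (use ternary_bounds in \<open>auto simp: ternary_digit_ternary decode_code\<close>)

section \<open>Conditional distributions and disintegrations\<close>

text \<open>Test the inequality of integrals on the set where \<open>g < f\<close>.\<close>
lemma AE_le_of_nn_integral_le: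
  assumes [measurable]: "f \<in> borel_measurable M" "g \<in> borel_measurable M"
    and fin: "(\<integral>\<^sup>+x. f x \<partial>M) < \<infinity>"
    and le: "\<And>C. C \<in> sets M \<Longrightarrow> (\<integral>\<^sup>+x\<in>C. f x \<partial>M) \<le> (\<integral>\<^sup>+x\<in>C. g x \<partial>M)"
  shows "AE x in M. f x \<le> (g x :: ennreal)"
proof -
  define C where "C = {x\<in>space M. g x < f x}"
  have [measurable]: "C \<in> sets M" unfolding C_def by measurable
  have g_le: "(\<integral>\<^sup>+x\<in>C. g x \<partial>M) \<le> (\<integral>\<^sup>+x. f x \<partial>M)"
    by (intro nn_integral_mono) (auto simp: C_def indicator_def intro: less_imp_le)
  have "(\<integral>\<^sup>+x. (f x - g x) * indicator C x \<partial>M) = (\<integral>\<^sup>+x. f x * indicator C x - g x * indicator C x \<partial>M)"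
    by (intro nn_integral_cong) (auto simp: indicator_def)
  also have "\<dots> = (\<integral>\<^sup>+x\<in>C. f x \<partial>M) - (\<integral>\<^sup>+x\<in>C. g x \<partial>M)"
    by (rule nn_integral_diff) (use g_le fin in \<open>auto simp: C_def indicator_def intro: less_imp_le\<close>)
  also have "\<dots> = 0"
  proof -
    have "(\<integral>\<^sup>+x\<in>C. f x \<partial>M) \<le> (\<integral>\<^sup>+x. f x \<partial>M)"
      by (intro nn_integral_mono) (auto simp: indicator_def)
    then show ?thesis using le[of C] fin by (simp add: diff_eq_0_iff_ennreal le_less_trans)
  qed
  finally have "AE x in M. (f x - g x) * indicator C x = 0"
    by (subst (asm) nn_integral_0_iff_AE) auto
  then show ?thesis
    by (rule AE_mp) (auto simp: C_def indicator_def not_less diff_eq_0_iff_ennreal intro!: AE_I2 split: if_splits)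
qed

lemma ex_density_of_le:
  assumes "finite_measure M" and sets: "sets N = sets M"
    and le: "\<And>A. A \<in> sets M \<Longrightarrow> emeasure N A \<le> emeasure M A"
  shows "\<exists>f. f \<in> borel_measurable M \<and> (\<forall>A\<in>sets M. emeasure N A = (\<integral>\<^sup>+x\<in>A. f x \<partial>M))"
proof -
  interpret finite_measure M by fact
  have "absolutely_continuous M N"
    unfolding absolutely_continuous_def
  proof
    fix A assume A: "A \<in> null_sets M"
    then have "emeasure N A = 0" using le[of A] by (auto simp: null_sets_def)
    then show "A \<in> null_sets N" using A by (auto simp: null_sets_def sets)
  qed
  then have "density M (RN_deriv M N) = N" by (rule density_RN_deriv) (simp add: sets)
  then have "emeasure N A = (\<integral>\<^sup>+x\<in>A. RN_deriv M N x \<partial>M)" if "A \<in> sets M" for A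
    using that by (metis emeasure_density borel_measurable_RN_deriv)
  then show ?thesis using borel_measurable_RN_deriv by blast
qed

text \<open>Dyadic rationals that decrease to \<open>x\<close> from strictly above. The \<open>n\<close>-th one is locally constant to the
  right of \<open>x\<close>, which gives right continuity of the limit at no cost.\<close>
definition dyadic_above :: "nat \<Rightarrow> real \<Rightarrow> real" where
  "dyadic_above n x = (of_int \<lfloor>2 ^ n * x\<rfloor> + 1) / 2 ^ n"

lemma dyadic_above_gt: "x < dyadic_above n x"
  and dyadic_above_le: "dyadic_above n x \<le> x + 1 / 2 ^ n"
  and dyadic_above_rat: "dyadic_above n x \<in> \<rat>"
proof -
  have "2 ^ n * x < of_int \<lfloor>2 ^ n * x\<rfloor> + 1" "of_int \<lfloor>2 ^ n * x\<rfloor> \<le> 2 ^ n * x" by linarith+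
  then show "x < dyadic_above n x" "dyadic_above n x \<le> x + 1 / 2 ^ n"
    by (auto simp: dyadic_above_def field_simps)
  show "dyadic_above n x \<in> \<rat>" by (simp add: dyadic_above_def)
qed

lemma dyadic_above_mono: "x \<le> y \<Longrightarrow> dyadic_above n x \<le> dyadic_above n y"
  unfolding dyadic_above_def by (intro divide_right_mono) (auto intro!: floor_mono mult_left_mono)

lemma dyadic_above_Suc: "dyadic_above (Suc n) x \<le> dyadic_above n x"
proof -
  have "\<lfloor>2 ^ Suc n * x\<rfloor> < 2 * (\<lfloor>2 ^ n * x\<rfloor> + 1)"
    by (simp add: floor_less_iff) linarith
  then have "\<lfloor>2 ^ Suc n * x\<rfloor> + 1 \<le> 2 * (\<lfloor>2 ^ n * x\<rfloor> + 1)" by linarith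
  then have "real_of_int (\<lfloor>2 ^ Suc n * x\<rfloor> + 1) \<le> of_int (2 * (\<lfloor>2 ^ n * x\<rfloor> + 1))"
    by (simp only: of_int_le_iff)
  then have "of_int \<lfloor>2 ^ Suc n * x\<rfloor> + 1 \<le> 2 * (of_int \<lfloor>2 ^ n * x\<rfloor> + 1 :: real)"
    by (simp only: of_int_add of_int_mult of_int_1 of_int_numeral)
  then show ?thesis unfolding dyadic_above_def by (simp add: divide_simps)
qed

lemma dyadic_above_decseq: "decseq (\<lambda>n. dyadic_above n x)"
  by (intro decseq_SucI dyadic_above_Suc)

lemma dyadic_above_const: "x \<le> y \<Longrightarrow> y < dyadic_above n x \<Longrightarrow> dyadic_above n y = dyadic_above n x"
proof -
  assume xy: "x \<le> y" "y < dyadic_above n x"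
  have "2 ^ n * x \<le> 2 ^ n * y" using xy(1) by simp
  moreover have "2 ^ n * y < of_int \<lfloor>2 ^ n * x\<rfloor> + 1"
    using xy(2) by (simp add: dyadic_above_def field_simps)
  ultimately have "\<lfloor>2 ^ n * y\<rfloor> = \<lfloor>2 ^ n * x\<rfloor>" by (intro floor_unique) linarith+
  then show ?thesis by (simp add: dyadic_above_def)
qed

text \<open>A monotone function on the rationals, with the boundary values of a distribution on the unit
  interval, becomes a distribution function when it is replaced by its limit from the right.\<close>
lemma dyadic_cdf_distribution:
  fixes h :: "real \<Rightarrow> ennreal"
  assumes mono: "\<And>p q. p \<in> \<rat> \<Longrightarrow> q \<in> \<rat> \<Longrightarrow> p \<le> q \<Longrightarrow> h p \<le> h q"
    and zero: "\<And>q. q \<in> \<rat> \<Longrightarrow> q < 0 \<Longrightarrow> h q = 0" and one: "\<And>q. q \<in> \<rat> \<Longrightarrow> 1 \<le> q \<Longrightarrow> h q = 1"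
  defines "G \<equiv> \<lambda>x. enn2real (INF n. h (dyadic_above n x))"
  shows "real_distribution (interval_measure G)" and "emeasure (interval_measure G) {..x} = (INF n. h (dyadic_above n x))"
proof -
  have le1: "h q \<le> 1" if "q \<in> \<rat>" for q
    using mono[of q "of_int (max 1 \<lceil>q\<rceil>)"] one[of "of_int (max 1 \<lceil>q\<rceil>)"] that
    by (auto simp: max_def ceiling_le_iff split: if_splits)
  have G: "ennreal (G x) = (INF n. h (dyadic_above n x))" for x
  proof -
    have "(INF n. h (dyadic_above n x)) \<le> 1" by (rule INF_lower2[of 0]) (auto simp: le1 dyadic_above_rat)
    then show ?thesis unfolding G_def by (intro ennreal_enn2real le_less_trans[OF _ ennreal_one_less_top])
  qed
  have G_nonneg: "0 \<le> G x" for x by (simp add: G_def)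
  have G_mono: "G x \<le> G y" if "x \<le> y" for x y
  proof -
    have "(INF n. h (dyadic_above n x)) \<le> (INF n. h (dyadic_above n y))"
      by (intro INF_mono) (auto intro!: mono dyadic_above_rat dyadic_above_mono that)
    then show ?thesis using G_nonneg by (simp flip: G)
  qed
  have G_right: "continuous (at_right a) G" for a
    unfolding continuous_within
  proof (rule order_tendstoI)
    fix b assume "b < G a"
    then show "eventually (\<lambda>x. b < G x) (at_right a)"
      by (intro eventually_at_right_less[THEN eventually_mono]) (metis G_mono less_le_trans less_imp_le)
  next
    fix b assume b: "G a < b"
    then have "ennreal (G a) < ennreal b" using G_nonneg[of a] by (simp add: ennreal_less_iff)
    then obtain n where n: "h (dyadic_above n a) < ennreal b"
      unfolding G INF_less_iff by auto
    have "G x < b" if "a < x" "x < dyadic_above n a" for x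
    proof -
      have "ennreal (G x) \<le> h (dyadic_above n x)" unfolding G by (rule INF_lower) simp
      also have "\<dots> < ennreal b" using n dyadic_above_const[of a x n] that by simp
      finally show ?thesis using G_nonneg[of x] by (simp add: ennreal_less_iff)
    qed
    then show "eventually (\<lambda>x. G x < b) (at_right a)"
      unfolding eventually_at_right_field using dyadic_above_gt[of a n] by blast
  qed
  have G0: "G x = 0" if neg: "x < 0" for x
  proof -
    obtain n :: nat where n: "1 / 2 ^ n < - x"
      using real_arch_pow_inv[of "- x" "1/2"] neg by (auto simp: power_one_over)
    have "ennreal (G x) \<le> h (dyadic_above n x)" unfolding G by (rule INF_lower) simp
    also have "\<dots> = 0" using dyadic_above_le[of n x] n by (intro zero dyadic_above_rat) auto
    finally show ?thesis using G_nonneg[of x] by simp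
  qed
  have G1: "G x = 1" if "1 \<le> x" for x
  proof -
    have "h (dyadic_above n x) = 1" for n
      using dyadic_above_gt[of x n] that by (intro one dyadic_above_rat) auto
    then show ?thesis by (simp add: G_def)
  qed
  have bot: "(G \<longlongrightarrow> 0) at_bot"
    by (rule tendsto_eventually) (auto intro!: eventually_at_bot_linorderI[of "-1"] G0)
  have top: "(G \<longlongrightarrow> 1) at_top"
    by (rule tendsto_eventually) (auto intro!: eventually_at_top_linorderI[of 1] G1)
  show "real_distribution (interval_measure G)"
    by (rule real_distribution_interval_measure) (fact G_mono G_right bot top)+
  show "emeasure (interval_measure G) {..x} = (INF n. h (dyadic_above n x))"
    using emeasure_interval_measure_Iic[of G x, OF G_mono G_right bot] by (simp add: G)
qed

text \<open>For each rational \<open>q\<close> the conditional probability of \<open>i \<le> q\<close> is a density. Countably many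
  relations make these densities, at almost every point \<open>z\<close>, into a distribution function in \<open>q\<close>,
  which defines the kernel.\<close>
lemma real_conditional_distribution:
  fixes \<nu> :: "'x measure" and i :: "'x \<Rightarrow> real"
  assumes "prob_space \<nu>" and \<pi> [measurable]: "\<pi> \<in> \<nu> \<rightarrow>\<^sub>M N" and i [measurable]: "i \<in> borel_measurable \<nu>"
    and bounds: "\<And>x. 0 \<le> i x" "\<And>x. i x \<le> 1"
  obtains K where "K \<in> distr \<nu> N \<pi> \<rightarrow>\<^sub>M prob_algebra borel"
    "\<And>C A. C \<in> sets N \<Longrightarrow> A \<in> sets borel \<Longrightarrow>
      emeasure \<nu> (\<pi> -` C \<inter> i -` A \<inter> space \<nu>) = (\<integral>\<^sup>+z\<in>C. emeasure (K z) A \<partial>distr \<nu> N \<pi>)"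
proof -
  interpret prob_space \<nu> by fact
  define \<eta> where "\<eta> = distr \<nu> N \<pi>"
  have sets_\<eta> [measurable_cong]: "sets \<eta> = sets N" by (simp add: \<eta>_def)
  have prob_\<eta>: "prob_space \<eta>" unfolding \<eta>_def by (rule prob_space_distr) fact
  interpret \<eta>: prob_space \<eta> by fact
  have em_\<eta>: "emeasure \<eta> C = emeasure \<nu> (\<pi> -` C \<inter> space \<nu>)" if "C \<in> sets N" for C
    using that by (simp add: \<eta>_def emeasure_distr)
  define part where "part A = distr (density \<nu> (indicator (i -` A \<inter> space \<nu>))) N \<pi>" for A
  have part: "emeasure (part A) C = emeasure \<nu> (\<pi> -` C \<inter> i -` A \<inter> space \<nu>)"
    if [measurable]: "A \<in> sets borel" "C \<in> sets N" for A C
  proof -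
    have "emeasure (part A) C = (\<integral>\<^sup>+x. indicator (i -` A \<inter> space \<nu>) x * indicator (\<pi> -` C \<inter> space \<nu>) x \<partial>\<nu>)"
      unfolding part_def by (simp add: emeasure_distr emeasure_density)
    also have "\<dots> = (\<integral>\<^sup>+x. indicator (\<pi> -` C \<inter> i -` A \<inter> space \<nu>) x \<partial>\<nu>)"
      by (intro nn_integral_cong) (auto simp: indicator_def)
    finally show ?thesis by simp
  qed
  have "\<exists>f. f \<in> borel_measurable \<eta> \<and>
      (\<forall>C\<in>sets \<eta>. emeasure \<nu> (\<pi> -` C \<inter> i -` {..q} \<inter> space \<nu>) = (\<integral>\<^sup>+z\<in>C. f z \<partial>\<eta>))" for q
  proof -
    have "finite_measure \<eta>" by (rule \<eta>.finite_measure_axioms)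
    moreover have "sets (part {..q}) = sets \<eta>" by (simp add: part_def sets_\<eta>)
    moreover have "emeasure (part {..q}) A \<le> emeasure \<eta> A" if "A \<in> sets \<eta>" for A
      using that by (auto simp: part em_\<eta> sets_\<eta> intro!: emeasure_mono)
    ultimately have "\<exists>f. f \<in> borel_measurable \<eta> \<and>
        (\<forall>A\<in>sets \<eta>. emeasure (part {..q}) A = (\<integral>\<^sup>+x\<in>A. f x \<partial>\<eta>))"
      by (rule ex_density_of_le)
    then show ?thesis by (auto simp: part sets_\<eta>)
  qed
  then obtain f where f [measurable]: "\<And>q. f q \<in> borel_measurable \<eta>"
    and f_eq: "\<And>q C. C \<in> sets N \<Longrightarrow> emeasure \<nu> (\<pi> -` C \<inter> i -` {..q} \<inter> space \<nu>) = (\<integral>\<^sup>+z\<in>C. f q z \<partial>\<eta>)"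
    unfolding sets_\<eta> by metis
  have f_fin: "(\<integral>\<^sup>+z. f q z \<partial>\<eta>) < \<top>" for q
  proof -
    have "(\<integral>\<^sup>+z. f q z \<partial>\<eta>) = (\<integral>\<^sup>+z\<in>space \<eta>. f q z \<partial>\<eta>)"
      by (intro nn_integral_cong) simp
    also have "\<dots> = emeasure \<nu> (\<pi> -` space \<eta> \<inter> i -` {..q} \<inter> space \<nu>)"
      by (rule f_eq[symmetric]) (simp flip: sets_\<eta>)
    finally show ?thesis by (simp add: less_top[symmetric])
  qed
  have f_mono: "AE z in \<eta>. f p z \<le> f q z" if "p \<le> q" for p q
  proof (rule AE_le_of_nn_integral_le)
    fix C assume "C \<in> sets \<eta>"
    then show "(\<integral>\<^sup>+z\<in>C. f p z \<partial>\<eta>) \<le> (\<integral>\<^sup>+z\<in>C. f q z \<partial>\<eta>)"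
      using that by (subst (1 2) f_eq[symmetric]) (auto simp: sets_\<eta> intro!: emeasure_mono)
  qed (auto simp: f_fin)
  have f_zero: "AE z in \<eta>. f q z = 0" if "q < 0" for q
  proof -
    have "AE z in \<eta>. f q z \<le> 0"
    proof (rule AE_le_of_nn_integral_le)
      fix C assume C: "C \<in> sets \<eta>"
      have "q < i x" for x using that bounds(1)[of x] by linarith
      then have "\<pi> -` C \<inter> i -` {..q} \<inter> space \<nu> = {}" by (auto simp: not_le[symmetric])
      then show "(\<integral>\<^sup>+z\<in>C. f q z \<partial>\<eta>) \<le> (\<integral>\<^sup>+z\<in>C. 0 \<partial>\<eta>)"
        using f_eq[of C q] C by (simp add: sets_\<eta>)
    qed (auto simp: f_fin)
    then show ?thesis by simp
  qed
  have f_one: "AE z in \<eta>. f q z = 1" if "1 \<le> q" for q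
  proof -
    have eq: "(\<integral>\<^sup>+z\<in>C. f q z \<partial>\<eta>) = (\<integral>\<^sup>+z\<in>C. 1 \<partial>\<eta>)" if C: "C \<in> sets \<eta>" for C
    proof -
      have "\<pi> -` C \<inter> i -` {..q} \<inter> space \<nu> = \<pi> -` C \<inter> space \<nu>"
        using \<open>1 \<le> q\<close> bounds(2) by (auto intro: order_trans)
      then show ?thesis using f_eq[of C q] C by (simp add: sets_\<eta> em_\<eta>)
    qed
    have "AE z in \<eta>. f q z \<le> 1"
      by (rule AE_le_of_nn_integral_le) (use eq in \<open>auto simp: f_fin\<close>)
    moreover have "AE z in \<eta>. 1 \<le> f q z"
      by (rule AE_le_of_nn_integral_le) (use eq in \<open>auto simp: \<eta>.emeasure_space_1\<close>)
    ultimately show ?thesis by eventually_elim auto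
  qed
  have cQ: "countable (\<rat> :: real set)" by (rule countable_rat)
  define good where "good z \<longleftrightarrow> (\<forall>p\<in>\<rat>. \<forall>q\<in>\<rat>. (p \<le> q \<longrightarrow> f p z \<le> f q z) \<and> (q < 0 \<longrightarrow> f q z = 0) \<and> (1 \<le> q \<longrightarrow> f q z = 1))" for z
  have AE_good: "AE z in \<eta>. good z"
    unfolding good_def
    by (intro AE_ball_countable[OF cQ, THEN iffD2] ballI AE_conjI AE_impI f_mono f_zero f_one)
  have good_meas [measurable]: "Measurable.pred \<eta> good"
  proof -
    have "Measurable.pred \<eta> (\<lambda>z. \<forall>p\<in>\<rat>. \<forall>q\<in>\<rat>. (p \<le> q \<longrightarrow> f p z \<le> f q z) \<and> (q < 0 \<longrightarrow> f q z = 0) \<and> (1 \<le> q \<longrightarrow> f q z = 1))"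
      unfolding pred_def by (intro sets.sets_Collect_countable_All' cQ) measurable
    then show ?thesis unfolding good_def[abs_def] .
  qed
  \<comment> \<open>At the exceptional points the point mass at 0 serves as a default.\<close>
  define h where "h z q = (if good z then f q z else if q < 0 then 0 else 1)" for z q
  have h_meas [measurable]: "(\<lambda>z. h z q) \<in> borel_measurable \<eta>" for q
    unfolding h_def by measurable
  define K where "K z = interval_measure (\<lambda>x. enn2real (INF n. h z (dyadic_above n x)))" for z
  have h_mono: "h z p \<le> h z q" if "p \<in> \<rat>" "q \<in> \<rat>" "p \<le> q" for z p q
    using that by (auto simp: h_def good_def)
  have h_zero: "h z q = 0" if "q \<in> \<rat>" "q < 0" for z q
    using that by (auto simp: h_def good_def)
  have h_one: "h z q = 1" if "q \<in> \<rat>" "1 \<le> q" for z q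
    using that by (auto simp: h_def good_def)
  note K = dyadic_cdf_distribution[of "h z" for z, OF h_mono h_zero h_one, folded K_def]
  have K_sets: "sets (K z) = sets borel" for z by (simp add: K_def)
  have K_meas: "K \<in> \<eta> \<rightarrow>\<^sub>M prob_algebra borel"
  proof (rule measurable_prob_algebra_generated)
    show "sets borel = sigma_sets UNIV (range (\<lambda>a::real. {..a}))"
      by (subst borel_eq_atMost) (simp add: sets_measure_of_conv)
    show "Int_stable (range (\<lambda>a::real. {..a}))"
      by (auto simp: Int_stable_def)
    show "prob_space (K z)" for z using K(1)[of z] by (simp add: real_distribution_def)
    show "(\<lambda>z. emeasure (K z) A) \<in> borel_measurable \<eta>" if A: "A \<in> range (\<lambda>a::real. {..a})" for A
    proof -
      obtain a where "A = {..a}" using A by auto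
      then show ?thesis by (simp add: K(2))
    qed
  qed (auto simp: K_sets)
  have Iic: "emeasure \<nu> (\<pi> -` C \<inter> i -` {..x} \<inter> space \<nu>) = (\<integral>\<^sup>+z\<in>C. emeasure (K z) {..x} \<partial>\<eta>)"
    if C [measurable]: "C \<in> sets N" for C x
  proof -
    have dec: "decseq (\<lambda>n. dyadic_above n x)" by (rule dyadic_above_decseq)
    have "(\<integral>\<^sup>+z\<in>C. emeasure (K z) {..x} \<partial>\<eta>) = (\<integral>\<^sup>+z. (INF n. h z (dyadic_above n x) * indicator C z) \<partial>\<eta>)"
      by (intro nn_integral_cong) (auto simp: K(2) indicator_def)
    also have "\<dots> = (INF n. \<integral>\<^sup>+z\<in>C. h z (dyadic_above n x) \<partial>\<eta>)"
    proof (rule nn_integral_monotone_convergence_INF_decseq)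
      show "decseq (\<lambda>n z. h z (dyadic_above n x) * indicator C z)"
        unfolding monotone_def le_fun_def
        by (intro allI impI mult_right_mono h_mono dyadic_above_rat decseqD[OF dec]) auto
      have "(\<integral>\<^sup>+z\<in>C. h z (dyadic_above 0 x) \<partial>\<eta>) \<le> (\<integral>\<^sup>+z. f (dyadic_above 0 x) z \<partial>\<eta>)"
        using AE_good by (intro nn_integral_mono_AE) (auto elim!: eventually_mono simp: h_def indicator_def)
      then show "(\<integral>\<^sup>+z\<in>C. h z (dyadic_above 0 x) \<partial>\<eta>) < \<infinity>"
        using f_fin[of "dyadic_above 0 x"] by (auto intro: le_less_trans)
    qed measurable
    also have "\<dots> = (INF n. emeasure \<nu> (\<pi> -` C \<inter> i -` {..dyadic_above n x} \<inter> space \<nu>))"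
    proof (rule INF_cong[OF refl])
      fix n
      have "(\<integral>\<^sup>+z\<in>C. h z (dyadic_above n x) \<partial>\<eta>) = (\<integral>\<^sup>+z\<in>C. f (dyadic_above n x) z \<partial>\<eta>)"
        using AE_good by (intro nn_integral_cong_AE) (auto elim!: eventually_mono simp: h_def)
      then show "(\<integral>\<^sup>+z\<in>C. h z (dyadic_above n x) \<partial>\<eta>) = emeasure \<nu> (\<pi> -` C \<inter> i -` {..dyadic_above n x} \<inter> space \<nu>)"
        by (simp add: f_eq C)
    qed
    also have "\<dots> = emeasure \<nu> (\<Inter>n. \<pi> -` C \<inter> i -` {..dyadic_above n x} \<inter> space \<nu>)"
    proof (rule INF_emeasure_decseq)
      show "range (\<lambda>n. \<pi> -` C \<inter> i -` {..dyadic_above n x} \<inter> space \<nu>) \<subseteq> sets \<nu>" by auto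
      show "decseq (\<lambda>n. \<pi> -` C \<inter> i -` {..dyadic_above n x} \<inter> space \<nu>)"
      proof (unfold monotone_def, intro allI impI)
        fix m n :: nat assume "m \<le> n"
        then show "\<pi> -` C \<inter> i -` {..dyadic_above n x} \<inter> space \<nu> \<subseteq> \<pi> -` C \<inter> i -` {..dyadic_above m x} \<inter> space \<nu>"
          using decseqD[OF dec, of m n] by auto
      qed
    qed simp
    also have "(\<Inter>n. \<pi> -` C \<inter> i -` {..dyadic_above n x} \<inter> space \<nu>) = \<pi> -` C \<inter> i -` {..x} \<inter> space \<nu>"
    proof -
      have "y \<le> x" if "\<And>n. y \<le> dyadic_above n x" for y
      proof (rule field_le_epsilon)
        fix e :: real assume "0 < e"
        then obtain n :: nat where "1 / 2 ^ n < e"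
          using real_arch_pow_inv[of e "1/2"] by (auto simp: power_one_over)
        then show "y \<le> x + e" using that[of n] dyadic_above_le[of n x] by linarith
      qed
      moreover have "y \<le> dyadic_above n x" if "y \<le> x" for y n
        using that dyadic_above_gt[of x n] by linarith
      ultimately show ?thesis by auto
    qed
    finally show ?thesis by simp
  qed
  have main: "emeasure \<nu> (\<pi> -` C \<inter> i -` A \<inter> space \<nu>) = (\<integral>\<^sup>+z\<in>C. emeasure (K z) A \<partial>\<eta>)"
    if C [measurable]: "C \<in> sets N" and A: "A \<in> sets borel" for C A
  proof -
    let ?D = "density \<eta> (indicator C)"
    define M1 where "M1 = distr (density \<nu> (indicator (\<pi> -` C \<inter> space \<nu>))) borel i"
    define M2 where "M2 = ?D \<bind> K"
    have ne: "space \<eta> \<noteq> {}" by (rule \<eta>.not_empty)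
    have K': "K \<in> ?D \<rightarrow>\<^sub>M subprob_algebra borel"
      using measurable_prob_algebraD[OF K_meas] by simp
    have M1: "emeasure M1 A = emeasure \<nu> (\<pi> -` C \<inter> i -` A \<inter> space \<nu>)" if [measurable]: "A \<in> sets borel" for A
    proof -
      have "emeasure M1 A = (\<integral>\<^sup>+x. indicator (\<pi> -` C \<inter> space \<nu>) x * indicator (i -` A \<inter> space \<nu>) x \<partial>\<nu>)"
        unfolding M1_def by (simp add: emeasure_distr emeasure_density)
      also have "\<dots> = (\<integral>\<^sup>+x. indicator (\<pi> -` C \<inter> i -` A \<inter> space \<nu>) x \<partial>\<nu>)"
        by (intro nn_integral_cong) (auto simp: indicator_def)
      finally show ?thesis by simp
    qed
    have M2: "emeasure M2 A = (\<integral>\<^sup>+z\<in>C. emeasure (K z) A \<partial>\<eta>)" if [measurable]: "A \<in> sets borel" for A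
    proof -
      have [measurable]: "(\<lambda>z. emeasure (K z) A) \<in> borel_measurable \<eta>"
        using measurable_compose[OF measurable_prob_algebraD[OF K_meas] measurable_emeasure_subprob_algebra[OF that]] .
      have "emeasure M2 A = (\<integral>\<^sup>+z. emeasure (K z) A \<partial>?D)"
        unfolding M2_def by (rule emeasure_bind[OF _ K' that]) (simp add: ne)
      also have "\<dots> = (\<integral>\<^sup>+z. indicator C z * emeasure (K z) A \<partial>\<eta>)"
        by (rule nn_integral_density) measurable
      finally show ?thesis by (simp add: mult.commute)
    qed
    have "M1 = M2"
    proof (rule measure_eqI_generator_eq[where E="range (\<lambda>a::real. {..a})" and \<Omega>=UNIV and A="\<lambda>n. {..real n}"])
      show "sets M1 = sigma_sets UNIV (range (\<lambda>a::real. {..a}))"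
        by (simp add: M1_def) (subst borel_eq_atMost, simp add: sets_measure_of_conv)
      have "sets M2 = sets borel" unfolding M2_def by (rule sets_bind) (auto simp: ne K_sets)
      then show "sets M2 = sigma_sets UNIV (range (\<lambda>a::real. {..a}))"
        by (simp) (subst borel_eq_atMost, simp add: sets_measure_of_conv)
      show "emeasure M1 X = emeasure M2 X" if "X \<in> range (\<lambda>a::real. {..a})" for X
        using that Iic[OF C] by (auto simp: M1 M2)
      show "(\<Union>n. {..real n}) = UNIV" using real_arch_simple by auto
    qed (auto simp: Int_stable_def M1)
    then show ?thesis using M1[OF A] M2[OF A] by simp
  qed
  show ?thesis using that[of K] K_meas main unfolding \<eta>_def by blast
qed

lemma disintegration_measurable:
  assumes "disintegration \<nu> \<eta> \<pi> D"
  shows "D \<in> \<eta> \<rightarrow>\<^sub>M subprob_algebra borel"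
    and "S \<in> sets borel \<Longrightarrow> (\<lambda>y. emeasure (D y) S) \<in> borel_measurable \<eta>"
proof -
  show D: "D \<in> \<eta> \<rightarrow>\<^sub>M subprob_algebra borel"
    using assms by (auto simp: disintegration_def intro: measurable_prob_algebraD)
  show "(\<lambda>y. emeasure (D y) S) \<in> borel_measurable \<eta>" if "S \<in> sets borel"
    by (rule measurable_compose[OF D measurable_emeasure_subprob_algebra[OF that]])
qed

text \<open>The kernel at \<open>y\<close> is concentrated on the fibre over \<open>y\<close>, so intersecting with \<open>\<pi> -` C\<close> either
  changes nothing or leaves nothing.\<close>
lemma disintegration_integral:
  assumes D: "disintegration \<nu> \<eta> \<pi> D" and sets: "sets \<eta> = sets borel" "prob_space \<eta>"
    and [measurable]: "\<pi> \<in> borel \<rightarrow>\<^sub>M borel" "S \<in> sets borel" "C \<in> sets borel"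
  shows "emeasure \<nu> (S \<inter> \<pi> -` C) = (\<integral>\<^sup>+y\<in>C. emeasure (D y) S \<partial>\<eta>)"
proof -
  have sp: "space \<eta> = UNIV" using sets_eq_imp_space_eq[OF sets(1)] by simp
  have SC: "S \<inter> \<pi> -` C \<in> sets borel"
    using measurable_sets[of \<pi> borel borel C] by auto
  have Dp: "D \<in> \<eta> \<rightarrow>\<^sub>M prob_algebra borel" using D by (simp add: disintegration_def)
  have "emeasure \<nu> (S \<inter> \<pi> -` C) = emeasure (\<eta> \<bind> D) (S \<inter> \<pi> -` C)"
    using D by (simp add: disintegration_def)
  also have "\<dots> = (\<integral>\<^sup>+y. emeasure (D y) (S \<inter> \<pi> -` C) \<partial>\<eta>)"
    by (rule emeasure_bind[OF _ disintegration_measurable(1)[OF D] SC]) (simp add: sp)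
  also have "\<dots> = (\<integral>\<^sup>+y\<in>C. emeasure (D y) S \<partial>\<eta>)"
  proof (rule nn_integral_cong_AE)
    have "AE y in \<eta>. emeasure (D y) (\<pi> -` {y}) = 1" using D by (simp add: disintegration_def)
    then show "AE y in \<eta>. emeasure (D y) (S \<inter> \<pi> -` C) = emeasure (D y) S * indicator C y"
    proof (rule AE_mp, intro AE_I2 impI)
      fix y assume y: "emeasure (D y) (\<pi> -` {y}) = 1" "y \<in> space \<eta>"
      have "D y \<in> space (prob_algebra borel)" using measurable_space[OF Dp y(2)] .
      then have s [measurable_cong]: "sets (D y) = sets borel" and p: "prob_space (D y)"
        by (auto simp: space_prob_algebra)
      interpret prob_space "D y" by fact
      have sp': "space (D y) = UNIV" using sets_eq_imp_space_eq[OF s] by simp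
      have m: "\<pi> -` {y} \<in> sets (D y)" using measurable_sets[of \<pi> borel borel "{y}"] by (simp add: s)
      then have AE: "AE x in D y. \<pi> x = y"
        using y(1) AE_in_set_eq_1[OF m] by (simp add: emeasure_eq_measure)
      show "emeasure (D y) (S \<inter> \<pi> -` C) = emeasure (D y) S * indicator C y"
      proof (cases "y \<in> C")
        case True
        have "emeasure (D y) (S \<inter> \<pi> -` C) = emeasure (D y) S"
          by (rule emeasure_eq_AE) (use AE SC True in \<open>auto elim!: eventually_mono simp: s\<close>)
        then show ?thesis using True by simp
      next
        case False
        have "emeasure (D y) (S \<inter> \<pi> -` C) = emeasure (D y) {}"
          by (rule emeasure_eq_AE) (use AE SC False in \<open>auto elim!: eventually_mono simp: s\<close>)
        then show ?thesis using False by simp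
      qed
    qed
  qed
  finally show ?thesis .
qed

lemma countable_basis_separates:
  obtains B :: "nat \<Rightarrow> 'a::{second_countable_topology, t1_space} set"
  where "\<And>n. open (B n)" "\<And>x y. (\<And>n. x \<in> B n \<Longrightarrow> y \<in> B n) \<Longrightarrow> x = y"
proof -
  obtain \<B> :: "'a set set" where \<B>: "countable \<B>" "topological_basis \<B>"
    using ex_countable_basis by blast
  define B where "B n = (from_nat_into (insert {} \<B>) n)" for n
  have c: "countable (insert {} \<B>)" using \<B> by simp
  have "open (B n)" for n
  proof -
    have "B n \<in> insert {} \<B>" unfolding B_def by (rule from_nat_into) simp
    then show ?thesis using topological_basis_open[OF \<B>(2)] by auto
  qed
  moreover have "x = y" if xy: "\<And>n. x \<in> B n \<Longrightarrow> y \<in> B n" for x y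
  proof (rule ccontr)
    assume "x \<noteq> y"
    then obtain U where U: "open U" "x \<in> U" "y \<notin> U" using t1_space by blast
    then obtain b where b: "b \<in> \<B>" "x \<in> b" "b \<subseteq> U" using topological_basisE[OF \<B>(2)] by metis
    then obtain n where "B n = b" using from_nat_into_surj[OF c, of b] unfolding B_def by auto
    then show False using xy[of n] b U by auto
  qed
  ultimately show ?thesis using that by blast
qed

text \<open>Code the points of the space by real numbers, take the conditional distributions of the code, and
  decode. The kernel at \<open>z\<close> gives full mass to the preimage of each basic open set around \<open>z\<close>, and
  countably many of these sets intersect in the fibre over \<open>z\<close>.\<close>
theorem disintegration_exists:
  fixes \<nu> :: "'x::polish_space measure" and \<pi> :: "'x \<Rightarrow> 'y::polish_space"
  assumes \<nu>: "prob_space \<nu>" and s [measurable_cong]: "sets \<nu> = sets borel"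
    and \<pi> [measurable]: "\<pi> \<in> borel \<rightarrow>\<^sub>M borel" and \<eta>: "distr \<nu> borel \<pi> = \<eta>"
  shows "\<exists>D. disintegration \<nu> \<eta> \<pi> D"
proof -
  interpret prob_space \<nu> by fact
  have sp: "space \<nu> = UNIV" using sets_eq_imp_space_eq[OF s] by simp
  have \<pi>' [measurable]: "\<pi> \<in> \<nu> \<rightarrow>\<^sub>M borel" by measurable
  have s\<eta> [measurable_cong]: "sets \<eta> = sets borel" and sp\<eta>: "space \<eta> = UNIV" unfolding \<eta>[symmetric] by simp_all
  have p\<eta>: "prob_space \<eta>" unfolding \<eta>[symmetric] by (rule prob_space_distr) measurable
  interpret \<eta>: prob_space \<eta> by fact
  obtain i :: "'x \<Rightarrow> real" and j where i [measurable]: "i \<in> borel_measurable borel"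
      and j [measurable]: "j \<in> borel_measurable borel" and ji: "\<And>x. j (i x) = x"
      and i_bounds: "\<And>x. 0 \<le> i x" "\<And>x. i x \<le> 1/2"
    using polish_real_retract by metis
  obtain K where K: "K \<in> \<eta> \<rightarrow>\<^sub>M prob_algebra borel"
    and K_eq: "\<And>C A. C \<in> sets borel \<Longrightarrow> A \<in> sets borel \<Longrightarrow>
      emeasure \<nu> (\<pi> -` C \<inter> i -` A \<inter> space \<nu>) = (\<integral>\<^sup>+z\<in>C. emeasure (K z) A \<partial>\<eta>)"
    unfolding \<eta>[symmetric]
  proof (rule real_conditional_distribution[OF \<nu> \<pi>', of i])
    show "i x \<le> 1" for x using i_bounds(2)[of x] by linarith
  qed (use i_bounds in auto)
  define D where "D z = distr (K z) borel j" for z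
  have K_sp: "sets (K z) = sets borel" "prob_space (K z)" for z
    using measurable_space[OF K, of z] by (auto simp: space_prob_algebra sp\<eta>)
  have D_meas: "D \<in> \<eta> \<rightarrow>\<^sub>M prob_algebra borel"
    unfolding D_def by (rule measurable_distr_prob_space2[OF K]) measurable
  have em_D: "emeasure (D z) S = emeasure (K z) (j -` S)" if "S \<in> sets borel" for z S
    unfolding D_def using that K_sp[of z] sets_eq_imp_space_eq[OF K_sp(1)[of z]]
    by (subst emeasure_distr) (auto cong: measurable_cong_sets)
  have D_eq: "emeasure \<nu> (\<pi> -` C \<inter> S) = (\<integral>\<^sup>+z\<in>C. emeasure (D z) S \<partial>\<eta>)"
    if [measurable]: "C \<in> sets borel" "S \<in> sets borel" for C S
  proof -
    have "j -` S \<in> sets borel" using measurable_sets[OF j, of S] by simp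
    from K_eq[OF that(1) this] show ?thesis by (simp add: em_D vimage_def ji sp)
  qed
  have D_prob: "prob_space (D z)" "sets (D z) = sets borel" for z
    using measurable_space[OF D_meas, of z] by (auto simp: space_prob_algebra sp\<eta>)
  have D_em [measurable]: "(\<lambda>z. emeasure (D z) S) \<in> borel_measurable \<eta>" if "S \<in> sets borel" for S
    using measurable_compose[OF measurable_prob_algebraD[OF D_meas] measurable_emeasure_subprob_algebra[OF that]] .
  have "\<eta> \<bind> D = \<nu>"
  proof (rule measure_eqI)
    show "sets (\<eta> \<bind> D) = sets \<nu>"
      using sets_bind[of \<eta> D borel] D_prob by (simp add: sp\<eta> s)
    fix S assume "S \<in> sets (\<eta> \<bind> D)"
    then have S: "S \<in> sets borel" using sets_bind[of \<eta> D borel] D_prob by (simp add: sp\<eta>)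
    have "emeasure (\<eta> \<bind> D) S = (\<integral>\<^sup>+z. emeasure (D z) S \<partial>\<eta>)"
      by (rule emeasure_bind[OF _ measurable_prob_algebraD[OF D_meas] S]) (simp add: sp\<eta>)
    then show "emeasure (\<eta> \<bind> D) S = emeasure \<nu> S"
      using D_eq[of UNIV S] S by simp
  qed
  moreover have "AE z in \<eta>. emeasure (D z) (\<pi> -` {z}) = 1"
  proof -
    obtain B :: "nat \<Rightarrow> 'y set" where B: "\<And>n. open (B n)" "\<And>x y. (\<And>n. x \<in> B n \<Longrightarrow> y \<in> B n) \<Longrightarrow> x = y"
      using countable_basis_separates by blast
    have pre: "\<pi> -` B n \<in> sets borel" for n using measurable_sets[OF \<pi>, of "B n"] B(1) by simp
    have "AE z in \<eta>. indicator (B n) z \<le> emeasure (D z) (\<pi> -` B n)" for n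
    proof (rule AE_le_of_nn_integral_le)
      fix C assume "C \<in> sets \<eta>"
      then have C [measurable]: "C \<in> sets borel" by (simp add: s\<eta>)
      have Bn [measurable]: "B n \<in> sets borel" using B(1) by simp
      have "(\<integral>\<^sup>+z\<in>C. indicator (B n) z \<partial>\<eta>) = (\<integral>\<^sup>+z. indicator (B n \<inter> C) z \<partial>\<eta>)"
        by (intro nn_integral_cong) (auto simp: indicator_def)
      also have "\<dots> = emeasure \<nu> (\<pi> -` (B n \<inter> C) \<inter> (\<pi> -` B n))"
        by (simp add: \<eta>[symmetric] emeasure_distr sp) (rule arg_cong[of _ _ "emeasure \<nu>"], auto)
      also have "\<dots> = (\<integral>\<^sup>+z\<in>(B n \<inter> C). emeasure (D z) (\<pi> -` B n) \<partial>\<eta>)"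
        by (rule D_eq) (use pre in auto)
      also have "\<dots> \<le> (\<integral>\<^sup>+z\<in>C. emeasure (D z) (\<pi> -` B n) \<partial>\<eta>)"
        by (intro nn_integral_mono) (auto simp: indicator_def)
      finally show "(\<integral>\<^sup>+z\<in>C. indicator (B n) z \<partial>\<eta>) \<le> (\<integral>\<^sup>+z\<in>C. emeasure (D z) (\<pi> -` B n) \<partial>\<eta>)" .
    qed (use B(1) pre in \<open>auto simp: s\<eta> less_top[symmetric] intro!: borel_measurable_indicator\<close>)
    then have "AE z in \<eta>. \<forall>n. indicator (B n) z \<le> emeasure (D z) (\<pi> -` B n)"
      by (simp add: AE_all_countable)
    then show ?thesis
    proof eventually_elim
      case (elim z)
      interpret Dz: prob_space "D z" by (rule D_prob)
      have "AE x in D z. z \<in> B n \<longrightarrow> \<pi> x \<in> B n" for n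
      proof (cases "z \<in> B n")
        case True
        then have "1 \<le> Dz.prob (\<pi> -` B n)" using elim[rule_format, of n]
          by (simp add: Dz.emeasure_eq_measure)
        then have "Dz.prob (\<pi> -` B n) = 1" using Dz.prob_le_1 by (intro antisym) auto
        then show ?thesis using Dz.AE_in_set_eq_1[of "\<pi> -` B n"] pre[of n] D_prob(2) by auto
      qed auto
      then have "AE x in D z. \<forall>n. z \<in> B n \<longrightarrow> \<pi> x \<in> B n" by (simp add: AE_all_countable)
      then have "AE x in D z. x \<in> \<pi> -` {z}"
        by (rule eventually_mono) (use B(2) in \<open>auto dest: sym\<close>)
      moreover have "\<pi> -` {z} \<in> sets (D z)" using measurable_sets[OF \<pi>, of "{z}"] D_prob(2) by simp
      ultimately show ?case using Dz.AE_in_set_eq_1[of "\<pi> -` {z}"] by (simp add: Dz.emeasure_eq_measure)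
    qed
  qed
  ultimately show ?thesis using D_meas unfolding disintegration_def by blast
qed

lemma disintegration_kernel:
  assumes "disintegration \<nu> \<eta> \<pi> D" "space \<eta> = UNIV"
  shows "prob_space (D y)" "sets (D y) = sets borel" "space (D y) = UNIV"
proof -
  have "D y \<in> space (prob_algebra borel)"
    using assms measurable_space[of D \<eta> "prob_algebra borel" y] by (auto simp: disintegration_def)
  then show "prob_space (D y)" and s: "sets (D y) = sets borel" by (auto simp: space_prob_algebra)
  show "space (D y) = UNIV" using sets_eq_imp_space_eq[OF s] by simp
qed

text \<open>Relative contractivity concerns every version of the disintegration, so the version
  may be improved on a null set.\<close>
lemma disintegration_modify:
  assumes D: "disintegration \<nu> \<eta> \<pi> D" and sp: "space \<eta> = UNIV" and N: "N \<in> null_sets \<eta>"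
  shows "disintegration \<nu> \<eta> \<pi> (\<lambda>y. if y \<in> N then D y\<^sub>0 else D y)"
proof -
  let ?D = "\<lambda>y. if y \<in> N then D y\<^sub>0 else D y"
  have Dm [measurable]: "D \<in> \<eta> \<rightarrow>\<^sub>M prob_algebra borel" using D by (simp add: disintegration_def)
  have [measurable]: "N \<in> sets \<eta>" using N by auto
  have c: "(\<lambda>y. D y\<^sub>0) \<in> \<eta> \<rightarrow>\<^sub>M prob_algebra borel"
    using measurable_space[OF Dm, of y\<^sub>0] sp by (intro measurable_const) auto
  have m: "?D \<in> \<eta> \<rightarrow>\<^sub>M prob_algebra borel"
    by (rule measurable_If_set[OF c Dm]) (simp add: sp)
  have AE: "AE y in \<eta>. ?D y = D y" using AE_not_in[OF N] by eventually_elim simp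
  have "\<eta> \<bind> ?D = \<eta> \<bind> D"
  proof (rule measure_eqI)
    have s: "sets (\<eta> \<bind> F) = sets borel" if "F \<in> \<eta> \<rightarrow>\<^sub>M prob_algebra borel" for F
    proof (rule sets_bind)
      show "sets (F y) = sets borel" if "y \<in> space \<eta>" for y
        using measurable_space[OF \<open>F \<in> _\<close> that] by (simp add: space_prob_algebra)
    qed (simp add: sp)
    show "sets (\<eta> \<bind> ?D) = sets (\<eta> \<bind> D)" by (simp only: s[OF m] s[OF Dm])
    fix S assume "S \<in> sets (\<eta> \<bind> ?D)"
    then have S: "S \<in> sets borel" by (simp only: s[OF m])
    have em: "emeasure (\<eta> \<bind> F) S = (\<integral>\<^sup>+y. emeasure (F y) S \<partial>\<eta>)" if "F \<in> \<eta> \<rightarrow>\<^sub>M prob_algebra borel" for F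
      by (rule emeasure_bind[OF _ measurable_prob_algebraD[OF that] S]) (simp add: sp)
    show "emeasure (\<eta> \<bind> ?D) S = emeasure (\<eta> \<bind> D) S"
      unfolding em[OF m] em[OF Dm] by (rule nn_integral_cong_AE) (use AE in eventually_elim, simp)
  qed
  moreover have "AE y in \<eta>. emeasure (?D y) (\<pi> -` {y}) = 1"
  proof -
    have "AE y in \<eta>. emeasure (D y) (\<pi> -` {y}) = 1" using D by (simp add: disintegration_def)
    with AE show ?thesis by eventually_elim simp
  qed
  ultimately show ?thesis using D m by (simp add: disintegration_def)
qed

section \<open>Approximation by a countable algebra of sets\<close>

text \<open>Terms for the sets of the algebra generated by a sequence of sets. They show that this algebra
  is countable.\<close>
datatype set_expr = Basic nat | Complement set_expr | Join set_expr set_expr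

instance set_expr :: countable by countable_datatype

primrec denote :: "(nat \<Rightarrow> 'a set) \<Rightarrow> set_expr \<Rightarrow> 'a set" where
  "denote B (Basic n) = B n"
| "denote B (Complement e) = - denote B e"
| "denote B (Join e f) = denote B e \<union> denote B f"

text \<open>The sets that can be approximated in measure by the algebra form a sigma-algebra: complements and
  finite unions are inherited from the algebra, and a countable union is a limit of finite ones.\<close>
lemma (in finite_measure) approximation_by_set_expr:
  assumes M: "sets M = sigma_sets UNIV (range B)" and A: "A \<in> sets M" and e: "0 < e"
  shows "\<exists>t. measure M ((A - denote B t) \<union> (denote B t - A)) < e"
proof -
  have "UNIV \<in> sets M" unfolding M by (rule sigma_sets_top)
  then have sp: "space M = UNIV" using sets.sets_into_space by blast
  have den: "denote B t \<in> sets M" for t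
  proof (induction t)
    case (Complement t)
    then show ?case using sets.compl_sets[of "denote B t" M] by (simp add: sp Compl_eq_Diff_UNIV)
  next
    case (Basic n)
    show ?case by (simp add: M)
  next
    case (Join s t)
    then show ?case by simp
  qed
  define d where "d X Y = measure M ((X - Y) \<union> (Y - X))" for X Y
  have tri: "d X Z \<le> d X Y + d Y Z" if "X \<in> sets M" "Y \<in> sets M" "Z \<in> sets M" for X Y Z
  proof -
    have "d X Z \<le> measure M (((X - Y) \<union> (Y - X)) \<union> ((Y - Z) \<union> (Z - Y)))"
      unfolding d_def using that by (intro finite_measure_mono) auto
    also have "\<dots> \<le> d X Y + d Y Z"
      unfolding d_def using that by (intro measure_Un_le) auto
    finally show ?thesis .
  qed
  define good where "good X \<longleftrightarrow> X \<in> sets M \<and> (\<forall>e>0. \<exists>t. d X (denote B t) < e)" for X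
  have compl: "good (- X)" if "good X" for X
  proof -
    have "X \<in> sets M" using that by (simp add: good_def)
    then have "- X \<in> sets M" using sets.compl_sets[of X M] by (simp add: sp Compl_eq_Diff_UNIV)
    moreover have "d (- X) (denote B (Complement t)) = d X (denote B t)" for t
      unfolding d_def by (rule arg_cong[of _ _ "measure M"]) auto
    ultimately show ?thesis using that unfolding good_def by metis
  qed
  have un: "good (X \<union> Y)" if X: "good X" and Y: "good Y" for X Y
    unfolding good_def
  proof (intro conjI allI impI)
    show "X \<union> Y \<in> sets M" using X Y by (auto simp: good_def)
    fix e :: real assume "0 < e"
    then obtain s t where st: "d X (denote B s) < e / 2" "d Y (denote B t) < e / 2"
      using X Y unfolding good_def by (metis half_gt_zero)
    have "d (X \<union> Y) (denote B (Join s t)) \<le>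
        measure M (((X - denote B s) \<union> (denote B s - X)) \<union> ((Y - denote B t) \<union> (denote B t - Y)))"
      unfolding d_def using X Y den by (intro finite_measure_mono) (auto simp: good_def)
    also have "\<dots> \<le> d X (denote B s) + d Y (denote B t)"
      unfolding d_def using X Y den by (intro measure_Un_le) (auto simp: good_def)
    finally show "\<exists>r. d (X \<union> Y) (denote B r) < e" using st by (intro exI[of _ "Join s t"]) linarith
  qed
  have "good X" if "X \<in> sigma_sets UNIV (range B)" for X
    using that
  proof induction
    case (Basic X)
    then obtain n where "X = B n" by auto
    moreover have "d (B n) (denote B (set_expr.Basic n)) = 0" by (simp add: d_def)
    moreover have "B n \<in> sets M" by (simp add: M)
    ultimately show ?case unfolding good_def by metis
  next
    case Empty
    have "d {} (denote B (Complement (Join (set_expr.Basic 0) (Complement (set_expr.Basic 0))))) = 0"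
      by (simp add: d_def)
    then show ?case unfolding good_def by (metis sets.empty_sets)
  next
    case (Compl X)
    then show ?case using compl[of X] by (simp add: Compl_eq_Diff_UNIV)
  next
    case (Union X)
    define U where "U n = (\<Union>i\<le>n. X i)" for n
    have U: "good (U n)" for n
      unfolding U_def by (induction n) (use Union un in \<open>auto simp: atMost_Suc\<close>)
    have eq: "(\<Union>n. U n) = (\<Union>n. X n)" unfolding U_def by blast
    have US: "U n \<in> sets M" for n using U by (simp add: good_def)
    show ?case
      unfolding good_def
    proof (intro conjI allI impI)
      show XS: "(\<Union>n. X n) \<in> sets M" using US eq by (metis sets.countable_UN range_subsetD image_subsetI)
      fix e :: real assume e: "0 < e"
      have "incseq U" unfolding U_def monotone_def by force
      then have "(\<lambda>n. measure M (U n)) \<longlonglongrightarrow> measure M (\<Union>n. X n)"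
        using finite_Lim_measure_incseq[of U] US eq by auto
      then have "eventually (\<lambda>n. measure M (\<Union>n. X n) - e / 2 < measure M (U n)) sequentially"
        by (rule order_tendstoD) (use e in simp)
      then obtain n where n: "measure M (\<Union>n. X n) - e / 2 < measure M (U n)"
        by (auto simp: eventually_sequentially)
      have sub: "U n \<subseteq> (\<Union>n. X n)" unfolding U_def by blast
      then have "(\<Union>n. X n) - U n \<union> (U n - (\<Union>n. X n)) = (\<Union>n. X n) - U n" by blast
      then have "d (\<Union>n. X n) (U n) < e / 2"
        unfolding d_def using n finite_measure_Diff[OF XS US sub] by simp
      moreover obtain t where "d (U n) (denote B t) < e / 2"
        using U e unfolding good_def by (metis half_gt_zero)
      ultimately show "\<exists>t. d (\<Union>n. X n) (denote B t) < e"
        using tri[OF XS US[of n] den[of t]] by (intro exI[of _ t]) linarith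
    qed
  qed
  then show ?thesis using A e unfolding M good_def d_def by blast
qed

text \<open>A set of positive measure fills almost all of some member of a countable family. This
  replaces density points, so that one member can be chosen for many sets at once.\<close>
lemma countable_dense_family:
  fixes M :: "'a::second_countable_topology measure"
  assumes "finite_measure M" and s: "sets M = sets borel"
  shows "\<exists>C :: nat \<Rightarrow> 'a set. (\<forall>n. C n \<in> sets borel) \<and>
    (\<forall>A r. A \<in> sets borel \<longrightarrow> 0 < measure M A \<longrightarrow> r < 1 \<longrightarrow>
      (\<exists>n. 0 < measure M (C n) \<and> r * measure M (C n) < measure M (C n \<inter> A)))"
proof -
  interpret finite_measure M by fact
  obtain \<B> :: "'a set set" where \<B>: "countable \<B>" "topological_basis \<B>"
    using ex_countable_basis by blast
  have c: "countable (insert {} \<B>)" using \<B> by simp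
  define B where "B = from_nat_into (insert {} \<B>)"
  have rB: "range B = insert {} \<B>" unfolding B_def using c by (intro range_from_nat_into) auto
  have "topological_basis (insert {} \<B>)"
    using \<B>(2) unfolding topological_basis_def
    by (metis (no_types, lifting) insertE insertI2 open_empty subsetD subsetI subset_insertI)
  then have "(borel :: 'a measure) = sigma UNIV (range B)"
    using borel_eq_countable_basis[OF c] rB by simp
  then have "sets (borel :: 'a measure) = sets (sigma UNIV (range B))" by (rule arg_cong)
  also have "\<dots> = sigma_sets UNIV (range B)" by (rule sets_measure_of) simp
  finally have "sets (borel :: 'a measure) = sigma_sets UNIV (range B)" .
  then have sB: "sets M = sigma_sets UNIV (range B)" by (simp add: s)
  have den: "denote B t \<in> sets borel" for t
  proof (induction t)
    case (Basic n)
    then show ?case using sB s by auto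
  qed auto
  show ?thesis
  proof (intro exI[of _ "\<lambda>n. denote B (from_nat n)"] conjI allI impI)
    fix A and r :: real assume A: "A \<in> sets borel" "0 < measure M A" and r: "r < 1"
    \<comment> \<open>An error below \<open>(1 - r') a / 2\<close> leaves more than half of \<open>A\<close> inside the approximating set, and its
      part outside \<open>A\<close> is then small enough compared with the part inside.\<close>
    define r' where "r' = max r 0"
    define a where "a = measure M A"
    define e where "e = (1 - r') * a / 2"
    have r': "0 \<le> r'" "r' < 1" "r \<le> r'" using r by (auto simp: r'_def)
    have "0 < e" unfolding e_def a_def using A r' by simp
    then obtain t where t: "measure M ((A - denote B t) \<union> (denote B t - A)) < e"
      using approximation_by_set_expr[OF sB, of A e] A s by auto
    let ?C = "denote B t"
    have [simp]: "A \<in> sets M" "?C \<in> sets M" using A den s by auto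
    have m: "measure M X < e" if "X \<subseteq> (A - ?C) \<union> (?C - A)" for X
      using t finite_measure_mono[OF that] by force
    have 1: "measure M A = measure M (?C \<inter> A) + measure M (A - ?C)"
      by (subst finite_measure_Union[symmetric]) (auto intro!: arg_cong[of _ _ "measure M"])
    have 2: "measure M ?C = measure M (?C \<inter> A) + measure M (?C - A)"
      by (subst finite_measure_Union[symmetric]) (auto intro!: arg_cong[of _ _ "measure M"])
    have 3: "measure M (A - ?C) < e" "measure M (?C - A) < e" by (intro m; blast)+
    have "e \<le> a / 2" unfolding e_def using r' A a_def by (simp add: mult_left_le_one_le)
    then have i: "a - e < measure M (?C \<inter> A)" "0 < measure M (?C \<inter> A)"
      using 1 3 A by (auto simp: a_def)
    have "r * measure M ?C \<le> r' * measure M ?C" using r' by (intro mult_right_mono) auto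
    also have "\<dots> = r' * measure M (?C \<inter> A) + r' * measure M (?C - A)" by (simp add: 2 distrib_left)
    also have "\<dots> \<le> r' * measure M (?C \<inter> A) + e"
      using r' 3 mult_left_le_one_le[of "measure M (?C - A)" r'] by auto
    also have "\<dots> < measure M (?C \<inter> A)"
    proof -
      have "e \<le> (1 - r') * (a / 2)" by (simp add: e_def)
      also have "\<dots> < (1 - r') * measure M (?C \<inter> A)"
        using i \<open>e \<le> a / 2\<close> r' by (intro mult_strict_left_mono) auto
      finally show ?thesis by (simp add: algebra_simps)
    qed
    finally have "r * measure M ?C < measure M (?C \<inter> A)" .
    moreover have "0 < measure M ?C" using i 2 measure_nonneg[of M "?C - A"] by linarith
    ultimately show "\<exists>n. 0 < measure M (denote B (from_nat n)) \<and>
        r * measure M (denote B (from_nat n)) < measure M (denote B (from_nat n) \<inter> A)"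
      by (metis from_nat_to_nat)
  qed (rule den)
qed

section \<open>Relatively contractive maps\<close>

lemma G_spaceD:
  assumes "G_space act \<nu>"
  shows "prob_space \<nu>" "sets \<nu> = sets borel" "space \<nu> = UNIV" "act 0 x = x" "act (g + h) x = act g (act h x)"
    "(\<lambda>(g, x). act g x) \<in> borel \<Otimes>\<^sub>M borel \<rightarrow>\<^sub>M borel" "act g \<in> borel \<rightarrow>\<^sub>M borel"
    "N \<in> sets borel \<Longrightarrow> act g -` N \<in> null_sets \<nu> \<longleftrightarrow> N \<in> null_sets \<nu>"
proof -
  show s: "sets \<nu> = sets borel" and m: "(\<lambda>(g, x). act g x) \<in> borel \<Otimes>\<^sub>M borel \<rightarrow>\<^sub>M borel"
    using assms by (auto simp: G_space_def)
  show "space \<nu> = UNIV" using sets_eq_imp_space_eq[OF s] by simp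
  have "(\<lambda>x. (g, x)) \<in> borel \<rightarrow>\<^sub>M borel \<Otimes>\<^sub>M borel" by measurable
  from measurable_compose[OF this m] show "act g \<in> borel \<rightarrow>\<^sub>M borel" by simp
qed (use assms in \<open>auto simp: G_space_def\<close>)

text \<open>The set \<open>E'\<close> consists of the points that lie in \<open>h E\<close> for most \<open>h\<close> in \<open>C\<close>. By Markov's inequality
  and Fubini's theorem, \<open>s\<close> times the measure of \<open>g E'\<close> is at most the average over \<open>h\<close> in \<open>C\<close> of the
  measures of \<open>(g + h) E\<close>. A bound for almost every translate of \<open>E\<close> becomes one for every translate of
  \<open>E'\<close>: the exceptional \<open>h\<close> depend on \<open>g\<close> but form a null set, by left quasi-invariance.\<close>
lemma smoothed_set_small:
  fixes act :: "'g::{topological_group_add, second_countable_topology, t2_space} \<Rightarrow> 'x::polish_space \<Rightarrow> 'x"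
  assumes act: "\<And>g h x. act (g + h) x = act g (act h x)"
      "(\<lambda>(g, x). act g x) \<in> borel \<Otimes>\<^sub>M borel \<rightarrow>\<^sub>M borel"
    and m: "prob_space m" "sets m = sets borel"
    and \<kappa>: "finite_measure \<kappa>" "sets \<kappa> = sets borel"
      "\<And>a A. A \<in> null_sets \<kappa> \<Longrightarrow> (+) a -` A \<in> null_sets \<kappa>"
    and [measurable]: "E \<in> sets borel" "C \<in> sets borel" and C: "0 < measure \<kappa> C"
    and bound: "AE h in \<kappa>. emeasure m (act (- h) -` E) \<le> ennreal c"
    and s: "0 < s" and c: "0 \<le> c"
    and E': "E' = {w. s * measure \<kappa> C < measure \<kappa> (C \<inter> {h. act (- h) w \<in> E})}"
  shows "E' \<in> sets borel" "measure m (act (- g) -` E') \<le> c / s"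
proof -
  interpret \<kappa>: finite_measure \<kappa> by fact
  interpret m: prob_space m by fact
  note [measurable_cong] = m(2) \<kappa>(2)
  note [measurable] = act(2)
  have sp: "space m = UNIV" "space \<kappa> = UNIV" "space (borel :: 'x measure) = UNIV"
    using sets_eq_imp_space_eq[OF m(2)] sets_eq_imp_space_eq[OF \<kappa>(2)] by simp_all
  have [measurable]: "(uminus :: 'g \<Rightarrow> 'g) \<in> borel_measurable borel"
    by (intro borel_measurable_continuous_onI continuous_intros)
  have jm: "(\<lambda>p. act (- (g + snd p)) (fst p)) \<in> (borel \<Otimes>\<^sub>M borel) \<rightarrow>\<^sub>M borel" for g
  proof -
    have "(\<lambda>p. (- (g + snd p), fst p)) \<in> (borel :: 'x measure) \<Otimes>\<^sub>M (borel :: 'g measure) \<rightarrow>\<^sub>M borel \<Otimes>\<^sub>M borel"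
      by measurable
    from measurable_compose[OF this act(2)] show ?thesis by simp
  qed
  have jset: "{p. snd p \<in> C \<and> act (- (g + snd p)) (fst p) \<in> E} \<in> sets (borel \<Otimes>\<^sub>M borel)" for g
  proof -
    have "{p \<in> space (borel \<Otimes>\<^sub>M borel). snd p \<in> C \<and> act (- (g + snd p)) (fst p) \<in> E} \<in> sets (borel \<Otimes>\<^sub>M borel)"
      using jm[of g] by measurable
    then show ?thesis by (simp add: space_pair_measure)
  qed
  have slice: "(\<lambda>w. emeasure \<kappa> (C \<inter> {h. act (- (g + h)) w \<in> E})) \<in> borel_measurable borel" for g
  proof -
    have "{p. snd p \<in> C \<and> act (- (g + snd p)) (fst p) \<in> E} \<in> sets (borel \<Otimes>\<^sub>M \<kappa>)"
      using jset[of g] by (simp cong: sets_pair_measure_cong add: \<kappa>(2))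
    from \<kappa>.measurable_emeasure_Pair[OF this]
    show ?thesis by (simp add: vimage_def Int_def)
  qed
  show E'm [measurable]: "E' \<in> sets borel"
    using slice[of 0] unfolding E' measure_def by simp measurable
  let ?S = "{p. snd p \<in> C \<and> act (- (g + snd p)) (fst p) \<in> E}"
  have S: "?S \<in> sets (m \<Otimes>\<^sub>M \<kappa>)"
    using jset[of g] by (simp cong: sets_pair_measure_cong add: \<kappa>(2) m(2))
  interpret p: pair_sigma_finite m \<kappa> ..
  obtain N where N: "{h \<in> space \<kappa>. \<not> emeasure m (act (- h) -` E) \<le> ennreal c} \<subseteq> N" "N \<in> null_sets \<kappa>"
    using bound by (auto elim!: AE_E3 simp: null_sets_def)
  have bound': "AE h in \<kappa>. emeasure m (act (- (g + h)) -` E) \<le> ennreal c"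
    by (rule AE_I'[OF \<kappa>(3)[OF N(2), of g]]) (use N(1) in \<open>auto simp: sp\<close>)
  have gE: "act (- g) -` E' \<in> sets borel"
  proof -
    have "(\<lambda>x. (- g, x)) \<in> (borel :: 'x measure) \<rightarrow>\<^sub>M borel \<Otimes>\<^sub>M borel" by measurable
    from measurable_compose[OF this act(2)] have "act (- g) \<in> borel \<rightarrow>\<^sub>M borel" by simp
    from measurable_sets[OF this E'm] show ?thesis by simp
  qed
  have "ennreal (s * measure \<kappa> C) * emeasure m (act (- g) -` E') = (\<integral>\<^sup>+w. ennreal (s * measure \<kappa> C) * indicator (act (- g) -` E') w \<partial>m)"
    using gE by (simp add: nn_integral_cmult_indicator m(2))
  also have "\<dots> \<le> (\<integral>\<^sup>+w. emeasure \<kappa> (C \<inter> {h. act (- (g + h)) w \<in> E}) \<partial>m)"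
  proof (intro nn_integral_mono)
    fix w
    have "act (- h) (act (- g) w) = act (- (g + h)) w" for h
      by (simp add: act(1)[symmetric] minus_add)
    then have "act (- g) w \<in> E' \<Longrightarrow> s * measure \<kappa> C < measure \<kappa> (C \<inter> {h. act (- (g + h)) w \<in> E})"
      by (simp add: E')
    then show "ennreal (s * measure \<kappa> C) * indicator (act (- g) -` E') w \<le> emeasure \<kappa> (C \<inter> {h. act (- (g + h)) w \<in> E})"
      by (auto simp: indicator_def \<kappa>.emeasure_eq_measure intro!: ennreal_leI less_imp_le)
  qed
  also have "\<dots> = emeasure (m \<Otimes>\<^sub>M \<kappa>) ?S"
    by (subst \<kappa>.emeasure_pair_measure_alt[OF S]) (simp add: vimage_def Int_def)
  also have "\<dots> = (\<integral>\<^sup>+h. emeasure m ((\<lambda>w. (w, h)) -` ?S) \<partial>\<kappa>)"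
    by (rule p.emeasure_pair_measure_alt2[OF S])
  also have "\<dots> \<le> (\<integral>\<^sup>+h. ennreal c * indicator C h \<partial>\<kappa>)"
  proof (rule nn_integral_mono_AE, use bound' in eventually_elim)
    fix h assume "emeasure m (act (- (g + h)) -` E) \<le> ennreal c"
    then show "emeasure m ((\<lambda>w. (w, h)) -` ?S) \<le> ennreal c * indicator C h"
      by (auto simp: indicator_def vimage_def)
  qed
  also have "\<dots> = ennreal c * emeasure \<kappa> C" by (rule nn_integral_cmult_indicator) (simp add: \<kappa>(2))
  finally have "ennreal (s * measure \<kappa> C * measure m (act (- g) -` E')) \<le> ennreal (c * measure \<kappa> C)"
    using s c by (simp add: m.emeasure_eq_measure \<kappa>.emeasure_eq_measure ennreal_mult[symmetric])
  then have "s * measure \<kappa> C * measure m (act (- g) -` E') \<le> c * measure \<kappa> C"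
    using c by (simp add: ennreal_le_iff)
  then have "s * measure m (act (- g) -` E') \<le> c"
    using C by (simp add: mult.assoc[symmetric] mult.commute[of _ "measure \<kappa> C"] mult.left_commute[of _ "measure \<kappa> C"])
  then show "measure m (act (- g) -` E') \<le> c / s" using s by (simp add: field_simps)
qed

text \<open>Let \<open>E'\<close> be the smoothed set for a member of the countable family. Its translates have measure at
  most \<open>c / s < 1\<close> for every fibre measure, which contradicts contraction unless \<open>E'\<close> is null. All these
  countably many sets being null, almost no orbit meets \<open>E\<close> in a set of times of positive measure,
  so by Fubini's theorem some translate of \<open>E\<close>, and hence \<open>E\<close>, is null.\<close>
lemma contractive_null:
  fixes actX :: "'g::{topological_group_add, second_countable_topology, t2_space} \<Rightarrow> 'x::polish_space \<Rightarrow> 'x"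
    and actY :: "'g \<Rightarrow> 'y::polish_space \<Rightarrow> 'y"
  assumes lc: "locally_compact_space (euclidean :: 'g topology)"
    and X: "G_space actX \<nu>" and \<pi> [measurable]: "\<pi> \<in> borel \<rightarrow>\<^sub>M borel" and \<eta>: "distr \<nu> borel \<pi> = \<eta>"
    and contr: "rel_contractive actX \<nu> actY \<eta> \<pi>"
    and E [measurable]: "E \<in> sets borel" and c: "0 \<le> c" "c < 1"
    and bound: "\<And>g C. C \<in> sets borel \<Longrightarrow> emeasure \<nu> (actX g -` E \<inter> \<pi> -` C) \<le> ennreal c * emeasure \<eta> C"
  shows "emeasure \<nu> E = 0"
proof -
  note X' = G_spaceD[OF X]
  interpret prob_space \<nu> by (rule X')
  have s\<eta> [measurable_cong]: "sets \<eta> = sets borel" and sp\<eta>: "space \<eta> = UNIV" unfolding \<eta>[symmetric] by simp_all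
  have "\<pi> \<in> \<nu> \<rightarrow>\<^sub>M borel" using \<pi> by (simp cong: measurable_cong_sets add: X'(2))
  then have p\<eta>: "prob_space \<eta>" unfolding \<eta>[symmetric] by (rule prob_space_distr)
  interpret \<eta>: prob_space \<eta> by fact
  obtain \<kappa> :: "'g measure" where s\<kappa> [measurable_cong]: "sets \<kappa> = sets borel" and f\<kappa>: "finite_measure \<kappa>"
      and nz: "emeasure \<kappa> UNIV \<noteq> 0" and inv: "\<And>a A. A \<in> null_sets \<kappa> \<Longrightarrow> (+) a -` A \<in> null_sets \<kappa>"
    using finite_left_quasi_invariant_measure[OF lc] by metis
  interpret \<kappa>: finite_measure \<kappa> by fact
  have sp\<kappa>: "space \<kappa> = UNIV" using sets_eq_imp_space_eq[OF s\<kappa>] by simp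
  have [measurable]: "(uminus :: 'g \<Rightarrow> 'g) \<in> borel_measurable borel"
    by (intro borel_measurable_continuous_onI continuous_intros)
  note [measurable] = X'(6)
  have pre: "actX g -` A \<in> sets borel" if "A \<in> sets borel" for g A
    using measurable_sets[OF X'(7) that, of g] by simp
  obtain D where D: "disintegration \<nu> \<eta> \<pi> D"
    using disintegration_exists[OF X'(1,2) \<pi> \<eta>] by blast
  have le: "AE y in \<eta>. emeasure (D y) (actX g -` E) \<le> ennreal c" for g
  proof (rule AE_le_of_nn_integral_le)
    fix C assume "C \<in> sets \<eta>"
    then have C: "C \<in> sets borel" by (simp add: s\<eta>)
    have "(\<integral>\<^sup>+y\<in>C. emeasure (D y) (actX g -` E) \<partial>\<eta>) = emeasure \<nu> (actX g -` E \<inter> \<pi> -` C)"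
      by (rule disintegration_integral[OF D s\<eta> p\<eta> \<pi> pre[OF E] C, symmetric])
    also have "\<dots> \<le> ennreal c * emeasure \<eta> C" by (rule bound[OF C])
    also have "\<dots> = (\<integral>\<^sup>+y\<in>C. ennreal c \<partial>\<eta>)" using C by (simp add: nn_integral_cmult_indicator s\<eta>)
    finally show "(\<integral>\<^sup>+y\<in>C. emeasure (D y) (actX g -` E) \<partial>\<eta>) \<le> (\<integral>\<^sup>+y\<in>C. ennreal c \<partial>\<eta>)" .
  next
    show "(\<lambda>y. emeasure (D y) (actX g -` E)) \<in> borel_measurable \<eta>"
      by (rule disintegration_measurable(2)[OF D pre[OF E]])
    have "(\<integral>\<^sup>+y. emeasure (D y) (actX g -` E) \<partial>\<eta>) \<le> (\<integral>\<^sup>+y. 1 \<partial>\<eta>)"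
      by (intro nn_integral_mono prob_space.emeasure_le_1 disintegration_kernel(1)[OF D sp\<eta>])
    then show "(\<integral>\<^sup>+y. emeasure (D y) (actX g -` E) \<partial>\<eta>) < \<infinity>"
      by (simp add: \<eta>.emeasure_space_1 le_less_trans[OF _ ennreal_one_less_top])
  qed simp
  have "AE y in \<eta>. AE h in \<kappa>. emeasure (D y) (actX (- h) -` E) \<le> ennreal c"
  proof -
    interpret p: pair_sigma_finite \<eta> \<kappa> ..
    have "(\<lambda>q. (- snd (fst q), snd q)) \<in> (\<eta> \<Otimes>\<^sub>M \<kappa>) \<Otimes>\<^sub>M (borel :: 'x measure) \<rightarrow>\<^sub>M borel \<Otimes>\<^sub>M borel"
      by measurable
    from measurable_compose[OF this X'(6)]
    have "(\<lambda>q. actX (- snd (fst q)) (snd q)) \<in> (\<eta> \<Otimes>\<^sub>M \<kappa>) \<Otimes>\<^sub>M (borel :: 'x measure) \<rightarrow>\<^sub>M borel" by simp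
    from measurable_sets[OF this E]
    have "(SIGMA p:space (\<eta> \<Otimes>\<^sub>M \<kappa>). actX (- snd p) -` E) \<in> sets ((\<eta> \<Otimes>\<^sub>M \<kappa>) \<Otimes>\<^sub>M borel)"
      by (rule back_subst[of "\<lambda>A. A \<in> sets _"]) (auto simp: space_pair_measure)
    moreover have "(\<lambda>p. D (fst p)) \<in> \<eta> \<Otimes>\<^sub>M \<kappa> \<rightarrow>\<^sub>M subprob_algebra borel"
      by (rule measurable_compose[OF measurable_fst disintegration_measurable(1)[OF D]])
    ultimately have [measurable]: "(\<lambda>p. emeasure (D (fst p)) (actX (- snd p) -` E)) \<in> borel_measurable (\<eta> \<Otimes>\<^sub>M \<kappa>)"
      by (rule emeasure_measurable_subprob_algebra2)
    have "{p\<in>space (\<eta> \<Otimes>\<^sub>M \<kappa>). emeasure (D (fst p)) (actX (- snd p) -` E) \<le> ennreal c} \<in> sets (\<eta> \<Otimes>\<^sub>M \<kappa>)"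
      by measurable
    from p.AE_commute[of "\<lambda>y h. emeasure (D y) (actX (- h) -` E) \<le> ennreal c", OF this]
    show ?thesis using le by simp
  qed
  then obtain N where N: "{y \<in> space \<eta>. \<not> (AE h in \<kappa>. emeasure (D y) (actX (- h) -` E) \<le> ennreal c)} \<subseteq> N" "N \<in> null_sets \<eta>"
    by (auto elim!: AE_E simp: null_sets_def)
  have "N \<noteq> UNIV" using N(2) \<eta>.emeasure_space_1 by (auto simp: null_sets_def sp\<eta>)
  then obtain y\<^sub>0 where y\<^sub>0: "y\<^sub>0 \<notin> N" by auto
  \<comment> \<open>Replacing the kernel on the null set makes the estimate hold at every point.\<close>
  define D' where "D' = (\<lambda>y. if y \<in> N then D y\<^sub>0 else D y)"
  have D': "disintegration \<nu> \<eta> \<pi> D'"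
    unfolding D'_def by (rule disintegration_modify[OF D sp\<eta> N(2)])
  have D'_le: "AE h in \<kappa>. emeasure (D' y) (actX (- h) -` E) \<le> ennreal c" for y
    using N(1) y\<^sub>0 unfolding D'_def by (auto simp: sp\<eta> subset_eq)
  note D'k = disintegration_kernel[OF D' sp\<eta>]
  \<comment> \<open>Any number strictly between \<open>c\<close> and 1 would do.\<close>
  define s where "s = (1 + c) / 2"
  have s: "0 < s" "c < s" "s < 1" using c by (auto simp: s_def)
  define F where "F C = {w. s * measure \<kappa> C < measure \<kappa> (C \<inter> {h. actX (- h) w \<in> E})}" for C
  have F: "F C \<in> sets borel" "\<And>g y. measure (D' y) (actX (- g) -` F C) \<le> c / s"
    if "C \<in> sets borel" "0 < measure \<kappa> C" for C
    using smoothed_set_small[OF X'(5,6) D'k(1,2) f\<kappa> s\<kappa> inv E that D'_le s(1) c(1) F_def] by auto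
  have F_null: "emeasure \<nu> (F C) = 0" if C: "C \<in> sets borel" "0 < measure \<kappa> C" for C
  proof -
    have "AE y in \<eta>. measure (D' y) (F C) > 0 \<longrightarrow>
           (\<exists>g :: nat \<Rightarrow> 'g. (\<lambda>n. measure (translate actX (- g n) (D' (actY (g n) y))) (F C)) \<longlonglongrightarrow> 1)"
      using contr D' F(1)[OF C] unfolding rel_contractive_def by blast
    moreover have no_limit: False if lim: "(\<lambda>n. measure (translate actX (- g n) (D' (actY (g n) y))) (F C)) \<longlonglongrightarrow> 1"
      for g :: "nat \<Rightarrow> 'g" and y
    proof -
      have "measure (translate actX (- g n) (D' (actY (g n) y))) (F C) \<le> c / s" for n
      proof -
        have "actX (- g n) \<in> D' (actY (g n) y) \<rightarrow>\<^sub>M borel"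
          using X'(7) by (simp cong: measurable_cong_sets add: D'k(2))
        then show ?thesis unfolding translate_def using F[OF C] by (simp add: measure_distr D'k(3))
      qed
      then have "1 \<le> c / s" by (intro LIMSEQ_le_const2[OF lim]) auto
      then show False using s by (simp add: field_simps)
    qed
    ultimately have "AE y in \<eta>. emeasure (D' y) (F C) = 0"
    proof (elim eventually_mono)
      fix y assume "measure (D' y) (F C) > 0 \<longrightarrow>
           (\<exists>g :: nat \<Rightarrow> 'g. (\<lambda>n. measure (translate actX (- g n) (D' (actY (g n) y))) (F C)) \<longlonglongrightarrow> 1)"
      then have "\<not> measure (D' y) (F C) > 0"
        by (auto dest: no_limit)
      then have "measure (D' y) (F C) = 0" by (simp add: not_less measure_le_0_iff)
      then show "emeasure (D' y) (F C) = 0"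
        using D'k(1) by (simp add: finite_measure.emeasure_eq_measure prob_space.finite_measure)
    qed
    moreover have "emeasure \<nu> (F C \<inter> \<pi> -` UNIV) = (\<integral>\<^sup>+y\<in>UNIV. emeasure (D' y) (F C) \<partial>\<eta>)"
      by (rule disintegration_integral[OF D' s\<eta> p\<eta> \<pi> F(1)[OF C]]) simp
    ultimately show ?thesis by (simp add: nn_integral_0_iff_AE disintegration_measurable(2)[OF D' F(1)[OF C]])
  qed
  obtain C :: "nat \<Rightarrow> 'g set" where "(\<forall>n. C n \<in> sets borel) \<and>
    (\<forall>A r. A \<in> sets borel \<longrightarrow> 0 < measure \<kappa> A \<longrightarrow> r < 1 \<longrightarrow>
      (\<exists>n. 0 < measure \<kappa> (C n) \<and> r * measure \<kappa> (C n) < measure \<kappa> (C n \<inter> A)))"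
    using countable_dense_family[OF f\<kappa> s\<kappa>] ..
  then have C: "\<And>n. C n \<in> sets borel"
    "\<And>A r. A \<in> sets borel \<Longrightarrow> 0 < measure \<kappa> A \<Longrightarrow> r < 1 \<Longrightarrow>
      \<exists>n. 0 < measure \<kappa> (C n) \<and> r * measure \<kappa> (C n) < measure \<kappa> (C n \<inter> A)"
    by simp_all
  have "AE w in \<nu>. 0 < measure \<kappa> (C n) \<longrightarrow> w \<notin> F (C n)" for n
  proof (cases "0 < measure \<kappa> (C n)")
    case True
    then have "F (C n) \<in> null_sets \<nu>" using F_null[OF C(1)] F(1)[OF C(1)] by (auto simp: null_sets_def X'(2))
    then show ?thesis by (auto dest: AE_not_in elim: eventually_mono)
  qed auto
  then have AE_F: "AE w in \<nu>. \<forall>n. 0 < measure \<kappa> (C n) \<longrightarrow> w \<notin> F (C n)" by (simp add: AE_all_countable)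
  have hm: "{h. actX (- h) w \<in> E} \<in> sets borel" for w
  proof -
    have "(\<lambda>h. (- h, w)) \<in> (borel :: 'g measure) \<rightarrow>\<^sub>M borel \<Otimes>\<^sub>M borel" by measurable
    from measurable_compose[OF this X'(6)] have "(\<lambda>h. actX (- h) w) \<in> borel \<rightarrow>\<^sub>M borel" by simp
    from measurable_sets[OF this E] show ?thesis by (simp add: vimage_def)
  qed
  have "AE w in \<nu>. AE h in \<kappa>. actX (- h) w \<notin> E"
    using AE_F
  proof eventually_elim
    case (elim w)
    let ?A = "{h. actX (- h) w \<in> E}"
    have "\<not> 0 < measure \<kappa> ?A"
      using C(2)[OF hm[of w] _ s(3)] elim by (auto simp: F_def)
    then have "?A \<in> null_sets \<kappa>"
      using hm[of w] by (auto simp: null_sets_def s\<kappa> \<kappa>.emeasure_eq_measure not_less measure_le_0_iff)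
    then show ?case by (auto dest: AE_not_in)
  qed
  moreover have "(AE w in \<nu>. AE h in \<kappa>. actX (- h) w \<notin> E) \<longleftrightarrow> (AE h in \<kappa>. AE w in \<nu>. actX (- h) w \<notin> E)"
  proof -
    interpret p: pair_sigma_finite \<nu> \<kappa> ..
    note [measurable_cong] = X'(2)
    have "(\<lambda>q. (- snd q, fst q)) \<in> \<nu> \<Otimes>\<^sub>M \<kappa> \<rightarrow>\<^sub>M borel \<Otimes>\<^sub>M borel" by measurable
    from measurable_compose[OF this X'(6)] have [measurable]: "(\<lambda>q. actX (- snd q) (fst q)) \<in> \<nu> \<Otimes>\<^sub>M \<kappa> \<rightarrow>\<^sub>M borel" by simp
    show ?thesis by (rule p.AE_commute) measurable
  qed
  ultimately have "AE h in \<kappa>. AE w in \<nu>. actX (- h) w \<notin> E" by simp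
  then have "\<exists>h. AE w in \<nu>. actX (- h) w \<notin> E"
  proof -
    assume ae: "AE h in \<kappa>. AE w in \<nu>. actX (- h) w \<notin> E"
    show ?thesis
    proof (rule ccontr)
      assume "\<not> ?thesis"
      with ae have "AE h in \<kappa>. False" by simp
      then show False using nz by (simp add: AE_iff_measurable[OF _ refl] sp\<kappa> s\<kappa> trivial_limit_def[symmetric] ae_filter_eq_bot_iff)
    qed
  qed
  then obtain h where "AE w in \<nu>. actX (- h) w \<notin> E" ..
  then have "actX (- h) -` E \<in> null_sets \<nu>"
    using pre[OF E, of "- h"] AE_iff_null_sets[of "actX (- h) -` E" \<nu>] by (simp add: X'(2))
  then have "E \<in> null_sets \<nu>" using X'(8)[OF E] by simp
  then show ?thesis by auto
qed

section \<open>Relatively measure-preserving maps\<close>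

text \<open>The hypothesis says that the fibre measures satisfy \<open>D y S \<le> c D y T\<close> for almost every \<open>y\<close>. Since the
  action preserves null sets, the same holds at \<open>g y\<close>, where the fibre measure is the translate of
  that at \<open>y\<close>.\<close>
lemma rel_measure_preserving_transfer:
  fixes actX :: "'g::topological_group_add \<Rightarrow> 'x::polish_space \<Rightarrow> 'x"
    and actY :: "'g \<Rightarrow> 'y::polish_space \<Rightarrow> 'y"
  assumes X: "G_space actX \<nu>" and Y: "G_space actY \<eta>" and \<pi>: "G_map actX \<nu> actY \<eta> \<pi>"
    and mp: "rel_measure_preserving actX \<nu> actY \<eta> \<pi>"
    and S: "S \<in> sets borel" and T: "T \<in> sets borel"
    and le: "\<And>C. C \<in> sets borel \<Longrightarrow> emeasure \<nu> (S \<inter> \<pi> -` C) \<le> ennreal c * emeasure \<nu> (T \<inter> \<pi> -` C)"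
    and C: "C \<in> sets borel"
  shows "emeasure \<nu> (actX g -` S \<inter> \<pi> -` C) \<le> ennreal c * emeasure \<nu> (actX g -` T \<inter> \<pi> -` C)"
proof -
  note X' = G_spaceD[OF X] and Y' = G_spaceD[OF Y]
  have \<pi>m: "\<pi> \<in> borel \<rightarrow>\<^sub>M borel" and \<eta>: "distr \<nu> borel \<pi> = \<eta>" using \<pi> by (auto simp: G_map_def)
  interpret \<eta>: prob_space \<eta> by (rule Y')
  obtain D where D: "disintegration \<nu> \<eta> \<pi> D"
    using disintegration_exists[OF X'(1,2) \<pi>m \<eta>] by blast
  note D_int = disintegration_integral[OF D Y'(2,1) \<pi>m]
  note Dm = disintegration_measurable(2)[OF D]
  note Dk = disintegration_kernel[OF D Y'(3)]
  have pre: "actX g -` A \<in> sets borel" if "A \<in> sets borel" for A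
    using measurable_sets[OF X'(7) that, of g] by simp
  have "AE y in \<eta>. emeasure (D y) S \<le> ennreal c * emeasure (D y) T"
  proof (rule AE_le_of_nn_integral_le)
    fix C assume "C \<in> sets \<eta>"
    then have C: "C \<in> sets borel" by (simp add: Y'(2))
    have "(\<integral>\<^sup>+y\<in>C. ennreal c * emeasure (D y) T \<partial>\<eta>) = ennreal c * (\<integral>\<^sup>+y\<in>C. emeasure (D y) T \<partial>\<eta>)"
      by (subst nn_integral_cmult[symmetric]) (use Dm[OF T] C in \<open>auto simp: mult.assoc Y'(2) intro!: borel_measurable_times_ennreal borel_measurable_indicator\<close>)
    then show "(\<integral>\<^sup>+y\<in>C. emeasure (D y) S \<partial>\<eta>) \<le> (\<integral>\<^sup>+y\<in>C. ennreal c * emeasure (D y) T \<partial>\<eta>)"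
      using le[OF C] D_int[OF S C] D_int[OF T C] by simp
  next
    have "(\<integral>\<^sup>+y. emeasure (D y) S \<partial>\<eta>) \<le> (\<integral>\<^sup>+y. 1 \<partial>\<eta>)"
      by (intro nn_integral_mono prob_space.emeasure_le_1 Dk)
    then show "(\<integral>\<^sup>+y. emeasure (D y) S \<partial>\<eta>) < \<infinity>"
      by (simp add: \<eta>.emeasure_space_1 le_less_trans[OF _ ennreal_one_less_top])
  qed (use Dm[OF S] Dm[OF T] in auto)
  then have "AE y in \<eta>. emeasure (D (actY g y)) S \<le> ennreal c * emeasure (D (actY g y)) T"
  proof -
    assume "AE y in \<eta>. emeasure (D y) S \<le> ennreal c * emeasure (D y) T"
    then obtain N where N: "{y \<in> space \<eta>. \<not> emeasure (D y) S \<le> ennreal c * emeasure (D y) T} \<subseteq> N" "N \<in> null_sets \<eta>"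
      by (auto elim!: AE_E simp: null_sets_def)
    then have "actY g -` N \<in> null_sets \<eta>" using Y'(8)[of N g] by (auto simp: null_sets_def Y'(2))
    then show ?thesis by (rule AE_I') (use N(1) in \<open>auto simp: Y'(3)\<close>)
  qed
  moreover have "AE y in \<eta>. D (actY g y) = translate actX g (D y)"
    using mp D unfolding rel_measure_preserving_def by blast
  ultimately have AE: "AE y in \<eta>. emeasure (D y) (actX g -` S) \<le> ennreal c * emeasure (D y) (actX g -` T)"
  proof eventually_elim
    case (elim y)
    have "actX g \<in> D y \<rightarrow>\<^sub>M borel" using X'(7) by (simp cong: measurable_cong_sets add: Dk(2))
    then have "emeasure (translate actX g (D y)) A = emeasure (D y) (actX g -` A)" if "A \<in> sets borel" for A
      using that unfolding translate_def by (simp add: emeasure_distr Dk(3))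
    then show ?case using elim S T by simp
  qed
  have "emeasure \<nu> (actX g -` S \<inter> \<pi> -` C) = (\<integral>\<^sup>+y\<in>C. emeasure (D y) (actX g -` S) \<partial>\<eta>)"
    by (rule D_int[OF pre[OF S] C])
  also have "\<dots> \<le> (\<integral>\<^sup>+y. ennreal c * (emeasure (D y) (actX g -` T) * indicator C y) \<partial>\<eta>)"
    by (intro nn_integral_mono_AE, use AE in eventually_elim) (auto simp: indicator_def)
  also have "\<dots> = ennreal c * (\<integral>\<^sup>+y\<in>C. emeasure (D y) (actX g -` T) \<partial>\<eta>)"
    by (rule nn_integral_cmult) (use Dm[OF pre[OF T]] C in \<open>auto simp: Y'(2) intro!: borel_measurable_times_ennreal borel_measurable_indicator\<close>)
  also have "(\<integral>\<^sup>+y\<in>C. emeasure (D y) (actX g -` T) \<partial>\<eta>) = emeasure \<nu> (actX g -` T \<inter> \<pi> -` C)"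
    by (rule D_int[OF pre[OF T] C, symmetric])
  finally show ?thesis .
qed

section \<open>The commuting square\<close>

locale contractive_preserving_square =
  fixes actX :: "'g::{topological_group_add, second_countable_topology, t2_space} \<Rightarrow> 'x::polish_space \<Rightarrow> 'x"
    and actY :: "'g \<Rightarrow> 'y::polish_space \<Rightarrow> 'y"
    and actZ :: "'g \<Rightarrow> 'z::polish_space \<Rightarrow> 'z"
    and actW :: "'g \<Rightarrow> 'w::polish_space \<Rightarrow> 'w"
    and \<nu> :: "'x measure" and \<eta> :: "'y measure" and \<zeta> :: "'z measure" and \<rho> :: "'w measure"
    and \<psi> :: "'w \<Rightarrow> 'x" and \<tau> :: "'w \<Rightarrow> 'y" and \<pi> :: "'x \<Rightarrow> 'z" and \<phi> :: "'y \<Rightarrow> 'z"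
  assumes lc: "locally_compact_space (euclidean :: 'g topology)"
    and X: "G_space actX \<nu>" and Y: "G_space actY \<eta>" and Z: "G_space actZ \<zeta>" and W: "G_space actW \<rho>"
    and \<psi>: "G_map actW \<rho> actX \<nu> \<psi>" and \<tau>: "G_map actW \<rho> actY \<eta> \<tau>"
    and \<pi>: "G_map actX \<nu> actZ \<zeta> \<pi>" and \<phi>: "G_map actY \<eta> actZ \<zeta> \<phi>"
    and square: "AE w in \<rho>. \<pi> (\<psi> w) = \<phi> (\<tau> w)"
    and \<tau>_preserving: "rel_measure_preserving actW \<rho> actY \<eta> \<tau>"
    and \<pi>_preserving: "rel_measure_preserving actX \<nu> actZ \<zeta> \<pi>"
    and \<psi>_contractive: "rel_contractive actW \<rho> actX \<nu> \<psi>"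
    and \<phi>_contractive: "rel_contractive actY \<eta> actZ \<zeta> \<phi>"
begin

lemmas X' = G_spaceD[OF X] and Y' = G_spaceD[OF Y] and Z' = G_spaceD[OF Z] and W' = G_spaceD[OF W]

lemma maps_measurable [measurable]:
  "\<psi> \<in> borel \<rightarrow>\<^sub>M borel" "\<tau> \<in> borel \<rightarrow>\<^sub>M borel" "\<pi> \<in> borel \<rightarrow>\<^sub>M borel" "\<phi> \<in> borel \<rightarrow>\<^sub>M borel"
  using \<psi> \<tau> \<pi> \<phi> by (auto simp: G_map_def)

lemma maps_distr: "distr \<rho> borel \<psi> = \<nu>" "distr \<rho> borel \<tau> = \<eta>" "distr \<nu> borel \<pi> = \<zeta>" "distr \<eta> borel \<phi> = \<zeta>"
  using \<psi> \<tau> \<pi> \<phi> by (auto simp: G_map_def)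

lemma vimage_borel [measurable]:
  "A \<in> sets borel \<Longrightarrow> \<psi> -` A \<in> sets borel" "B \<in> sets borel \<Longrightarrow> \<tau> -` B \<in> sets borel"
  "A \<in> sets borel \<Longrightarrow> actX g -` A \<in> sets borel" "B \<in> sets borel \<Longrightarrow> actY g -` B \<in> sets borel"
  "E \<in> sets borel \<Longrightarrow> actW g -` E \<in> sets borel"
  "Q \<in> sets borel \<Longrightarrow> \<pi> -` Q \<in> sets borel" "Q \<in> sets borel \<Longrightarrow> \<phi> -` Q \<in> sets borel"
  using measurable_sets[OF maps_measurable(1), of A] measurable_sets[OF maps_measurable(2), of B]
    measurable_sets[OF maps_measurable(3), of Q] measurable_sets[OF maps_measurable(4), of Q]
    measurable_sets[OF X'(7), of A g] measurable_sets[OF Y'(7), of B g] measurable_sets[OF W'(7), of E g]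
  by simp_all

lemma emeasure_factor:
  "A \<in> sets borel \<Longrightarrow> emeasure \<nu> A = emeasure \<rho> (\<psi> -` A)"
  "B \<in> sets borel \<Longrightarrow> emeasure \<eta> B = emeasure \<rho> (\<tau> -` B)"
  "Q \<in> sets borel \<Longrightarrow> emeasure \<zeta> Q = emeasure \<nu> (\<pi> -` Q)"
  "Q \<in> sets borel \<Longrightarrow> emeasure \<zeta> Q = emeasure \<eta> (\<phi> -` Q)"
proof -
  have m: "\<psi> \<in> \<rho> \<rightarrow>\<^sub>M borel" "\<tau> \<in> \<rho> \<rightarrow>\<^sub>M borel" "\<pi> \<in> \<nu> \<rightarrow>\<^sub>M borel" "\<phi> \<in> \<eta> \<rightarrow>\<^sub>M borel"
    using maps_measurable by (simp_all cong: measurable_cong_sets add: X'(2) Y'(2) W'(2))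
  show "A \<in> sets borel \<Longrightarrow> emeasure \<nu> A = emeasure \<rho> (\<psi> -` A)"
    "B \<in> sets borel \<Longrightarrow> emeasure \<eta> B = emeasure \<rho> (\<tau> -` B)"
    "Q \<in> sets borel \<Longrightarrow> emeasure \<zeta> Q = emeasure \<nu> (\<pi> -` Q)"
    "Q \<in> sets borel \<Longrightarrow> emeasure \<zeta> Q = emeasure \<eta> (\<phi> -` Q)"
    using emeasure_distr[OF m(1), of A] emeasure_distr[OF m(2), of B] emeasure_distr[OF m(3), of Q]
      emeasure_distr[OF m(4), of Q]
    by (simp_all add: maps_distr X'(3) Y'(3) W'(3))
qed

lemma AE_translate:
  assumes "AE w in \<rho>. P w" shows "AE w in \<rho>. P (actW g w)"
proof -
  obtain N where N: "{w \<in> space \<rho>. \<not> P w} \<subseteq> N" "N \<in> null_sets \<rho>"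
    using assms by (auto elim!: AE_E simp: null_sets_def)
  then have "actW g -` N \<in> null_sets \<rho>" using W'(8)[of N g] by (auto simp: null_sets_def W'(2))
  then show ?thesis by (rule AE_I') (use N(1) in \<open>auto simp: W'(3)\<close>)
qed

lemma AE_equivariant:
  "AE w in \<rho>. \<psi> (actW g w) = actX g (\<psi> w) \<and> \<tau> (actW g w) = actY g (\<tau> w) \<and>
     \<pi> (\<psi> w) = \<phi> (\<tau> w) \<and> \<pi> (\<psi> (actW g w)) = \<phi> (\<tau> (actW g w))"
proof -
  have "AE w in \<rho>. \<psi> (actW g w) = actX g (\<psi> w)" "AE w in \<rho>. \<tau> (actW g w) = actY g (\<tau> w)"
    using \<psi> \<tau> by (auto simp: G_map_def)
  with square AE_translate[OF square, of g] show ?thesis by eventually_elim simp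
qed

text \<open>Let \<open>B\<close> be the set in question and \<open>Q\<close> the set of \<open>z\<close> where the conditional probability of \<open>A\<close> given
  \<open>Z\<close> is at most \<open>t\<close>, so that \<open>B\<close> lies over \<open>Q\<close>. For each \<open>g\<close>, the translate of \<open>A\<close> fills at least the
  fraction \<open>s\<close> of the translate of \<open>B\<close>, and at most the fraction \<open>t\<close> of the translate of \<open>Q\<close>. Therefore
  the translate of \<open>B\<close> fills at most the fraction \<open>t / s\<close> of the part of \<open>Y\<close> over any subset of \<open>Z\<close>,
  and contraction of \<open>\<phi>\<close> applies.\<close>
lemma conditional_probability_gap_null:
  assumes D: "disintegration \<rho> \<eta> \<tau> D" and K: "disintegration \<nu> \<zeta> \<pi> K"
    and A [measurable]: "A \<in> sets borel" and st: "0 \<le> t" "t < s"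
  shows "emeasure \<eta> {y. ennreal s \<le> emeasure (D y) (\<psi> -` A) \<and> emeasure (K (\<phi> y)) A \<le> ennreal t} = 0"
proof -
  define Q where "Q = {z. emeasure (K z) A \<le> ennreal t}"
  define B where "B = {y. ennreal s \<le> emeasure (D y) (\<psi> -` A)} \<inter> \<phi> -` Q"
  have "{z \<in> space \<zeta>. emeasure (K z) A \<le> ennreal t} \<in> sets \<zeta>"
    using disintegration_measurable(2)[OF K A] by measurable
  then have Q [measurable]: "Q \<in> sets borel" by (simp add: Q_def Z'(2,3))
  have "{y \<in> space \<eta>. ennreal s \<le> emeasure (D y) (\<psi> -` A)} \<in> sets \<eta>"
    using disintegration_measurable(2)[OF D vimage_borel(1)[OF A]] by measurable
  then have B [measurable]: "B \<in> sets borel" by (simp add: B_def Y'(2,3))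
  have s: "0 < s" using st by simp
  have tower_B: "emeasure \<rho> (\<tau> -` B \<inter> \<tau> -` C) \<le> ennreal (1 / s) * emeasure \<rho> (\<psi> -` A \<inter> \<tau> -` B \<inter> \<tau> -` C)"
    if C [measurable]: "C \<in> sets borel" for C
  proof -
    have "ennreal s * emeasure \<rho> (\<tau> -` B \<inter> \<tau> -` C) = ennreal s * emeasure \<eta> (B \<inter> C)"
      by (simp add: emeasure_factor(2))
    also have "\<dots> = (\<integral>\<^sup>+y\<in>B \<inter> C. ennreal s \<partial>\<eta>)"
      by (simp add: nn_integral_cmult_indicator Y'(2))
    also have "\<dots> \<le> (\<integral>\<^sup>+y\<in>B \<inter> C. emeasure (D y) (\<psi> -` A) \<partial>\<eta>)"
      by (intro nn_integral_mono) (auto simp: B_def indicator_def)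
    also have "\<dots> = emeasure \<rho> (\<psi> -` A \<inter> \<tau> -` (B \<inter> C))"
      by (rule disintegration_integral[OF D Y'(2,1) maps_measurable(2), symmetric]) measurable
    also have "\<psi> -` A \<inter> \<tau> -` (B \<inter> C) = \<psi> -` A \<inter> \<tau> -` B \<inter> \<tau> -` C" by auto
    finally have "ennreal (1 / s) * (ennreal s * emeasure \<rho> (\<tau> -` B \<inter> \<tau> -` C)) \<le>
        ennreal (1 / s) * emeasure \<rho> (\<psi> -` A \<inter> \<tau> -` B \<inter> \<tau> -` C)"
      by (rule mult_left_mono) simp
    then show ?thesis using s by (simp add: mult.assoc[symmetric] ennreal_mult[symmetric])
  qed
  have base_Q: "emeasure \<nu> (A \<inter> \<pi> -` Q \<inter> \<pi> -` C) \<le> ennreal t * emeasure \<nu> (\<pi> -` Q \<inter> \<pi> -` C)"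
    if C [measurable]: "C \<in> sets borel" for C
  proof -
    have "emeasure \<nu> (A \<inter> \<pi> -` Q \<inter> \<pi> -` C) = emeasure \<nu> (A \<inter> \<pi> -` (Q \<inter> C))"
      by (rule arg_cong[of _ _ "emeasure \<nu>"]) auto
    also have "\<dots> = (\<integral>\<^sup>+z\<in>Q \<inter> C. emeasure (K z) A \<partial>\<zeta>)"
      by (rule disintegration_integral[OF K Z'(2,1) maps_measurable(3)]) measurable
    also have "\<dots> \<le> (\<integral>\<^sup>+z\<in>Q \<inter> C. ennreal t \<partial>\<zeta>)"
      by (intro nn_integral_mono) (auto simp: Q_def indicator_def)
    also have "\<dots> = ennreal t * emeasure \<zeta> (Q \<inter> C)"
      by (simp add: nn_integral_cmult_indicator Z'(2))
    finally show ?thesis by (simp add: emeasure_factor(3))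
  qed
  have "emeasure \<eta> B = 0"
  proof (rule contractive_null[OF lc Y maps_measurable(4) maps_distr(4) \<phi>_contractive B])
    show "0 \<le> t / s" "t / s < 1" using st by auto
    fix g and C :: "'z set" assume C [measurable]: "C \<in> sets borel"
    have "emeasure \<eta> (actY g -` B \<inter> \<phi> -` C) = emeasure \<rho> (\<tau> -` (actY g -` B \<inter> \<phi> -` C))"
      by (rule emeasure_factor(2)) measurable
    also have "\<dots> = emeasure \<rho> (actW g -` \<tau> -` B \<inter> \<tau> -` \<phi> -` C)"
      by (rule emeasure_eq_AE, use AE_equivariant[of g] in eventually_elim) (auto simp: W'(2))
    also have "\<dots> \<le> ennreal (1 / s) * emeasure \<rho> (actW g -` (\<psi> -` A \<inter> \<tau> -` B) \<inter> \<tau> -` \<phi> -` C)"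
      by (rule rel_measure_preserving_transfer[OF W Y \<tau> \<tau>_preserving]) (use tower_B in auto)
    also have "emeasure \<rho> (actW g -` (\<psi> -` A \<inter> \<tau> -` B) \<inter> \<tau> -` \<phi> -` C) \<le>
        emeasure \<rho> (\<psi> -` (actX g -` (A \<inter> \<pi> -` Q) \<inter> \<pi> -` C))"
      by (rule emeasure_mono_AE, use AE_equivariant[of g] in eventually_elim) (auto simp: W'(2) B_def)
    also have "\<dots> = emeasure \<nu> (actX g -` (A \<inter> \<pi> -` Q) \<inter> \<pi> -` C)"
      by (rule emeasure_factor(1)[symmetric]) measurable
    also have "\<dots> \<le> ennreal t * emeasure \<nu> (actX g -` \<pi> -` Q \<inter> \<pi> -` C)"
      by (rule rel_measure_preserving_transfer[OF X Z \<pi> \<pi>_preserving]) (use base_Q in auto)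
    also have "emeasure \<nu> (actX g -` \<pi> -` Q \<inter> \<pi> -` C) \<le> emeasure \<nu> (\<pi> -` C)"
      by (rule emeasure_mono) (auto simp: X'(2))
    also have "\<dots> = emeasure \<zeta> C" by (simp add: emeasure_factor(3))
    finally have "emeasure \<eta> (actY g -` B \<inter> \<phi> -` C) \<le> ennreal (1 / s) * (ennreal t * emeasure \<zeta> C)"
      by (simp add: mult_left_mono)
    also have "\<dots> = ennreal (t / s) * emeasure \<zeta> C"
      using s st by (simp add: mult.assoc[symmetric] ennreal_mult[symmetric])
    finally show "emeasure \<eta> (actY g -` B \<inter> \<phi> -` C) \<le> ennreal (t / s) * emeasure \<zeta> C" .
  qed
  then show ?thesis by (simp add: B_def Q_def Int_def)
qed

text \<open>Conditional independence of \<open>\<psi>\<close> and \<open>\<tau>\<close> over \<open>Z\<close>. One inequality follows from the preceding lemma by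
  exhausting the gap with rational numbers; both sides have the same integral, so it is an
  equality.\<close>
lemma conditional_probability_base:
  assumes D: "disintegration \<rho> \<eta> \<tau> D" and K: "disintegration \<nu> \<zeta> \<pi> K"
    and A [measurable]: "A \<in> sets borel"
  shows "AE y in \<eta>. emeasure (D y) (\<psi> -` A) = emeasure (K (\<phi> y)) A"
proof -
  interpret \<rho>: prob_space \<rho> by (rule W')
  note [measurable_cong] = Y'(2) Z'(2)
  have K_meas [measurable]: "(\<lambda>z. emeasure (K z) A) \<in> borel_measurable \<zeta>"
    by (rule disintegration_measurable(2)[OF K A])
  have D_meas [measurable]: "(\<lambda>y. emeasure (D y) (\<psi> -` A)) \<in> borel_measurable \<eta>"
    by (rule disintegration_measurable(2)[OF D]) measurable
  have K_meas' [measurable]: "(\<lambda>z. emeasure (K z) A) \<in> borel_measurable borel"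
    using K_meas by (simp cong: measurable_cong_sets add: Z'(2))
  have le: "AE y in \<eta>. emeasure (D y) (\<psi> -` A) \<le> emeasure (K (\<phi> y)) A"
  proof -
    have "AE y in \<eta>. \<not> (ennreal (of_rat s) \<le> emeasure (D y) (\<psi> -` A) \<and> emeasure (K (\<phi> y)) A \<le> ennreal (of_rat t))"
      if st: "0 \<le> t" "t < s" for s t :: rat
    proof -
      let ?B = "{y. ennreal (of_rat s) \<le> emeasure (D y) (\<psi> -` A) \<and> emeasure (K (\<phi> y)) A \<le> ennreal (of_rat t)}"
      have "{y \<in> space \<eta>. ennreal (of_rat s) \<le> emeasure (D y) (\<psi> -` A) \<and> emeasure (K (\<phi> y)) A \<le> ennreal (of_rat t)} \<in> sets \<eta>"
        by measurable
      then have "?B \<in> null_sets \<eta>"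
        using conditional_probability_gap_null[OF D K A, of "of_rat t" "of_rat s"] st
        by (auto simp: null_sets_def Y'(3) of_rat_less)
      then show ?thesis by (auto dest: AE_not_in)
    qed
    then have "AE y in \<eta>. \<forall>s t. 0 \<le> t \<longrightarrow> t < s \<longrightarrow>
        \<not> (ennreal (of_rat s) \<le> emeasure (D y) (\<psi> -` A) \<and> emeasure (K (\<phi> y)) A \<le> ennreal (of_rat t))"
      by (simp add: AE_all_countable)
    then show ?thesis
    proof (rule eventually_mono)
      fix y assume y: "\<forall>s t. 0 \<le> t \<longrightarrow> t < s \<longrightarrow>
        \<not> (ennreal (of_rat s) \<le> emeasure (D y) (\<psi> -` A) \<and> emeasure (K (\<phi> y)) A \<le> ennreal (of_rat t))"
      show "emeasure (D y) (\<psi> -` A) \<le> emeasure (K (\<phi> y)) A"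
      proof (rule ccontr)
        assume "\<not> ?thesis"
        then have "emeasure (K (\<phi> y)) A < emeasure (D y) (\<psi> -` A)" by simp
        then obtain t :: rat where t: "emeasure (K (\<phi> y)) A < ennreal (of_rat t)" "ennreal (of_rat t) < emeasure (D y) (\<psi> -` A)"
          using ennreal_rat_dense by blast
        then obtain s :: rat where s: "ennreal (of_rat t) < ennreal (of_rat s)" "ennreal (of_rat s) < emeasure (D y) (\<psi> -` A)"
          using ennreal_rat_dense by blast
        have "0 < ennreal (of_rat t)" using t(1) by (rule le_less_trans[rotated]) simp
        then have "0 \<le> t" by (simp add: less_imp_le)
        moreover from s(1) this have "t < s" by (simp add: ennreal_less_iff of_rat_less)
        ultimately show False using y s t by (auto dest: less_imp_le)
      qed
    qed
  qed
  have int_D: "(\<integral>\<^sup>+y. emeasure (D y) (\<psi> -` A) \<partial>\<eta>) = emeasure \<nu> A"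
    using disintegration_integral[OF D Y'(2,1) maps_measurable(2) vimage_borel(1)[OF A], of UNIV]
    by (simp add: emeasure_factor(1))
  have "(\<integral>\<^sup>+y. emeasure (K (\<phi> y)) A \<partial>\<eta>) = (\<integral>\<^sup>+z. emeasure (K z) A \<partial>distr \<eta> borel \<phi>)"
    by (rule nn_integral_distr[symmetric]) measurable
  also have "\<dots> = emeasure \<nu> A"
    using disintegration_integral[OF K Z'(2,1) maps_measurable(3) A, of UNIV]
    by (simp add: maps_distr(4))
  finally have int_K: "(\<integral>\<^sup>+y. emeasure (K (\<phi> y)) A \<partial>\<eta>) = emeasure \<nu> A" .
  have fin: "emeasure \<nu> A \<noteq> \<infinity>"
    using emeasure_factor(1)[OF A] by (simp add: \<rho>.emeasure_eq_measure)
  have "(\<integral>\<^sup>+y. emeasure (K (\<phi> y)) A - emeasure (D y) (\<psi> -` A) \<partial>\<eta>) = emeasure \<nu> A - emeasure \<nu> A"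
    unfolding int_K[symmetric]
    by (subst nn_integral_diff) (use le int_D fin in \<open>auto simp: int_K\<close>)
  then have "AE y in \<eta>. emeasure (K (\<phi> y)) A - emeasure (D y) (\<psi> -` A) = 0"
    using fin nn_integral_0_iff_AE[of "\<lambda>y. emeasure (K (\<phi> y)) A - emeasure (D y) (\<psi> -` A)" \<eta>] by simp
  with le show ?thesis by eventually_elim (simp add: diff_eq_0_iff_ennreal antisym)
qed

text \<open>Integrate the conditional probability of \<open>A\<close> over \<open>C\<close>. As it depends on \<open>y\<close> only through \<open>\<phi> y\<close>, the
  integral can be taken over \<open>Z\<close>, where the image of \<open>\<eta>\<close> restricted to \<open>C\<close> has density
  \<open>emeasure (L z) C\<close>.\<close>
lemma joint_law:
  assumes K: "disintegration \<nu> \<zeta> \<pi> K" and L: "disintegration \<eta> \<zeta> \<phi> L"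
    and A [measurable]: "A \<in> sets borel" and C [measurable]: "C \<in> sets borel"
  shows "emeasure \<rho> (\<psi> -` A \<inter> \<tau> -` C) = (\<integral>\<^sup>+z. emeasure (K z) A * emeasure (L z) C \<partial>\<zeta>)"
proof -
  note [measurable_cong] = Y'(2) Z'(2)
  obtain D where D: "disintegration \<rho> \<eta> \<tau> D"
    using disintegration_exists[OF W'(1,2) maps_measurable(2) maps_distr(2)] by blast
  have K_meas [measurable]: "(\<lambda>z. emeasure (K z) A) \<in> borel_measurable \<zeta>"
    by (rule disintegration_measurable(2)[OF K A])
  have K_meas' [measurable]: "(\<lambda>z. emeasure (K z) A) \<in> borel_measurable borel"
    using K_meas by (simp cong: measurable_cong_sets add: Z'(2))
  have L_meas [measurable]: "(\<lambda>z. emeasure (L z) C) \<in> borel_measurable \<zeta>"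
    by (rule disintegration_measurable(2)[OF L C])
  have law: "distr (density \<eta> (indicator C)) borel \<phi> = density \<zeta> (\<lambda>z. emeasure (L z) C)"
  proof (rule measure_eqI)
    fix Q assume "Q \<in> sets (distr (density \<eta> (indicator C)) borel \<phi>)"
    then have Q [measurable]: "Q \<in> sets borel" by simp
    have "emeasure (distr (density \<eta> (indicator C)) borel \<phi>) Q = (\<integral>\<^sup>+y. indicator C y * indicator (\<phi> -` Q) y \<partial>\<eta>)"
      by (simp add: emeasure_distr emeasure_density Y'(3))
    also have "\<dots> = (\<integral>\<^sup>+y. indicator (C \<inter> \<phi> -` Q) y \<partial>\<eta>)"
      by (intro nn_integral_cong) (auto simp: indicator_def)
    also have "\<dots> = emeasure \<eta> (C \<inter> \<phi> -` Q)" by (simp add: Y'(2))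
    also have "\<dots> = (\<integral>\<^sup>+z\<in>Q. emeasure (L z) C \<partial>\<zeta>)"
      by (rule disintegration_integral[OF L Z'(2,1) maps_measurable(4) C Q])
    also have "\<dots> = emeasure (density \<zeta> (\<lambda>z. emeasure (L z) C)) Q"
      by (simp add: emeasure_density)
    finally show "emeasure (distr (density \<eta> (indicator C)) borel \<phi>) Q = emeasure (density \<zeta> (\<lambda>z. emeasure (L z) C)) Q" .
  qed (simp add: Z'(2))
  have "emeasure \<rho> (\<psi> -` A \<inter> \<tau> -` C) = (\<integral>\<^sup>+y\<in>C. emeasure (D y) (\<psi> -` A) \<partial>\<eta>)"
    by (rule disintegration_integral[OF D Y'(2,1) maps_measurable(2)]) measurable
  also have "\<dots> = (\<integral>\<^sup>+y. indicator C y * emeasure (K (\<phi> y)) A \<partial>\<eta>)"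
    by (rule nn_integral_cong_AE, use conditional_probability_base[OF D K A] in eventually_elim) (simp add: mult.commute)
  also have "\<dots> = (\<integral>\<^sup>+y. emeasure (K (\<phi> y)) A \<partial>density \<eta> (indicator C))"
    by (rule nn_integral_density[symmetric]) measurable
  also have "\<dots> = (\<integral>\<^sup>+z. emeasure (K z) A \<partial>distr (density \<eta> (indicator C)) borel \<phi>)"
    by (rule nn_integral_distr[symmetric]) measurable
  also have "\<dots> = (\<integral>\<^sup>+z. emeasure (L z) C * emeasure (K z) A \<partial>\<zeta>)"
    unfolding law by (rule nn_integral_density) measurable
  finally show ?thesis by (simp add: mult.commute)
qed

definition joint :: "'w \<Rightarrow> 'x \<times> 'y" where "joint w = (\<psi> w, \<tau> w)"

lemma joint_measurable [measurable]: "joint \<in> borel \<rightarrow>\<^sub>M borel"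
proof -
  have "joint \<in> borel \<rightarrow>\<^sub>M borel \<Otimes>\<^sub>M borel" unfolding joint_def[abs_def] by measurable
  then show ?thesis by (simp add: borel_prod)
qed

lemma joint_measurable' [measurable]: "joint \<in> \<rho> \<rightarrow>\<^sub>M borel"
  using joint_measurable by (simp cong: measurable_cong_sets add: W'(2))

lemma joint_vimage [measurable]: "B \<in> sets borel \<Longrightarrow> joint -` B \<in> sets borel"
  using measurable_sets[OF joint_measurable, of B] by simp

lemma distr_joint: "distr \<rho> borel joint = rel_joining \<nu> \<eta> \<zeta> \<pi> \<phi>"
proof -
  define K where "K = (SOME D. disintegration \<nu> \<zeta> \<pi> D)"
  define L where "L = (SOME D. disintegration \<eta> \<zeta> \<phi> D)"
  have K: "disintegration \<nu> \<zeta> \<pi> K" unfolding K_def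
    by (rule someI_ex[OF disintegration_exists[OF X'(1,2) maps_measurable(3) maps_distr(3)]])
  have L: "disintegration \<eta> \<zeta> \<phi> L" unfolding L_def
    by (rule someI_ex[OF disintegration_exists[OF Y'(1,2) maps_measurable(4) maps_distr(4)]])
  have Ks: "prob_space (K z)" "sets (K z) = sets borel" for z using disintegration_kernel[OF K Z'(3)] by auto
  have Ls: "prob_space (L z)" "sets (L z) = sets borel" for z using disintegration_kernel[OF L Z'(3)] by auto
  have J: "rel_joining \<nu> \<eta> \<zeta> \<pi> \<phi> = \<zeta> \<bind> (\<lambda>z. K z \<Otimes>\<^sub>M L z)"
    by (simp add: rel_joining_def K_def L_def)
  have m: "(\<lambda>z. K z \<Otimes>\<^sub>M L z) \<in> \<zeta> \<rightarrow>\<^sub>M subprob_algebra (borel \<Otimes>\<^sub>M borel)"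
    by (rule measurable_pair_measure[OF disintegration_measurable(1)[OF K] disintegration_measurable(1)[OF L]])
  have sJ: "sets (rel_joining \<nu> \<eta> \<zeta> \<pi> \<phi>) = sets (borel \<Otimes>\<^sub>M borel)"
    unfolding J by (rule sets_bind) (use Ks Ls in \<open>auto simp: Z'(3) intro!: sets_pair_measure_cong\<close>)
  interpret \<rho>: prob_space \<rho> by (rule W')
  let ?E = "{a \<times> b |a b. a \<in> sets (borel :: 'x measure) \<and> b \<in> sets (borel :: 'y measure)}"
  have gen: "sets (borel \<Otimes>\<^sub>M borel) = sigma_sets UNIV ?E"
    by (simp add: sets_pair_measure)
  show ?thesis
  proof (rule measure_eqI_generator_eq[where E="?E" and \<Omega>=UNIV and A="\<lambda>_. UNIV"])
    show "Int_stable ?E" by (rule Int_stable_pair_measure_generator)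
    show "sets (distr \<rho> borel joint) = sigma_sets UNIV ?E"
      unfolding gen[symmetric] by (simp only: sets_distr borel_prod)
    show "sets (rel_joining \<nu> \<eta> \<zeta> \<pi> \<phi>) = sigma_sets UNIV ?E"
      unfolding gen[symmetric] by (rule sJ)
    show "range (\<lambda>_. UNIV) \<subseteq> ?E" by (auto intro!: exI[of _ UNIV])
    show "emeasure (distr \<rho> borel joint) UNIV \<noteq> \<infinity>" for i :: nat
      by (simp add: emeasure_distr \<rho>.emeasure_eq_measure)
    fix S assume "S \<in> ?E"
    then obtain A C where S: "S = A \<times> C" and A [measurable]: "A \<in> sets borel" and C [measurable]: "C \<in> sets borel"
      by auto
    have S_prod: "S \<in> sets (borel \<Otimes>\<^sub>M borel)" unfolding S by measurable
    then have "S \<in> sets borel" by (simp only: borel_prod)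
    then have "emeasure (distr \<rho> borel joint) S = emeasure \<rho> (joint -` S)"
      by (simp add: emeasure_distr W'(3))
    also have "joint -` S = \<psi> -` A \<inter> \<tau> -` C" by (auto simp: joint_def S)
    also have "emeasure \<rho> (\<psi> -` A \<inter> \<tau> -` C) = (\<integral>\<^sup>+z. emeasure (K z) A * emeasure (L z) C \<partial>\<zeta>)"
      by (rule joint_law[OF K L A C])
    also have "\<dots> = (\<integral>\<^sup>+z. emeasure (K z \<Otimes>\<^sub>M L z) S \<partial>\<zeta>)"
    proof (intro nn_integral_cong)
      fix z
      interpret L: prob_space "L z" by (rule Ls)
      show "emeasure (K z) A * emeasure (L z) C = emeasure (K z \<Otimes>\<^sub>M L z) S"
        unfolding S by (rule L.emeasure_pair_measure_Times[symmetric]) (simp_all add: Ks Ls)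
    qed
    also have "\<dots> = emeasure (rel_joining \<nu> \<eta> \<zeta> \<pi> \<phi>) S"
      unfolding J by (rule emeasure_bind[OF _ m S_prod, symmetric]) (simp add: Z'(3))
    finally show "emeasure (distr \<rho> borel joint) S = emeasure (rel_joining \<nu> \<eta> \<zeta> \<pi> \<phi>) S" .
  qed auto
qed

text \<open>Here the two principles meet on the other side of the square. Testing against products \<open>C\<^sub>0 \<times> A\<close>
  turns the bound given \<open>joint\<close> into inequalities between conditional probabilities over \<open>Y\<close>, one for
  each \<open>C\<^sub>0\<close> in \<open>X\<close>. They survive translation because \<open>\<tau>\<close> is relatively measure-preserving, and then bound
  the conditional probability over \<open>X\<close>.\<close>
lemma partial_conditional_probability_null:
  assumes D: "disintegration \<rho> (distr \<rho> borel joint) joint D"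
    and E [measurable]: "E \<in> sets borel" and c: "0 \<le> c" "c < 1"
  shows "emeasure \<rho> (E \<inter> joint -` {v. emeasure (D v) E \<le> ennreal c}) = 0"
proof -
  let ?\<theta> = "distr \<rho> borel joint"
  interpret \<rho>: prob_space \<rho> by (rule W')
  have s\<theta>: "sets ?\<theta> = sets borel" "prob_space ?\<theta>" by (auto intro: \<rho>.prob_space_distr)
  define B where "B = {v. emeasure (D v) E \<le> ennreal c}"
  have "{v \<in> space ?\<theta>. emeasure (D v) E \<le> ennreal c} \<in> sets ?\<theta>"
    using disintegration_measurable(2)[OF D E] by measurable
  then have B [measurable]: "B \<in> sets borel" by (simp add: B_def)
  have bound: "emeasure \<rho> (E \<inter> joint -` B \<inter> joint -` C) \<le> ennreal c * emeasure \<rho> (joint -` C)"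
    if C [measurable]: "C \<in> sets borel" for C
  proof -
    have "emeasure \<rho> (E \<inter> joint -` B \<inter> joint -` C) = emeasure \<rho> (E \<inter> joint -` (B \<inter> C))"
      by (rule arg_cong[of _ _ "emeasure \<rho>"]) auto
    also have "\<dots> = (\<integral>\<^sup>+v\<in>B \<inter> C. emeasure (D v) E \<partial>?\<theta>)"
      by (rule disintegration_integral[OF D s\<theta> joint_measurable E]) measurable
    also have "\<dots> \<le> (\<integral>\<^sup>+v\<in>C. ennreal c \<partial>?\<theta>)"
      by (intro nn_integral_mono) (auto simp: B_def indicator_def)
    also have "\<dots> = ennreal c * emeasure ?\<theta> C" by (rule nn_integral_cmult_indicator) simp
    finally show ?thesis by (simp add: emeasure_distr W'(3))
  qed
  have "emeasure \<rho> (E \<inter> joint -` B) = 0"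
  proof (rule contractive_null[OF lc W maps_measurable(1) maps_distr(1) \<psi>_contractive _ c])
    show "E \<inter> joint -` B \<in> sets borel" by measurable
    fix g and C :: "'x set" assume C [measurable]: "C \<in> sets borel"
    \<comment> \<open>The set whose preimage under \<open>g\<close> is \<open>C\<close>.\<close>
    define C\<^sub>0 where "C\<^sub>0 = actX (- g) -` C"
    have C\<^sub>0 [measurable]: "C\<^sub>0 \<in> sets borel" unfolding C\<^sub>0_def by measurable
    have C\<^sub>0_iff: "actX g x \<in> C\<^sub>0 \<longleftrightarrow> x \<in> C" for x
      using X'(5)[of "- g" g x] X'(4)[of x] by (simp add: C\<^sub>0_def)
    have "emeasure \<rho> (actW g -` (E \<inter> joint -` B) \<inter> \<psi> -` C) =
        emeasure \<rho> (actW g -` (E \<inter> joint -` B \<inter> \<psi> -` C\<^sub>0) \<inter> \<tau> -` UNIV)"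
      by (rule emeasure_eq_AE, use AE_equivariant[of g] in eventually_elim) (auto simp: W'(2) C\<^sub>0_iff)
    also have "\<dots> \<le> ennreal c * emeasure \<rho> (actW g -` \<psi> -` C\<^sub>0 \<inter> \<tau> -` UNIV)"
    proof (rule rel_measure_preserving_transfer[OF W Y \<tau> \<tau>_preserving])
      fix A :: "'y set" assume A [measurable]: "A \<in> sets borel"
      have "C\<^sub>0 \<times> A \<in> sets (borel \<Otimes>\<^sub>M borel)" by measurable
      then have "C\<^sub>0 \<times> A \<in> sets borel" by (simp only: borel_prod)
      from bound[OF this] show "emeasure \<rho> (E \<inter> joint -` B \<inter> \<psi> -` C\<^sub>0 \<inter> \<tau> -` A) \<le> ennreal c * emeasure \<rho> (\<psi> -` C\<^sub>0 \<inter> \<tau> -` A)"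
        by (simp add: joint_def vimage_def Int_def conj_assoc)
    qed auto
    also have "emeasure \<rho> (actW g -` \<psi> -` C\<^sub>0 \<inter> \<tau> -` UNIV) = emeasure \<rho> (\<psi> -` C)"
      by (rule emeasure_eq_AE, use AE_equivariant[of g] in eventually_elim) (auto simp: W'(2) C\<^sub>0_iff)
    finally show "emeasure \<rho> (actW g -` (E \<inter> joint -` B) \<inter> \<psi> -` C) \<le> ennreal c * emeasure \<nu> C"
      by (simp add: emeasure_factor(1))
  qed
  then show ?thesis by (simp add: B_def)
qed

text \<open>The preceding lemma for \<open>c\<close> tending to 1 shows that the conditional probability of \<open>E\<close> is 1 almost everywhere on \<open>E\<close>.
  Where it is 1, almost every point lies in \<open>E\<close>.\<close>
lemma joint_generates:
  assumes E [measurable]: "E \<in> sets borel"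
  shows "\<exists>B\<in>sets borel. AE w in \<rho>. w \<in> E \<longleftrightarrow> joint w \<in> B"
proof -
  let ?\<theta> = "distr \<rho> borel joint"
  interpret \<rho>: prob_space \<rho> by (rule W')
  have s\<theta>: "sets ?\<theta> = sets borel" "prob_space ?\<theta>" by (auto intro: \<rho>.prob_space_distr)
  obtain D where D: "disintegration \<rho> ?\<theta> joint D"
    using disintegration_exists[OF W'(1,2) joint_measurable refl] by blast
  have Dm: "{v. P (emeasure (D v) E)} \<in> sets borel" if "Measurable.pred borel P" for P
    using measurable_compose[OF disintegration_measurable(2)[OF D E] that] by (simp add: pred_def)
  define B where "B = {v. 1 \<le> emeasure (D v) E}"
  have B [measurable]: "B \<in> sets borel" unfolding B_def by (rule Dm) measurable
  have "AE w in \<rho>. \<not> (w \<in> E \<and> emeasure (D (joint w)) E \<le> ennreal (1 - 1 / Suc n))" for n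
  proof -
    have "E \<inter> joint -` {v. emeasure (D v) E \<le> ennreal (1 - 1 / Suc n)} \<in> sets borel"
      by (intro sets.Int E joint_vimage Dm) measurable
    moreover have "emeasure \<rho> (E \<inter> joint -` {v. emeasure (D v) E \<le> ennreal (1 - 1 / Suc n)}) = 0"
      by (rule partial_conditional_probability_null[OF D E]) auto
    ultimately have "E \<inter> joint -` {v. emeasure (D v) E \<le> ennreal (1 - 1 / Suc n)} \<in> null_sets \<rho>"
      by (auto simp: null_sets_def W'(2))
    then show ?thesis by (auto dest: AE_not_in)
  qed
  then have AE1: "AE w in \<rho>. \<forall>n. \<not> (w \<in> E \<and> emeasure (D (joint w)) E \<le> ennreal (1 - 1 / Suc n))"
    unfolding AE_all_countable by (rule allI)
  have AE2: "AE w in \<rho>. \<not> (w \<in> - E \<and> joint w \<in> B)"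
  proof -
    have "emeasure \<rho> (- E \<inter> joint -` B) = (\<integral>\<^sup>+v\<in>B. emeasure (D v) (- E) \<partial>?\<theta>)"
      by (rule disintegration_integral[OF D s\<theta> joint_measurable]) measurable
    also have "\<dots> = 0"
    proof -
      have zero: "emeasure (D v) (- E) * indicator B v = 0" for v
      proof -
        interpret Dv: prob_space "D v" by (rule disintegration_kernel[OF D]) simp
        have Dv: "sets (D v) = sets borel" "space (D v) = UNIV" using disintegration_kernel[OF D] by auto
        have "Dv.prob (- E) = 1 - Dv.prob E"
          using Dv.prob_compl[of E] by (simp add: Dv Compl_eq_Diff_UNIV)
        then show ?thesis using order.antisym[OF Dv.prob_le_1[of E]]
          by (auto simp: B_def indicator_def Dv.emeasure_eq_measure)
      qed
      have "(\<integral>\<^sup>+v\<in>B. emeasure (D v) (- E) \<partial>?\<theta>) = (\<integral>\<^sup>+v. 0 \<partial>?\<theta>)"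
        by (rule nn_integral_cong) (rule zero)
      then show ?thesis by simp
    qed
    finally have "- E \<inter> joint -` B \<in> null_sets \<rho>" by (auto simp: null_sets_def W'(2))
    then show ?thesis by (auto dest: AE_not_in)
  qed
  have "AE w in \<rho>. w \<in> E \<longleftrightarrow> joint w \<in> B"
    using AE1 AE2
  proof eventually_elim
    case (elim w)
    have "joint w \<in> B" if "w \<in> E"
    proof (rule ccontr)
      interpret Dv: prob_space "D (joint w)" by (rule disintegration_kernel[OF D]) simp
      assume "joint w \<notin> B"
      then have "Dv.prob E < 1" by (simp add: B_def Dv.emeasure_eq_measure not_le)
      then obtain n where "inverse (real (Suc n)) < 1 - Dv.prob E"
        using reals_Archimedean[of "1 - Dv.prob E"] by auto
      then have "Dv.prob E \<le> 1 - 1 / Suc n" by (simp add: inverse_eq_divide)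
      then show False using elim(1) that by (auto simp: Dv.emeasure_eq_measure intro!: ennreal_leI)
    qed
    then show ?case using elim(2) by auto
  qed
  then show ?thesis using B by blast
qed

text \<open>Each bit of the code of \<open>w\<close> can be read off from \<open>joint w\<close>, outside a null set; decoding these bits
  gives the inverse.\<close>
lemma joint_section:
  obtains h where "h \<in> borel \<rightarrow>\<^sub>M borel" "AE w in \<rho>. h (joint w) = w"
proof -
  have "\<forall>k. \<exists>B. B \<in> sets borel \<and> (AE w in \<rho>. w \<in> code_set k \<longleftrightarrow> joint w \<in> B)"
    using joint_generates[OF code_set_borel] by blast
  then obtain B where B: "\<And>k. B k \<in> sets borel" "\<And>k. AE w in \<rho>. w \<in> code_set k \<longleftrightarrow> joint w \<in> B k"
    by metis
  from B(2) have "AE w in \<rho>. \<forall>k. w \<in> code_set k \<longleftrightarrow> joint w \<in> B k" by (simp add: AE_all_countable)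
  then have "AE w in \<rho>. decode (\<lambda>k. joint w \<in> B k) = w"
  proof eventually_elim
    case (elim w)
    then have "(\<lambda>k. joint w \<in> B k) = (\<lambda>k. w \<in> code_set k)" by auto
    then show ?case by (simp add: decode_code)
  qed
  with measurable_decode[OF B(1)] show ?thesis by (rule that)
qed

lemma AE_joint_equivariant:
  "AE w in \<rho>. joint (actW g w) = diagonal_action actX actY g (joint w)"
  using AE_equivariant[of g] by eventually_elim (simp add: joint_def diagonal_action_def)

lemma AE_distr_joint:
  assumes "Measurable.pred borel P"
  shows "(AE v in distr \<rho> borel joint. P v) \<longleftrightarrow> (AE w in \<rho>. P (joint w))"
  using assms by (intro AE_distr_iff) (simp_all add: pred_def)

lemma diagonal_action_measurable:
  "(\<lambda>(g, v). diagonal_action actX actY g v) \<in> borel \<Otimes>\<^sub>M borel \<rightarrow>\<^sub>M borel"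
proof -
  have 1: "(\<lambda>p. (fst p, fst (snd p))) \<in> (borel :: 'g measure) \<Otimes>\<^sub>M (borel \<Otimes>\<^sub>M borel) \<rightarrow>\<^sub>M borel \<Otimes>\<^sub>M (borel :: 'x measure)"
    by measurable
  have 2: "(\<lambda>p. (fst p, snd (snd p))) \<in> (borel :: 'g measure) \<Otimes>\<^sub>M (borel \<Otimes>\<^sub>M borel) \<rightarrow>\<^sub>M borel \<Otimes>\<^sub>M (borel :: 'y measure)"
    by measurable
  have [measurable]: "(\<lambda>p. actX (fst p) (fst (snd p))) \<in> borel \<Otimes>\<^sub>M (borel \<Otimes>\<^sub>M (borel :: 'y measure)) \<rightarrow>\<^sub>M borel"
    "(\<lambda>p. actY (fst p) (snd (snd p))) \<in> borel \<Otimes>\<^sub>M ((borel :: 'x measure) \<Otimes>\<^sub>M borel) \<rightarrow>\<^sub>M borel"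
    using measurable_compose[OF 1 X'(6)] measurable_compose[OF 2 Y'(6)] by simp_all
  have "(\<lambda>p. (actX (fst p) (fst (snd p)), actY (fst p) (snd (snd p)))) \<in> borel \<Otimes>\<^sub>M (borel \<Otimes>\<^sub>M borel) \<rightarrow>\<^sub>M borel \<Otimes>\<^sub>M borel"
    by measurable
  then show ?thesis
    by (simp add: borel_prod diagonal_action_def map_prod_def split_beta')
qed

lemma diagonal_action_vimage:
  assumes "B \<in> sets borel" shows "diagonal_action actX actY g -` B \<in> sets borel"
proof -
  have "(\<lambda>v. (g, v)) \<in> (borel :: ('x \<times> 'y) measure) \<rightarrow>\<^sub>M borel \<Otimes>\<^sub>M borel" by measurable
  from measurable_compose[OF this diagonal_action_measurable] have "diagonal_action actX actY g \<in> borel \<rightarrow>\<^sub>M borel" by simp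
  from measurable_sets[OF this assms] show ?thesis by simp
qed

lemma G_space_joining: "G_space (diagonal_action actX actY) (distr \<rho> borel joint)"
proof -
  interpret \<rho>: prob_space \<rho> by (rule W')
  have "diagonal_action actX actY g -` N \<in> null_sets (distr \<rho> borel joint) \<longleftrightarrow> N \<in> null_sets (distr \<rho> borel joint)"
    if N: "N \<in> sets borel" for g N
  proof -
    have null: "M \<in> null_sets (distr \<rho> borel joint) \<longleftrightarrow> joint -` M \<in> null_sets \<rho>" if "M \<in> sets borel" for M
      using that joint_vimage[OF that] by (auto simp: null_sets_def emeasure_distr W'(2,3))
    have "emeasure \<rho> (joint -` diagonal_action actX actY g -` N) = emeasure \<rho> (actW g -` joint -` N)"
      by (rule emeasure_eq_AE, use AE_joint_equivariant[of g] in eventually_elim)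
         (auto simp: W'(2) N diagonal_action_vimage vimage_borel joint_vimage)
    then have "joint -` diagonal_action actX actY g -` N \<in> null_sets \<rho> \<longleftrightarrow> actW g -` joint -` N \<in> null_sets \<rho>"
      using N by (simp add: null_sets_def W'(2) diagonal_action_vimage vimage_borel joint_vimage)
    then show ?thesis using W'(8)[OF joint_vimage[OF N], of g] null[OF N] null[OF diagonal_action_vimage[OF N]] by simp
  qed
  moreover have "diagonal_action actX actY 0 v = v"
      "diagonal_action actX actY (g + h) v = diagonal_action actX actY g (diagonal_action actX actY h v)" for g h v
    by (cases v, simp add: diagonal_action_def X'(4,5) Y'(4,5))+
  ultimately show ?thesis
    unfolding G_space_def using diagonal_action_measurable \<rho>.prob_space_distr[OF joint_measurable'] by simp
qed

theorem isomorphic_joining: "G_isomorphic actW \<rho> (diagonal_action actX actY) (rel_joining \<nu> \<eta> \<zeta> \<pi> \<phi>)"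
proof -
  let ?\<theta> = "distr \<rho> borel joint"
  obtain h where h [measurable]: "h \<in> borel \<rightarrow>\<^sub>M borel" and h_joint: "AE w in \<rho>. h (joint w) = w"
    by (rule joint_section)
  have d [measurable]: "diagonal_action actX actY g \<in> borel \<rightarrow>\<^sub>M borel" for g
    by (rule measurableI) (simp_all add: diagonal_action_vimage)
  have [measurable]: "actW g \<in> borel \<rightarrow>\<^sub>M borel" for g by (rule W')
  have joint: "G_map actW \<rho> (diagonal_action actX actY) ?\<theta> joint"
    unfolding G_map_def using AE_joint_equivariant by simp
  have inverse: "G_map (diagonal_action actX actY) ?\<theta> actW \<rho> h"
    unfolding G_map_def
  proof (intro conjI allI)
    have "distr ?\<theta> borel h = distr \<rho> borel (h \<circ> joint)"
      by (rule distr_distr) measurable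
    also have "\<dots> = distr \<rho> borel (\<lambda>w. w)"
    proof (rule distr_cong_AE)
      show "AE w in \<rho>. (h \<circ> joint) w = w" using h_joint by simp
      show "h \<circ> joint \<in> \<rho> \<rightarrow>\<^sub>M borel" by (rule measurable_comp[OF joint_measurable' h])
      show "(\<lambda>w. w) \<in> \<rho> \<rightarrow>\<^sub>M borel" by (simp cong: measurable_cong_sets add: W'(2))
    qed simp_all
    also have "\<dots> = \<rho>" by (rule distr_id2) (simp add: W'(2))
    finally show "distr ?\<theta> borel h = \<rho>" .
    fix g
    have "Measurable.pred borel (\<lambda>v. h (diagonal_action actX actY g v) = actW g (h v))" by measurable
    moreover have "AE w in \<rho>. h (diagonal_action actX actY g (joint w)) = actW g (h (joint w))"
      using AE_translate[OF h_joint, of g] h_joint AE_joint_equivariant[of g] by eventually_elim simp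
    ultimately show "AE v in ?\<theta>. h (diagonal_action actX actY g v) = actW g (h v)"
      by (simp add: AE_distr_joint)
  qed (rule h)
  have "Measurable.pred borel (\<lambda>v. joint (h v) = v)" by measurable
  moreover have "AE w in \<rho>. joint (h (joint w)) = joint w" using h_joint by eventually_elim simp
  ultimately have "AE v in ?\<theta>. joint (h v) = v" by (simp add: AE_distr_joint)
  then show ?thesis
    unfolding distr_joint[symmetric] G_isomorphic_def
    using W G_space_joining joint inverse h_joint by blast
qed

end

theorem corollary5p3:
  fixes actX :: "'g::{topological_group_add, second_countable_topology, t2_space} \<Rightarrow> 'x::polish_space \<Rightarrow> 'x"
    and actY :: "'g \<Rightarrow> 'y::polish_space \<Rightarrow> 'y"
    and actZ :: "'g \<Rightarrow> 'z::polish_space \<Rightarrow> 'z"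
    and actW :: "'g \<Rightarrow> 'w::polish_space \<Rightarrow> 'w"
    and \<nu> :: "'x measure" and \<eta> :: "'y measure" and \<zeta> :: "'z measure" and \<rho> :: "'w measure"
    and \<psi> :: "'w \<Rightarrow> 'x" and \<tau> :: "'w \<Rightarrow> 'y" and \<pi> :: "'x \<Rightarrow> 'z" and \<phi> :: "'y \<Rightarrow> 'z"
  assumes "locally_compact_space (euclidean :: 'g topology)"
    and "G_space actX \<nu>" and "G_space actY \<eta>" and "G_space actZ \<zeta>" and "G_space actW \<rho>"
    and "G_map actW \<rho> actX \<nu> \<psi>" and "G_map actW \<rho> actY \<eta> \<tau>"
    and "G_map actX \<nu> actZ \<zeta> \<pi>" and "G_map actY \<eta> actZ \<zeta> \<phi>"
    and "AE w in \<rho>. \<pi> (\<psi> w) = \<phi> (\<tau> w)"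
    and "rel_measure_preserving actW \<rho> actY \<eta> \<tau>"
    and "rel_measure_preserving actX \<nu> actZ \<zeta> \<pi>"
    and "rel_contractive actW \<rho> actX \<nu> \<psi>"
    and "rel_contractive actY \<eta> actZ \<zeta> \<phi>"
  shows "G_isomorphic actW \<rho> (diagonal_action actX actY) (rel_joining \<nu> \<eta> \<zeta> \<pi> \<phi>)"
proof -
  interpret contractive_preserving_square actX actY actZ actW \<nu> \<eta> \<zeta> \<rho> \<psi> \<tau> \<pi> \<phi>
    by (rule contractive_preserving_square.intro) (fact assms)+
  show ?thesis by (rule isomorphic_joining)
qed

end
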